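(* Let $X$ be a complex manifold, $i\colon Y\hookrightarrow X$ a compact complex submanifold, and $L$ a holomorphic line bundle on $X$ whose restriction $L|_Y$ is a unitary flat line bundle on $Y$. Let $r\ge 2$ be an integer. If the generalized first Ueda obstruction class $u_1(Y,X,L)\in H^1(Y,i^*\Omega^1_X)$ is nonzero, then $L$ admits no Hermitian metric of class $C^r$ with semi-positive Chern curvature.
   Context: For $r\ge 2$ a Hermitian metric of class $C^r$ on $L$ has a Chern curvature form with $C^{r-2}$ (in particular continuous) coefficients; it is semi-positive if it is a semi-positive $(1,1)$-form at every point of $X$. A holomorphic line bundle is unitary flat if it can be given by locally constant transition functions with values in $\mathrm{U}(1)$. Generalized first Ueda obstruction class. Let $X$ be a complex manifold, $i\colon Y\hookrightarrow X$ a closed embedding of a reduced analytic subvariety, and $L$ a holomorphic line bundle on $X$. Here $i^{-1}$ denotes the inverse image functor for sheaves of abelian groups, and $i^*\mathcal F:=i^{-1}\mathcal F\otimes_{i^{-1}\mathcal O_X}\mathcal O_Y$ is the inverse image of an $\mathcal O_X$-module $\mathcal F$; there is a canonical morphism $i^{-1}\mathcal F\to i^*\mathcal F$. Let $[L]\in H^1(Y,i^{-1}\mathcal O_X^* )$ be the image of the class of $L$ in $H^1(X,\mathcal O_X^* )$ under the natural map $H^1(X,\mathcal O_X^* )\to H^1(X,i_*i^{-1}\mathcal O_X^* )\simeq H^1(Y,i^{-1}\mathcal O_X^* )$. Let $d\mathcal O_X\subset\Omega^1_X$ be the subsheaf of (locally) exact holomorphic $1$-forms. Then $u_1(Y,X,L)\in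 H^1(Y,i^*\Omega^1_X)$ is the image of $[L]$ under $$H^1(Y,i^{-1}\mathcal O_X^* )\xrightarrow{d\log}H^1(Y,i^{-1}d\mathcal O_X)\to H^1(Y,i^{-1}\Omega_X^1)\to H^1(Y,i^*\Omega_X^1),$$ where $d\log$ is induced by $f\mapsto df/f$, the second map by the inclusion $d\mathcal O_X\hookrightarrow\Omega^1_X$, and the third by $i^{-1}\Omega^1_X\to i^*\Omega^1_X$. *)

theory Defs
  imports "HOL-Analysis.Analysis" "HOL-Algebra.Free_Abelian_Groups" "HOL-Algebra.Module"
begin

section \<open>Complex manifolds and submanifolds\<close>

definition cholo_on :: "(complex^'n::finite) set \<Rightarrow> (complex^'n \<Rightarrow> complex) \<Rightarrow> bool" where
  "cholo_on S f \<longleftrightarrow>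
     (\<forall>z\<in>S. \<exists>D. (f has_derivative D) (at z) \<and> (\<forall>c v. D (c *s v) = c * D v))"

type_synonym ('a, 'n) chart = "'a set \<times> ('a \<Rightarrow> complex^'n)"

definition is_chart :: "'a topology \<Rightarrow> ('a, 'n::finite) chart \<Rightarrow> bool" where
  "is_chart X = (\<lambda>(U, \<phi>). openin X U \<and> open (\<phi> ` U) \<and>
     homeomorphic_map (subtopology X U) (top_of_set (\<phi> ` U)) \<phi>)"

definition transition_holo :: "('a, 'n::finite) chart \<Rightarrow> ('a, 'n) chart \<Rightarrow> bool" where
  "transition_holo = (\<lambda>(U, \<phi>) (V, \<psi>).
     \<forall>i. cholo_on (\<phi> ` (U \<inter> V)) (\<lambda>z. \<psi> (inv_into U \<phi> z) $ i))"

text \<open>The holomorphic structure is a maximal atlas.  Charts are total functions; their values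
  outside their domain are irrelevant.\<close>

definition complex_manifold :: "'a topology \<Rightarrow> ('a, 'n::finite) chart set \<Rightarrow> bool" where
  "complex_manifold X A \<longleftrightarrow>
     Hausdorff_space X \<and> second_countable X \<and>
     (\<forall>c\<in>A. is_chart X c) \<and>
     (\<forall>x\<in>topspace X. \<exists>c\<in>A. x \<in> fst c) \<and>
     (\<forall>c\<in>A. \<forall>d\<in>A. transition_holo c d) \<and>
     (\<forall>c. is_chart X c \<and> (\<forall>d\<in>A. transition_holo c d \<and> transition_holo d c) \<longrightarrow> c \<in> A)"

text \<open>The codimension of \<open>Y\<close> at a point is the number of equations \<open>card I\<close>; it may depend on the
  component of \<open>Y\<close>.\<close>

definition complex_submanifold ::
    "'a topology \<Rightarrow> ('a, 'n::finite) chart set \<Rightarrow> 'a set \<Rightarrow> bool" where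
  "complex_submanifold X A Y \<longleftrightarrow> Y \<subseteq> topspace X \<and>
     (\<forall>y\<in>Y. \<exists>(W, \<phi>)\<in>A. \<exists>I. y \<in> W \<and> \<phi> ` (W \<inter> Y) = {z \<in> \<phi> ` W. \<forall>i\<in>I. z $ i = 0})"

definition holo_fun :: "('a, 'n::finite) chart set \<Rightarrow> 'a set \<Rightarrow> ('a \<Rightarrow> complex) \<Rightarrow> bool" where
  "holo_fun A U f \<longleftrightarrow> (\<forall>(W, \<phi>)\<in>A. cholo_on (\<phi> ` (U \<inter> W)) (\<lambda>z. f (inv_into W \<phi> z)))"

section \<open>Sheaves of abelian groups\<close>

text \<open>A sheaf is represented as a sheaf of functions: a section over \<open>U\<close> is a function on \<open>U\<close> whose
  value at \<open>x\<close> lies in the abelian group \<open>vals F x\<close>, and restriction is restriction of functions.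
  Every sheaf has this form, with its stalks as value groups.  Sections are total functions
  whose values outside \<open>U\<close> are irrelevant.\<close>

record ('a, 's) sheaf =
  vals :: "'a \<Rightarrow> 's monoid"
  sections :: "'a set \<Rightarrow> ('a \<Rightarrow> 's) set"

record ('a, 's) O_module = "('a, 's) sheaf" +
  act :: "complex \<Rightarrow> 's \<Rightarrow> 's"

definition germ :: "'a topology \<Rightarrow> 'a \<Rightarrow> ('a \<Rightarrow> 's) \<Rightarrow> ('a \<Rightarrow> 's) set" where
  "germ T y f = {g. \<exists>N. openin T N \<and> y \<in> N \<and> (\<forall>x\<in>N. g x = f x)}"

definition stalk ::
    "'a topology \<Rightarrow> ('a, 's, 'z) sheaf_scheme \<Rightarrow> 'a \<Rightarrow> ('a \<Rightarrow> 's) set monoid" where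
  "stalk T F y =
     \<lparr> carrier = {germ T y f | U f. openin T U \<and> y \<in> U \<and> f \<in> sections F U},
       mult = (\<lambda>a b. \<Union>f\<in>a. \<Union>g\<in>b. germ T y (\<lambda>x. f x \<otimes>\<^bsub>vals F x\<^esub> g x)),
       one = germ T y (\<lambda>x. \<one>\<^bsub>vals F x\<^esub>) \<rparr>"

text \<open>The functor \<open>i\<inverse>\<close> for the inclusion of a subspace \<open>Y\<close>: sections are the
  functions with values in the stalks of \<open>F\<close> that are locally induced by sections of \<open>F\<close>.\<close>

definition inverse_image ::
    "'a topology \<Rightarrow> 'a set \<Rightarrow> ('a, 's, 'z) sheaf_scheme \<Rightarrow> ('a, ('a \<Rightarrow> 's) set) sheaf" where
  "inverse_image X Y F =
     \<lparr> vals = stalk X F,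
       sections = (\<lambda>V. {s. openin (subtopology X Y) V \<and>
         (\<forall>y\<in>V. \<exists>U f. openin X U \<and> y \<in> U \<and> f \<in> sections F U \<and>
                 (\<forall>z\<in>U \<inter> V. s z = germ X z f))}) \<rparr>"

section \<open>The first cohomology group\<close>

text \<open>\<open>H\<^sup>1\<close> as the direct limit of Cech cohomology over open coverings.  As in Godement, only
  coverings \<open>(U x)\<close> indexed by the points of the space, with \<open>x \<in> U x\<close>, are used.  They are
  cofinal among all open coverings, and any two have the common refinement \<open>U x \<inter> U' x\<close>.  Elements
  of the group are equivalence classes of pairs of a covering and a 1-cocycle on it.\<close>

type_synonym ('a, 's) cochain = "('a \<Rightarrow> 'a set) \<times> ('a \<Rightarrow> 'a \<Rightarrow> 'a \<Rightarrow> 's)"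

definition cocycles :: "'a topology \<Rightarrow> ('a, 's, 'z) sheaf_scheme \<Rightarrow> ('a, 's) cochain set" where
  "cocycles T F = {(U, c).
     (\<forall>x\<in>topspace T. openin T (U x) \<and> x \<in> U x) \<and>
     (\<forall>x\<in>topspace T. \<forall>y\<in>topspace T. c x y \<in> sections F (U x \<inter> U y)) \<and>
     (\<forall>x\<in>topspace T. \<forall>y\<in>topspace T. \<forall>z\<in>topspace T. \<forall>p\<in>U x \<inter> U y \<inter> U z.
        c x y p \<otimes>\<^bsub>vals F p\<^esub> c y z p = c x z p)}"

definition cohomologous ::
    "'a topology \<Rightarrow> ('a, 's, 'z) sheaf_scheme \<Rightarrow> (('a, 's) cochain \<times> ('a, 's) cochain) set" where
  "cohomologous T F = {((U, c), (U', c')).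
     (U, c) \<in> cocycles T F \<and> (U', c') \<in> cocycles T F \<and>
     (\<exists>V b.
        (\<forall>x\<in>topspace T. openin T (V x) \<and> x \<in> V x \<and> V x \<subseteq> U x \<inter> U' x \<and> b x \<in> sections F (V x)) \<and>
        (\<forall>x\<in>topspace T. \<forall>y\<in>topspace T. \<forall>p\<in>V x \<inter> V y.
           b x p \<otimes>\<^bsub>vals F p\<^esub> c' x y p = c x y p \<otimes>\<^bsub>vals F p\<^esub> b y p))}"

definition coh_class ::
    "'a topology \<Rightarrow> ('a, 's, 'z) sheaf_scheme \<Rightarrow> ('a, 's) cochain \<Rightarrow> ('a, 's) cochain set" where
  "coh_class T F u = cohomologous T F `` {u}"

definition H1 :: "'a topology \<Rightarrow> ('a, 's, 'z) sheaf_scheme \<Rightarrow> ('a, 's) cochain set monoid" where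
  "H1 T F =
     \<lparr> carrier = cocycles T F // cohomologous T F,
       mult = (\<lambda>a b. \<Union>(U, c)\<in>a. \<Union>(V, d)\<in>b.
         coh_class T F (\<lambda>x. U x \<inter> V x, \<lambda>x y p. c x y p \<otimes>\<^bsub>vals F p\<^esub> d x y p)),
       one = coh_class T F (\<lambda>x. topspace T, \<lambda>x y p. \<one>\<^bsub>vals F p\<^esub>) \<rparr>"

text \<open>The map into \<open>H1 T G\<close> induced by a sheaf morphism to \<open>G\<close> given by the maps \<open>h p\<close> of value
  groups.\<close>

definition H1_map ::
    "'a topology \<Rightarrow> ('a, 't, 'z) sheaf_scheme \<Rightarrow> ('a \<Rightarrow> 's \<Rightarrow> 't) \<Rightarrow>
     ('a, 's) cochain set \<Rightarrow> ('a, 't) cochain set" where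
  "H1_map T G h a = (\<Union>(U, c)\<in>a. coh_class T G (U, \<lambda>x y p. h p (c x y p)))"

text \<open>The natural map \<open>H\<^sup>1(X, F) \<rightarrow> H\<^sup>1(X, i\<^sub>* i\<inverse> F) \<simeq> H\<^sup>1(Y, i\<inverse> F)\<close>: a cocycle of \<open>F\<close> on a covering
  \<open>U\<close> goes to the cocycle of its germs along \<open>Y\<close>, on the covering of \<open>Y\<close> by the sets
  \<open>U y \<inter> Y\<close>.\<close>

definition H1_restrict ::
    "'a topology \<Rightarrow> 'a set \<Rightarrow> ('a, 's, 'z) sheaf_scheme \<Rightarrow>
     ('a, 's) cochain set \<Rightarrow> ('a, ('a \<Rightarrow> 's) set) cochain set" where
  "H1_restrict X Y F a = (\<Union>(U, c)\<in>a.
     coh_class (subtopology X Y) (inverse_image X Y F)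
       (\<lambda>x. U x \<inter> Y, \<lambda>x y p. germ X p (c x y)))"

section \<open>Structure sheaves and holomorphic 1-forms\<close>

definition add_complex :: "complex monoid" where
  "add_complex = \<lparr> carrier = UNIV, mult = (+), one = 0 \<rparr>"

definition mult_complex :: "complex monoid" where
  "mult_complex = \<lparr> carrier = - {0}, mult = (*), one = 1 \<rparr>"

definition O_sheaf ::
    "'a topology \<Rightarrow> ('a, 'n::finite) chart set \<Rightarrow> ('a, complex) sheaf" where
  "O_sheaf X A =
     \<lparr> vals = (\<lambda>x. add_complex), sections = (\<lambda>U. {f. openin X U \<and> holo_fun A U f}) \<rparr>"

text \<open>The structure sheaf \<open>O\<^sub>X / I\<^sub>Y\<close> of the reduced subspace \<open>Y\<close>: functions that are locally
  restrictions of holomorphic functions on \<open>X\<close>.\<close>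

definition O_sub ::
    "'a topology \<Rightarrow> ('a, 'n::finite) chart set \<Rightarrow> 'a set \<Rightarrow> ('a, complex) sheaf" where
  "O_sub X A Y =
     \<lparr> vals = (\<lambda>x. add_complex),
       sections = (\<lambda>V. {f. openin (subtopology X Y) V \<and>
         (\<forall>y\<in>V. \<exists>U g. y \<in> U \<and> g \<in> sections (O_sheaf X A) U \<and> (\<forall>x\<in>U \<inter> V. f x = g x))}) \<rparr>"

definition units_sheaf :: "('a, complex) sheaf \<Rightarrow> ('a, complex) sheaf" where
  "units_sheaf F =
     \<lparr> vals = (\<lambda>x. mult_complex), sections = (\<lambda>U. {f \<in> sections F U. \<forall>x\<in>U. f x \<noteq> 0}) \<rparr>"

definition cgrad ::
    "('a, 'n::finite) chart \<Rightarrow> ('a \<Rightarrow> complex) \<Rightarrow> 'a \<Rightarrow> complex^'n" where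
  "cgrad = (\<lambda>(W, \<phi>) f x. \<chi> i. deriv (\<lambda>t. f (inv_into W \<phi> (\<phi> x + axis i t))) 0)"

text \<open>A holomorphic cotangent vector at \<open>x\<close> is given by its components in all charts at \<open>x\<close>,
  subject to the transformation rule
  \<open>\<omega>\<^sub>d = (\<Sum>i. \<omega>\<^sub>c\<^sub>,\<^sub>i * \<partial>\<phi>\<^sub>i / \<partial>\<psi>)\<close>
  for charts \<open>c = (W, \<phi>)\<close> and \<open>d = (V, \<psi>)\<close>.\<close>

type_synonym ('a, 'n) covector = "('a, 'n) chart \<Rightarrow> complex^'n"

definition cotangent ::
    "('a, 'n::finite) chart set \<Rightarrow> 'a \<Rightarrow> ('a, 'n) covector set" where
  "cotangent A x = {\<omega>.
     (\<forall>c. \<not> (c \<in> A \<and> x \<in> fst c) \<longrightarrow> \<omega> c = 0) \<and>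
     (\<forall>c\<in>A. \<forall>d\<in>A. x \<in> fst c \<and> x \<in> fst d \<longrightarrow>
        \<omega> d = (\<Sum>i\<in>UNIV. (\<omega> c $ i) *s cgrad d (\<lambda>p. snd c p $ i) x))}"

definition cotangent_group ::
    "('a, 'n::finite) chart set \<Rightarrow> 'a \<Rightarrow> ('a, 'n) covector monoid" where
  "cotangent_group A x =
     \<lparr> carrier = cotangent A x, mult = (\<lambda>\<omega> \<eta> c. \<omega> c + \<eta> c), one = (\<lambda>c. 0) \<rparr>"

definition Omega1 ::
    "'a topology \<Rightarrow> ('a, 'n::finite) chart set \<Rightarrow> ('a, ('a, 'n) covector) O_module" where
  "Omega1 X A =
     \<lparr> vals = cotangent_group A,
       sections = (\<lambda>U. {\<omega>. openin X U \<and> (\<forall>x\<in>U. \<omega> x \<in> cotangent A x) \<and>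
         (\<forall>c\<in>A. \<forall>i. holo_fun A (U \<inter> fst c) (\<lambda>x. \<omega> x c $ i))}),
       act = (\<lambda>a \<omega> c. a *s \<omega> c) \<rparr>"

definition ext_d ::
    "('a, 'n::finite) chart set \<Rightarrow> ('a \<Rightarrow> complex) \<Rightarrow> 'a \<Rightarrow> ('a, 'n) covector" where
  "ext_d A f x = (\<lambda>c. if c \<in> A \<and> x \<in> fst c then cgrad c f x else 0)"

definition dlog ::
    "('a, 'n::finite) chart set \<Rightarrow> ('a \<Rightarrow> complex) \<Rightarrow> 'a \<Rightarrow> ('a, 'n) covector" where
  "dlog A f x = (\<lambda>c. (1 / f x) *s ext_d A f x c)"

definition dO_sheaf ::
    "'a topology \<Rightarrow> ('a, 'n::finite) chart set \<Rightarrow> ('a, ('a, 'n) covector) sheaf" where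
  "dO_sheaf X A =
     \<lparr> vals = cotangent_group A,
       sections = (\<lambda>U. {\<omega>. openin X U \<and>
         (\<forall>x\<in>U. \<exists>N f. x \<in> N \<and> N \<subseteq> U \<and> f \<in> sections (O_sheaf X A) N \<and>
                 (\<forall>y\<in>N. \<omega> y = ext_d A f y))}) \<rparr>"

section \<open>Tensor products and the inverse image of a module\<close>

definition tensor_relations ::
    "'r ring \<Rightarrow> ('r, 'm) module \<Rightarrow> ('r, 'k) module \<Rightarrow> ('m \<times> 'k \<Rightarrow>\<^sub>0 int) set" where
  "tensor_relations R M N =
     {frag_of (m \<oplus>\<^bsub>M\<^esub> m', n) - frag_of (m, n) - frag_of (m', n) | m m' n.
        m \<in> carrier M \<and> m' \<in> carrier M \<and> n \<in> carrier N} \<union>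
     {frag_of (m, n \<oplus>\<^bsub>N\<^esub> n') - frag_of (m, n) - frag_of (m, n') | m n n'.
        m \<in> carrier M \<and> n \<in> carrier N \<and> n' \<in> carrier N} \<union>
     {frag_of (a \<odot>\<^bsub>M\<^esub> m, n) - frag_of (m, a \<odot>\<^bsub>N\<^esub> n) | a m n.
        a \<in> carrier R \<and> m \<in> carrier M \<and> n \<in> carrier N}"

definition tensor_kernel ::
    "'r ring \<Rightarrow> ('r, 'm) module \<Rightarrow> ('r, 'k) module \<Rightarrow> ('m \<times> 'k \<Rightarrow>\<^sub>0 int) set" where
  "tensor_kernel R M N =
     generate (free_Abelian_group (carrier M \<times> carrier N)) (tensor_relations R M N)"

definition tensor_group ::
    "'r ring \<Rightarrow> ('r, 'm) module \<Rightarrow> ('r, 'k) module \<Rightarrow> ('m \<times> 'k \<Rightarrow>\<^sub>0 int) set monoid" where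
  "tensor_group R M N =
     free_Abelian_group (carrier M \<times> carrier N) Mod tensor_kernel R M N"

definition tensor_elem ::
    "'r ring \<Rightarrow> ('r, 'm) module \<Rightarrow> ('r, 'k) module \<Rightarrow> 'm \<Rightarrow> 'k \<Rightarrow> ('m \<times> 'k \<Rightarrow>\<^sub>0 int) set" where
  "tensor_elem R M N m n =
     tensor_kernel R M N #>\<^bsub>free_Abelian_group (carrier M \<times> carrier N)\<^esub> frag_of (m, n)"

definition O_stalk ::
    "'a topology \<Rightarrow> ('a, 'n::finite) chart set \<Rightarrow> 'a \<Rightarrow> ('a \<Rightarrow> complex) set ring" where
  "O_stalk X A y =
     \<lparr> carrier = carrier (stalk X (O_sheaf X A) y),
       mult = (\<lambda>a b. \<Union>f\<in>a. \<Union>g\<in>b. germ X y (\<lambda>x. f x * g x)),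
       one = germ X y (\<lambda>x. 1),
       zero = \<one>\<^bsub>stalk X (O_sheaf X A) y\<^esub>,
       add = mult (stalk X (O_sheaf X A) y) \<rparr>"

text \<open>The ring operations that the record type of modules inherits play no role for modules, so
  they are left undefined.\<close>

definition stalk_module ::
    "'a topology \<Rightarrow> ('a, 's) O_module \<Rightarrow> 'a \<Rightarrow> (('a \<Rightarrow> complex) set, ('a \<Rightarrow> 's) set) module" where
  "stalk_module X F y =
     \<lparr> carrier = carrier (stalk X F y), mult = undefined, one = undefined,
       zero = \<one>\<^bsub>stalk X F y\<^esub>, add = mult (stalk X F y),
       smult = (\<lambda>a m. \<Union>f\<in>a. \<Union>s\<in>m. germ X y (\<lambda>x. act F (f x) (s x))) \<rparr>"

definition O_sub_stalk_module ::
    "'a topology \<Rightarrow> ('a, 'n::finite) chart set \<Rightarrow> 'a set \<Rightarrow> 'a \<Rightarrow>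
     (('a \<Rightarrow> complex) set, ('a \<Rightarrow> complex) set) module" where
  "O_sub_stalk_module X A Y y =
     \<lparr> carrier = carrier (stalk (subtopology X Y) (O_sub X A Y) y),
       mult = undefined, one = undefined,
       zero = \<one>\<^bsub>stalk (subtopology X Y) (O_sub X A Y) y\<^esub>,
       add = mult (stalk (subtopology X Y) (O_sub X A Y) y),
       smult = (\<lambda>a b. \<Union>f\<in>a. \<Union>g\<in>b. germ (subtopology X Y) y (\<lambda>x. f x * g x)) \<rparr>"

definition pullback_stalk ::
    "'a topology \<Rightarrow> ('a, 'n::finite) chart set \<Rightarrow> 'a set \<Rightarrow> ('a, 's) O_module \<Rightarrow> 'a \<Rightarrow>
     (('a \<Rightarrow> 's) set \<times> ('a \<Rightarrow> complex) set \<Rightarrow>\<^sub>0 int) set monoid" where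
  "pullback_stalk X A Y F y =
     tensor_group (O_stalk X A y) (stalk_module X F y) (O_sub_stalk_module X A Y y)"

definition pullback_elem ::
    "'a topology \<Rightarrow> ('a, 'n::finite) chart set \<Rightarrow> 'a set \<Rightarrow> ('a, 's) O_module \<Rightarrow> 'a \<Rightarrow>
     ('a \<Rightarrow> 's) set \<Rightarrow> ('a \<Rightarrow> complex) set \<Rightarrow>
     (('a \<Rightarrow> 's) set \<times> ('a \<Rightarrow> complex) set \<Rightarrow>\<^sub>0 int) set" where
  "pullback_elem X A Y F y =
     tensor_elem (O_stalk X A y) (stalk_module X F y) (O_sub_stalk_module X A Y y)"

text \<open>\<open>i\<^sup>*F\<close> is the sheaf associated with the presheaf tensor product of \<open>i\<inverse> F\<close> and \<open>O\<^sub>Y\<close> over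
  \<open>i\<inverse> O\<^sub>X\<close>: its sections are locally finite sums of elementary tensors of sections.\<close>

definition module_pullback ::
    "'a topology \<Rightarrow> ('a, 'n::finite) chart set \<Rightarrow> 'a set \<Rightarrow> ('a, 's) O_module \<Rightarrow>
     ('a, (('a \<Rightarrow> 's) set \<times> ('a \<Rightarrow> complex) set \<Rightarrow>\<^sub>0 int) set) sheaf" where
  "module_pullback X A Y F =
     \<lparr> vals = pullback_stalk X A Y F,
       sections = (\<lambda>V. {s. openin (subtopology X Y) V \<and>
         (\<forall>y\<in>V. \<exists>N (k::nat) m h. y \<in> N \<and> N \<subseteq> V \<and> openin (subtopology X Y) N \<and>
            (\<forall>j<k. m j \<in> sections (inverse_image X Y F) N \<and> h j \<in> sections (O_sub X A Y) N) \<and>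
            (\<forall>z\<in>N. s z = finprod (pullback_stalk X A Y F z)
               (\<lambda>j. pullback_elem X A Y F z (m j z) (germ (subtopology X Y) z (h j))) {..<k}))}) \<rparr>"

section \<open>Holomorphic line bundles\<close>

text \<open>A line bundle consists of a total space, a projection and a set of local trivializations.  A
  trivialization over \<open>U\<close> is given by its fibre coordinate \<open>\<tau>\<close>.  Transition functions act by
  multiplication, so the trivializations determine the vector space structure of the fibres.\<close>

record ('a, 'e) line_bundle =
  bundle_space :: "'e topology"
  bundle_proj :: "'e \<Rightarrow> 'a"
  bundle_trivs :: "('a set \<times> ('e \<Rightarrow> complex)) set"

definition over :: "('a, 'e) line_bundle \<Rightarrow> 'a set \<Rightarrow> 'e set" where
  "over L U = {e \<in> topspace (bundle_space L). bundle_proj L e \<in> U}"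

definition local_triv ::
    "'a topology \<Rightarrow> ('a, 'e) line_bundle \<Rightarrow> 'a set \<times> ('e \<Rightarrow> complex) \<Rightarrow> bool" where
  "local_triv T L = (\<lambda>(U, \<tau>). openin T U \<and>
     homeomorphic_map (subtopology (bundle_space L) (over L U))
       (prod_topology (subtopology T U) euclidean) (\<lambda>e. (bundle_proj L e, \<tau> e)))"

definition local_frame ::
    "('a, 'e) line_bundle \<Rightarrow> 'a set \<times> ('e \<Rightarrow> complex) \<Rightarrow> 'a \<Rightarrow> 'e" where
  "local_frame L t x = (THE e. e \<in> over L {x} \<and> snd t e = 1)"

definition transition ::
    "('a, 'e) line_bundle \<Rightarrow> 'a set \<times> ('e \<Rightarrow> complex) \<Rightarrow> 'a set \<times> ('e \<Rightarrow> complex) \<Rightarrow> 'a \<Rightarrow> complex" where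
  "transition L t t' x = snd t (local_frame L t' x)"

text \<open>Here and below \<open>S\<close> is the structure sheaf of the base \<open>T\<close>.\<close>

definition trivs_compatible ::
    "('a, complex) sheaf \<Rightarrow> ('a, 'e) line_bundle \<Rightarrow>
     'a set \<times> ('e \<Rightarrow> complex) \<Rightarrow> 'a set \<times> ('e \<Rightarrow> complex) \<Rightarrow> bool" where
  "trivs_compatible S L t t' \<longleftrightarrow>
     transition L t t' \<in> sections (units_sheaf S) (fst t \<inter> fst t') \<and>
     (\<forall>e\<in>over L (fst t \<inter> fst t'). snd t e = transition L t t' (bundle_proj L e) * snd t' e)"

definition holomorphic_line_bundle ::
    "'a topology \<Rightarrow> ('a, complex) sheaf \<Rightarrow> ('a, 'e) line_bundle \<Rightarrow> bool" where
  "holomorphic_line_bundle T S L \<longleftrightarrow>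
     continuous_map (bundle_space L) T (bundle_proj L) \<and>
     (\<forall>t\<in>bundle_trivs L. local_triv T L t) \<and>
     (\<forall>x\<in>topspace T. \<exists>t\<in>bundle_trivs L. x \<in> fst t) \<and>
     (\<forall>t\<in>bundle_trivs L. \<forall>t'\<in>bundle_trivs L. trivs_compatible S L t t')"

definition holo_triv ::
    "'a topology \<Rightarrow> ('a, complex) sheaf \<Rightarrow> ('a, 'e) line_bundle \<Rightarrow>
     'a set \<times> ('e \<Rightarrow> complex) \<Rightarrow> bool" where
  "holo_triv T S L t \<longleftrightarrow> local_triv T L t \<and>
     (\<forall>t'\<in>bundle_trivs L. trivs_compatible S L t t' \<and> trivs_compatible S L t' t)"

definition restrict_bundle :: "('a, 'e) line_bundle \<Rightarrow> 'a set \<Rightarrow> ('a, 'e) line_bundle" where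
  "restrict_bundle L Y =
     \<lparr> bundle_space = subtopology (bundle_space L) (over L Y),
       bundle_proj = bundle_proj L,
       bundle_trivs = (\<lambda>(U, \<tau>). (U \<inter> Y, \<tau>)) ` bundle_trivs L \<rparr>"

definition locally_constant_on :: "'a topology \<Rightarrow> 'a set \<Rightarrow> ('a \<Rightarrow> 'b) \<Rightarrow> bool" where
  "locally_constant_on T U g \<longleftrightarrow>
     (\<forall>x\<in>U. \<exists>N. openin T N \<and> x \<in> N \<and> (\<forall>y\<in>N \<inter> U. g y = g x))"

definition unitary_flat ::
    "'a topology \<Rightarrow> ('a, complex) sheaf \<Rightarrow> ('a, 'e) line_bundle \<Rightarrow> bool" where
  "unitary_flat T S L \<longleftrightarrow> (\<exists>\<T>.
     (\<forall>t\<in>\<T>. holo_triv T S L t) \<and>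
     (\<forall>x\<in>topspace T. \<exists>t\<in>\<T>. x \<in> fst t) \<and>
     (\<forall>t\<in>\<T>. \<forall>t'\<in>\<T>. locally_constant_on T (fst t \<inter> fst t') (transition L t t') \<and>
        (\<forall>x\<in>fst t \<inter> fst t'. cmod (transition L t t' x) = 1)))"

text \<open>The class of \<open>L\<close> in \<open>H\<^sup>1(T, S\<^sup>*)\<close>.  All choices of local trivializations give the same class.\<close>

definition bundle_class ::
    "'a topology \<Rightarrow> ('a, complex) sheaf \<Rightarrow> ('a, 'e) line_bundle \<Rightarrow> ('a, complex) cochain set" where
  "bundle_class T S L =
     (\<Union>t\<in>{t. \<forall>x\<in>topspace T. holo_triv T S L (t x) \<and> x \<in> fst (t x)}.
        coh_class T (units_sheaf S) (\<lambda>x. fst (t x), \<lambda>x y. transition L (t x) (t y)))"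

section \<open>The generalized first Ueda obstruction class\<close>

definition ueda_class ::
    "'a topology \<Rightarrow> ('a, 'n::finite) chart set \<Rightarrow> 'a set \<Rightarrow> ('a, 'e) line_bundle \<Rightarrow>
     ('a, (('a \<Rightarrow> ('a, 'n) covector) set \<times> ('a \<Rightarrow> complex) set \<Rightarrow>\<^sub>0 int) set) cochain set" where
  "ueda_class X A Y L =
     (let T = subtopology X Y;
          L_class = H1_restrict X Y (units_sheaf (O_sheaf X A)) (bundle_class X (O_sheaf X A) L);
          dlog_class =
            H1_map T (inverse_image X Y (dO_sheaf X A)) (\<lambda>p a. \<Union>f\<in>a. germ X p (dlog A f)) L_class;
          Omega_class = H1_map T (inverse_image X Y (Omega1 X A)) (\<lambda>p m. m) dlog_class
      in H1_map T (module_pullback X A Y (Omega1 X A))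
           (\<lambda>p m. pullback_elem X A Y (Omega1 X A) p m (germ T p (\<lambda>x. 1))) Omega_class)"

section \<open>Hermitian metrics and their curvature\<close>

fun Cr_on :: "nat \<Rightarrow> 'v::real_normed_vector set \<Rightarrow> ('v \<Rightarrow> real) \<Rightarrow> bool" where
  "Cr_on 0 S f = continuous_on S f"
| "Cr_on (Suc k) S f =
     ((\<forall>x\<in>S. f differentiable (at x)) \<and> (\<forall>v. Cr_on k S (\<lambda>x. frechet_derivative f (at x) v)))"

text \<open>A metric is a family of Hermitian inner products \<open>h e e'\<close> on the fibres, for \<open>e\<close> and
  \<open>e'\<close> in the same fibre.  The weight is the squared norm of the local frame.\<close>

definition weight ::
    "('a, 'e) line_bundle \<Rightarrow> ('e \<Rightarrow> 'e \<Rightarrow> complex) \<Rightarrow> 'a set \<times> ('e \<Rightarrow> complex) \<Rightarrow> 'a \<Rightarrow> real" where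
  "weight L h t x = Re (h (local_frame L t x) (local_frame L t x))"

definition hermitian_metric ::
    "('a, 'e) line_bundle \<Rightarrow> ('e \<Rightarrow> 'e \<Rightarrow> complex) \<Rightarrow> bool" where
  "hermitian_metric L h \<longleftrightarrow>
     (\<forall>t\<in>bundle_trivs L. \<forall>x\<in>fst t. weight L h t x > 0 \<and>
        (\<forall>e\<in>over L {x}. \<forall>e'\<in>over L {x}.
           h e e' = of_real (weight L h t x) * snd t e * cnj (snd t e')))"

definition metric_of_class ::
    "('a, 'n::finite) chart set \<Rightarrow> ('a, 'e) line_bundle \<Rightarrow> nat \<Rightarrow> ('e \<Rightarrow> 'e \<Rightarrow> complex) \<Rightarrow> bool" where
  "metric_of_class A L r h \<longleftrightarrow>
     (\<forall>t\<in>bundle_trivs L. \<forall>(W, \<phi>)\<in>A.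
        Cr_on r (\<phi> ` (fst t \<inter> W)) (\<lambda>z. weight L h t (inv_into W \<phi> z)))"

definition wirtinger ::
    "'n::finite \<Rightarrow> (complex^'n \<Rightarrow> complex) \<Rightarrow> complex^'n \<Rightarrow> complex" where
  "wirtinger i f z = (frechet_derivative f (at z) (axis i 1)
                      - \<i> * frechet_derivative f (at z) (axis i \<i>)) / 2"

definition wirtinger_bar ::
    "'n::finite \<Rightarrow> (complex^'n \<Rightarrow> complex) \<Rightarrow> complex^'n \<Rightarrow> complex" where
  "wirtinger_bar i f z = (frechet_derivative f (at z) (axis i 1)
                          + \<i> * frechet_derivative f (at z) (axis i \<i>)) / 2"

text \<open>The matrix of coefficients of the Chern curvature form (minus \<open>del\<close> \<open>del-bar\<close> of the logarithm of the weight)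
  in the chart \<open>(W, \<phi>)\<close>, with respect to the forms \<open>dz\<^sub>i \<and> dz-bar\<^sub>j\<close>.\<close>

definition chern_curvature ::
    "('a, 'e) line_bundle \<Rightarrow> ('e \<Rightarrow> 'e \<Rightarrow> complex) \<Rightarrow> 'a set \<times> ('e \<Rightarrow> complex) \<Rightarrow>
     ('a, 'n::finite) chart \<Rightarrow> 'a \<Rightarrow> complex^'n^'n" where
  "chern_curvature L h t = (\<lambda>(W, \<phi>) x. \<chi> i j.
     - wirtinger i (wirtinger_bar j
         (\<lambda>z. of_real (ln (weight L h t (inv_into W \<phi> z))))) (\<phi> x))"

definition semipositive_curvature ::
    "('a, 'n::finite) chart set \<Rightarrow> ('a, 'e) line_bundle \<Rightarrow> ('e \<Rightarrow> 'e \<Rightarrow> complex) \<Rightarrow> bool" where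
  "semipositive_curvature A L h \<longleftrightarrow>
     (\<forall>t\<in>bundle_trivs L. \<forall>c\<in>A. \<forall>x\<in>fst t \<inter> fst c. \<forall>v.
        let q = (\<Sum>i\<in>UNIV. \<Sum>j\<in>UNIV. chern_curvature L h t c x $ i $ j * (v $ i) * cnj (v $ j))
        in q \<in> \<real> \<and> Re q \<ge> 0)"

end

theory Submission
  imports Defs "HOL-Complex_Analysis.Cauchy_Integral_Formula"
begin

text \<open>A unitary flat structure on the restriction of \<open>L\<close> to \<open>Y\<close> has frames whose square norm \<open>G\<close>, for a
  given metric on \<open>L\<close>, does not depend on the frame.  If the curvature is semi-positive, then \<open>- log G\<close> is
  plurisubharmonic on the compact manifold \<open>Y\<close>, so \<open>G\<close> is locally constant by the strong maximum
  principle.  Hence the curvature form vanishes on the tangent vectors of \<open>Y\<close>, and being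
  semi-positive it vanishes as soon as one of its two arguments is tangent to \<open>Y\<close>.  This says that the
  coefficients of the forms \<open>\<partial> log |e|\<^sup>2\<close>, for local frames \<open>e\<close> of \<open>L\<close>, are holomorphic along \<open>Y\<close>.  These
  forms differ by the logarithmic derivatives of the transition functions, so that they
  define sections of the pullback of the cotangent sheaf whose coboundary is the Ueda cocycle.\<close>

section \<open>Complex differentiability in several variables\<close>

text \<open>The class lives in the forms of \<open>X\<close> along \<open>Y\<close>, so flatness in
  the directions of \<open>Y\<close> alone would not suffice: the components of the connection form
  normal to \<open>Y\<close> must also be holomorphic along \<open>Y\<close>. They are, because a
  semi-positive Hermitian matrix with a zero on its diagonal has a zero row, and semi-positivity is
  available for all tangent vectors of \<open>X\<close>. Two obstacles shape the rest. First,
  \<open>Y\<close> may be disconnected, so a minimum of \<open>G\<close> over \<open>Y\<close>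
  settles only one component; the minimum is taken instead over the points of \<open>Y\<close> near
  which \<open>G\<close> is not known to be constant. Secondly, the connection form is in general
  not holomorphic off \<open>Y\<close> and hence is no section of \<open>Omega1 X A\<close>. Its
  coefficients are therefore extended from \<open>Y\<close> through the projection of an adapted
  chart onto the coordinate plane of \<open>Y\<close>, and the bounding cochain is a sum of tensors
  of the \<open>dz_j\<close> with these coefficients. The change from local weights to
  \<open>G\<close> costs nothing, since both differ by the factor \<open>(cmod F)\<^sup>2\<close>
  with \<open>F\<close> holomorphic and without zeros, whose logarithm is harmonic on complex
  lines.\<close>

definition cdiff_at :: "(complex^'n::finite \<Rightarrow> complex) \<Rightarrow> complex^'n \<Rightarrow> bool" where
  "cdiff_at f z \<longleftrightarrow> (\<exists>D. (f has_derivative D) (at z) \<and> (\<forall>c v. D (c *s v) = c * D v))"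

text \<open>A one-variable \<open>deriv\<close>, so that the components of \<open>cgrad\<close>
  unfold to it and the one-variable Cauchy formula applies.\<close>

definition cpartial :: "'n::finite \<Rightarrow> (complex^'n \<Rightarrow> complex) \<Rightarrow> complex^'n \<Rightarrow> complex" where
  "cpartial i f z = deriv (\<lambda>t. f (z + axis i t)) 0"

lemma cholo_on_iff: "cholo_on S f \<longleftrightarrow> (\<forall>z\<in>S. cdiff_at f z)"
  by (simp add: cholo_on_def cdiff_at_def)

lemma axis_eq_smult: "axis i c = c *s (axis i 1 :: complex^'n::finite)"
  by (simp add: vec_eq_iff axis_def)

lemma norm_axis_complex [simp]: "norm (axis i c :: complex^'n::finite) = norm c"
proof -
  have "(axis i c :: complex^'n) \<bullet> axis i c = c \<bullet> c"
    by (simp add: inner_axis_axis)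
  then show ?thesis
    by (simp add: norm_eq_sqrt_inner)
qed

lemma linear_axis: "linear (axis i :: complex \<Rightarrow> complex^'n::finite)"
  by (rule linearI) (simp_all add: vec_eq_iff axis_def)

lemma bounded_linear_axis: "bounded_linear (axis i :: complex \<Rightarrow> complex^'n::finite)"
  by (rule linear_conv_bounded_linear[THEN iffD1, OF linear_axis])

lemma axis_zero [simp]: "axis i (0::complex) = 0"
  by simp

lemma sum_axis_complex: "(\<Sum>i\<in>UNIV. axis i (v $ i)) = (v :: complex^'n::finite)"
  by (simp add: vec_eq_iff axis_def sum.delta)

lemma linear_smult_vec_left: "linear (\<lambda>c. c *s (v :: complex^'n::finite))"
  by (rule linearI) (simp_all add: vec_eq_iff algebra_simps)

lemma cdiff_atE:
  assumes "cdiff_at f z"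
  obtains D where "(f has_derivative D) (at z)" "\<And>c v. D (c *s v) = c * D v"
  using assms unfolding cdiff_at_def by blast

lemma cdiff_atI: "(f has_derivative D) (at z) \<Longrightarrow> (\<And>c v. D (c *s v) = c * D v) \<Longrightarrow> cdiff_at f z"
  unfolding cdiff_at_def by blast

lemma cdiff_at_const [simp]: "cdiff_at (\<lambda>z. c) z"
  by (rule cdiff_atI[of _ "\<lambda>v. 0"]) auto

lemma cdiff_at_nth [simp]: "cdiff_at (\<lambda>z. z $ i) z"
  by (rule cdiff_atI[of _ "\<lambda>v. v $ i"])
    (auto intro!: bounded_linear.has_derivative[OF bounded_linear_vec_nth] derivative_eq_intros)

lemma cdiff_at_add: "cdiff_at f z \<Longrightarrow> cdiff_at g z \<Longrightarrow> cdiff_at (\<lambda>z. f z + g z) z"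
proof (elim cdiff_atE)
  fix D D' assume D: "(f has_derivative D) (at z)" "\<And>c v. D (c *s v) = c * D v"
    and D': "(g has_derivative D') (at z)" "\<And>c v. D' (c *s v) = c * D' v"
  show ?thesis
    by (rule cdiff_atI[OF has_derivative_add[OF D(1) D'(1)]]) (simp add: D D' algebra_simps)
qed

lemma cdiff_at_mult: "cdiff_at f z \<Longrightarrow> cdiff_at g z \<Longrightarrow> cdiff_at (\<lambda>z. f z * g z) z"
proof (elim cdiff_atE)
  fix D D' assume D: "(f has_derivative D) (at z)" "\<And>c v. D (c *s v) = c * D v"
    and D': "(g has_derivative D') (at z)" "\<And>c v. D' (c *s v) = c * D' v"
  show ?thesis
    by (rule cdiff_atI[OF has_derivative_mult[OF D(1) D'(1)]]) (simp add: D D' algebra_simps)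
qed

lemma cdiff_at_minus: "cdiff_at f z \<Longrightarrow> cdiff_at (\<lambda>z. - f z) z"
  using cdiff_at_mult[OF cdiff_at_const[of "-1"], of f z] by simp

lemma cdiff_at_compose_field:
  assumes "cdiff_at f z" and "(g has_field_derivative g') (at (f z))"
  shows "cdiff_at (\<lambda>z. g (f z)) z"
proof -
  obtain D where D: "(f has_derivative D) (at z)" "\<And>c v. D (c *s v) = c * D v"
    using assms(1) by (rule cdiff_atE) blast
  have "((\<lambda>z. g (f z)) has_derivative (\<lambda>v. g' * D v)) (at z)"
    using has_derivative_compose[OF D(1), of g "(*) g'"] assms(2)
    by (simp add: has_field_derivative_def)
  then show ?thesis
    by (rule cdiff_atI) (simp add: D)
qed

lemma cdiff_at_cong:
  assumes "cdiff_at f z" and "open N" "z \<in> N" "\<And>w. w \<in> N \<Longrightarrow> g w = f w"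
  shows "cdiff_at g z"
  using assms unfolding cdiff_at_def by (metis has_derivative_transform_within_open)

lemma cdiff_at_continuous: "cdiff_at f z \<Longrightarrow> isCont f z"
  by (elim cdiff_atE) (rule has_derivative_continuous)

lemma has_derivative_vec_complex:
  fixes g :: "'v::real_normed_vector \<Rightarrow> complex^'m::finite"
  assumes "\<And>i. ((\<lambda>z. g z $ i) has_derivative D i) F"
  shows "(g has_derivative (\<lambda>v. \<chi> i. D i v)) F"
proof -
  have "((\<lambda>z. \<Sum>i\<in>UNIV. axis i (g z $ i)) has_derivative (\<lambda>v. \<Sum>i\<in>UNIV. axis i (D i v))) F"
    by (intro has_derivative_sum bounded_linear.has_derivative[OF bounded_linear_axis] assms)
  moreover have "(\<Sum>i\<in>UNIV. axis i (D i v)) = (\<chi> i. D i v)" for v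
    using sum_axis_complex[of "\<chi> i. D i v"] by simp
  ultimately show ?thesis
    by (simp add: sum_axis_complex)
qed

lemma cdiff_at_compose:
  fixes g :: "complex^'m::finite \<Rightarrow> complex^'n::finite"
  assumes "cdiff_at f (g z)" and "\<And>i. cdiff_at (\<lambda>w. g w $ i) z"
  shows "cdiff_at (\<lambda>w. f (g w)) z"
proof -
  obtain D where D: "(f has_derivative D) (at (g z))" "\<And>c v. D (c *s v) = c * D v"
    using assms(1) by (rule cdiff_atE) blast
  have "\<forall>i. \<exists>E. ((\<lambda>w. g w $ i) has_derivative E) (at z) \<and> (\<forall>c v. E (c *s v) = c * E v)"
    using assms(2) unfolding cdiff_at_def by blast
  then obtain E where E: "\<And>i. ((\<lambda>w. g w $ i) has_derivative E i) (at z)"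
      "\<And>i c v. E i (c *s v) = c * E i v"
    by metis
  have "((\<lambda>w. f (g w)) has_derivative (\<lambda>v. D (\<chi> i. E i v))) (at z)"
    by (rule has_derivative_compose[OF has_derivative_vec_complex[OF E(1)] D(1)])
  moreover have "(\<chi> i. E i (c *s v)) = c *s (\<chi> i. E i v)" for c v
    by (simp add: vec_eq_iff E)
  ultimately show ?thesis
    by (intro cdiff_atI) (auto simp: D)
qed

text \<open>A derivative that commutes with \<open>*s\<close> is determined by its values on the
  vectors \<open>axis i 1\<close>, and these are derivatives of functions of one complex
  variable.\<close>

lemma has_derivative_cpartial:
  assumes D: "(f has_derivative D) (at z)" and lin: "\<And>c v. D (c *s v) = c * D v"
  shows "((\<lambda>t. f (z + axis i t)) has_field_derivative D (axis i 1)) (at 0)"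
    and "cpartial i f z = D (axis i 1)"
    and "D v = (\<Sum>i\<in>UNIV. v $ i * cpartial i f z)"
proof -
  have *: "((\<lambda>t. f (z + axis i t)) has_field_derivative D (axis i 1)) (at 0)" for i
  proof -
    have ax: "((\<lambda>t. z + axis i t) has_derivative axis i) (at 0)"
      by (auto intro!: derivative_eq_intros bounded_linear.has_derivative[OF bounded_linear_axis])
    have "((\<lambda>t. f (z + axis i t)) has_derivative (\<lambda>t. D (axis i t))) (at 0)"
      using has_derivative_compose[OF ax, of f D] D by simp
    moreover have "(\<lambda>t. D (axis i t)) = (*) (D (axis i 1))"
      by (rule ext, subst axis_eq_smult) (simp only: lin mult.commute)
    ultimately show ?thesis
      by (simp only: has_field_derivative_def)
  qed
  show "((\<lambda>t. f (z + axis i t)) has_field_derivative D (axis i 1)) (at 0)"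
    by (rule *)
  have c: "cpartial i f z = D (axis i 1)" for i
    unfolding cpartial_def by (rule DERIV_imp_deriv[OF *])
  then show "cpartial i f z = D (axis i 1)" .
  have "D v = D (\<Sum>i\<in>UNIV. axis i (v $ i))"
    by (simp add: sum_axis_complex)
  also have "\<dots> = (\<Sum>i\<in>UNIV. D (axis i (v $ i)))"
    using has_derivative_linear[OF D] by (rule linear_sum)
  also have "\<dots> = (\<Sum>i\<in>UNIV. v $ i * cpartial i f z)"
  proof (rule sum.cong)
    fix i
    show "D (axis i (v $ i)) = v $ i * cpartial i f z"
      by (subst axis_eq_smult) (simp only: lin c)
  qed simp
  finally show "D v = (\<Sum>i\<in>UNIV. v $ i * cpartial i f z)" .
qed

lemma cdiff_at_has_derivative:
  "cdiff_at f z \<Longrightarrow> (f has_derivative (\<lambda>v. \<Sum>i\<in>UNIV. v $ i * cpartial i f z)) (at z)"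
  by (elim cdiff_atE) (metis (no_types, lifting) ext has_derivative_cpartial(3))

lemma cpartial_eqI:
  assumes "(f has_derivative (\<lambda>v. \<Sum>i\<in>UNIV. v $ i * a i)) (at z)"
  shows "cpartial i f z = a i"
proof -
  have "cpartial i f z = (\<Sum>k\<in>UNIV. axis i 1 $ k * a k)"
    by (rule has_derivative_cpartial(2)[OF assms]) (simp add: sum_distrib_left mult.assoc)
  also have "\<dots> = (\<Sum>k\<in>UNIV. if k = i then a k else 0)"
    by (intro sum.cong) (auto simp: axis_def)
  finally show ?thesis by simp
qed

lemma cpartial_cong:
  assumes "open N" "z \<in> N" "\<And>w. w \<in> N \<Longrightarrow> f w = g w"
  shows "cpartial i f z = cpartial i g z"
proof -
  have "((\<lambda>t. z + axis i t) \<longlongrightarrow> z + axis i 0) (at 0)"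
    by (intro tendsto_intros bounded_linear.tendsto[OF bounded_linear_axis])
  then have "((\<lambda>t. z + axis i t) \<longlongrightarrow> z) (nhds 0)"
    using tendsto_at_iff_tendsto_nhds[of "\<lambda>t. z + axis i t" 0] by simp
  then have "\<forall>\<^sub>F t in nhds 0. z + axis i t \<in> N"
    using assms(1,2) by (rule topological_tendstoD)
  then have "\<forall>\<^sub>F t in nhds 0. f (z + axis i t) = g (z + axis i t)"
    by eventually_elim (rule assms(3))
  then show ?thesis
    unfolding cpartial_def by (rule deriv_cong_ev) simp
qed

section \<open>Cauchy's formula and the holomorphy of partial derivatives\<close>

lemma Cauchy_first_derivative_integral:
  assumes hol: "g holomorphic_on ball 0 s" and r: "0 < r" "r < s"
  shows "((\<lambda>\<theta>. g (circlepath 0 r \<theta>) / circlepath 0 r \<theta>) has_integral deriv g 0) {0..1}"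
proof -
  have "((\<lambda>u. g u / (u - 0) ^ Suc 1) has_contour_integral ((2 * pi * \<i>) / fact 1 * (deriv ^^ 1) g 0))
        (circlepath 0 r)"
    using r by (intro Cauchy_has_contour_integral_higher_derivative_circlepath
        holomorphic_on_imp_continuous_on holomorphic_on_subset[OF hol]) auto
  then have "((\<lambda>\<theta>. g (circlepath 0 r \<theta>) / circlepath 0 r \<theta> ^ 2 *
       vector_derivative (circlepath 0 r) (at \<theta>)) has_integral (2 * pi * \<i> * deriv g 0)) {0..1}"
    by (simp add: has_contour_integral power2_eq_square)
  then have "((\<lambda>\<theta>. (g (circlepath 0 r \<theta>) / circlepath 0 r \<theta> ^ 2 *
       vector_derivative (circlepath 0 r) (at \<theta>)) / (2 * pi * \<i>)) has_integral
       (2 * pi * \<i> * deriv g 0) / (2 * pi * \<i>)) {0..1}"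
    by (rule has_integral_divide)
  \<comment> \<open>The derivative of a circle centred at 0 is \<open>2 * pi * \<i>\<close> times
    the circle itself; it cancels the normalising constant and one of the two powers in the
    denominator.\<close>
  moreover have "(g (circlepath 0 r \<theta>) / circlepath 0 r \<theta> ^ 2 *
       vector_derivative (circlepath 0 r) (at \<theta>)) / (2 * pi * \<i>) =
       g (circlepath 0 r \<theta>) / circlepath 0 r \<theta>" for \<theta>
    unfolding vector_derivative_circlepath
    using r by (simp add: circlepath power2_eq_square field_simps)
  ultimately show ?thesis by simp
qed

text \<open>Cauchy's formula on the complex line through \<open>z\<close> in the direction of the
  coordinate \<open>i\<close>. It expresses a derivative by values of \<open>f\<close> only, so that
  continuity and differentiability in \<open>z\<close> can be studied under the integral
  sign.\<close>

lemma cpartial_integral: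
  fixes f :: "complex^'n::finite \<Rightarrow> complex"
  assumes f: "\<And>w. w \<in> ball z s \<Longrightarrow> cdiff_at f w" and r: "0 < r" "r < s"
  shows "((\<lambda>\<theta>. f (z + axis i (circlepath 0 r \<theta>)) / circlepath 0 r \<theta>) has_integral cpartial i f z) {0..1}"
proof -
  have "(\<lambda>t. f (z + axis i t)) holomorphic_on ball 0 s"
  proof (unfold holomorphic_on_def, rule ballI)
    fix t :: complex assume t: "t \<in> ball 0 s"
    then have "cdiff_at f (z + axis i t)"
      by (intro f) (simp add: dist_norm)
    then obtain D where D: "(f has_derivative D) (at (z + axis i t))" "\<And>c v. D (c *s v) = c * D v"
      by (rule cdiff_atE) blast
    have "((\<lambda>u. f (z + axis i t + axis i u)) has_field_derivative D (axis i 1)) (at 0)"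
      by (rule has_derivative_cpartial(1)[OF D])
    moreover have "z + axis i t + axis i u = z + axis i (u + t)" for u
      by (simp add: vec_eq_iff axis_def)
    ultimately have "((\<lambda>u. f (z + axis i u)) has_field_derivative D (axis i 1)) (at (0 + t))"
      by (subst DERIV_shift) (simp only:)
    then show "(\<lambda>u. f (z + axis i u)) field_differentiable at t within ball 0 s"
      by (metis add.left_neutral field_differentiable_at_within field_differentiable_def)
  qed
  then show ?thesis
    unfolding cpartial_def by (rule Cauchy_first_derivative_integral[OF _ r])
qed

lemma circlepath_at_zero: "0 < r \<Longrightarrow> norm (circlepath 0 r \<theta>) = r" "0 < r \<Longrightarrow> circlepath 0 r \<theta> \<noteq> 0"
  by (simp_all add: circlepath norm_mult)

lemma continuous_on_circlepath_real: "continuous_on S (circlepath 0 r)"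
  unfolding circlepath by (intro continuous_intros)

text \<open>By Cauchy's formula the partial derivative is a parameter integral whose integrand is
  jointly continuous in the centre and the angle, because \<open>f\<close> is continuous.\<close>

lemma continuous_on_cpartial:
  fixes f :: "complex^'n::finite \<Rightarrow> complex"
  assumes "open S" "cholo_on S f"
  shows "continuous_on S (cpartial i f)"
proof (rule continuous_at_imp_continuous_on, rule ballI)
  fix z assume "z \<in> S"
  then obtain e where e: "e > 0" "ball z e \<subseteq> S"
    using assms(1) openE by blast
  \<comment> \<open>Centres range over \<open>ball z r\<close>, and Cauchy's formula is applied on
    \<open>ball w (2 * r)\<close>; the sum \<open>3 * r\<close> of the radii stays below
    \<open>e\<close>.\<close>
  define r where "r = e / 4"
  have r: "r > 0" using e by (simp add: r_def)
  have f: "cdiff_at f w" if "w \<in> ball z e" for w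
    using assms(2) that e by (auto simp: cholo_on_iff)
  have contf: "continuous_on (ball z e) f"
    by (intro continuous_at_imp_continuous_on ballI cdiff_at_continuous f)
  have "integral (cbox 0 1) (\<lambda>\<theta>. f (w + axis i (circlepath 0 r \<theta>)) / circlepath 0 r \<theta>) = cpartial i f w"
    if "w \<in> ball z r" for w
  proof -
    have "cdiff_at f u" if "u \<in> ball w (2 * r)" for u
      using \<open>w \<in> ball z r\<close> that dist_triangle[of z u w] r by (intro f) (auto simp: r_def)
    then show ?thesis
      using cpartial_integral[of w "2 * r" f r i] r by (simp add: integral_unique)
  qed
  moreover have "continuous_on (ball z r)
      (\<lambda>w. integral (cbox 0 1) (\<lambda>\<theta>. f (w + axis i (circlepath 0 r \<theta>)) / circlepath 0 r \<theta>))"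
  proof (rule integral_continuous_on_param)
    have "z' + axis i (circlepath 0 r \<theta>) \<in> ball z e" if "z' \<in> ball z r" for z' \<theta>
      using that r dist_triangle[of z "z' + axis i (circlepath 0 r \<theta>)" z']
        circlepath_at_zero(1)[OF r, of \<theta>]
      by (auto simp: r_def dist_norm)
    then show "continuous_on (ball z r \<times> cbox 0 1)
      (\<lambda>(w, \<theta>). f (w + axis i (circlepath 0 r \<theta>)) / circlepath 0 r \<theta>)"
      unfolding split_beta
      by (intro continuous_intros continuous_on_compose2[OF contf]
          continuous_on_compose2[OF continuous_on_circlepath_real[of UNIV r]]
          bounded_linear.continuous_on[OF bounded_linear_axis])
        (auto simp: circlepath_at_zero(2)[OF r])
  qed
  ultimately have "continuous_on (ball z r) (cpartial i f)"
    by (rule continuous_on_eq[rotated])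
  then show "isCont (cpartial i f) z"
    using r by (simp add: continuous_on_eq_continuous_at)
qed

text \<open>Differentiation under Cauchy's integral for the derivative, which is legitimate because the
  same integral first shows that the partial derivatives are continuous.\<close>

lemma cholo_on_cpartial:
  fixes f :: "complex^'n::finite \<Rightarrow> complex"
  assumes "open S" "cholo_on S f"
  shows "cholo_on S (cpartial i f)"
  unfolding cholo_on_iff
proof
  fix z assume "z \<in> S"
  then obtain e where e: "e > 0" "ball z e \<subseteq> S"
    using assms(1) openE by blast
  define r where "r = e / 4"
  have r: "r > 0" using e by (simp add: r_def)
  have f: "cdiff_at f w" if "w \<in> ball z e" for w
    using assms(2) that e by (auto simp: cholo_on_iff)
  have contp: "continuous_on (ball z e) (cpartial j f)" for j
    using continuous_on_cpartial[OF assms] continuous_on_subset e(2) by blast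
  have contf: "continuous_on (ball z e) f"
    by (intro continuous_at_imp_continuous_on ballI cdiff_at_continuous f)
  define p where "p = circlepath 0 r"
  have p0: "p \<theta> \<noteq> 0" for \<theta> using circlepath_at_zero(2)[OF r] by (simp add: p_def)
  have contpp: "continuous_on T p" for T
    unfolding p_def by (rule continuous_on_circlepath_real)
  have in_ball: "w + axis i (p \<theta>) \<in> ball z e" if "w \<in> ball z r" for w \<theta>
    using that r dist_triangle[of z "w + axis i (p \<theta>)" w] circlepath_at_zero(1)[OF r, of \<theta>]
    by (auto simp: r_def dist_norm p_def)
  \<comment> \<open>The derivative of the integrand with respect to \<open>w\<close>, packed as a
    bounded linear map because the Leibniz rule asks for joint continuity in the operator norm. This
    continuity comes from that of the partial derivatives of \<open>f\<close>.\<close>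
  define fx where "fx = (\<lambda>w \<theta>. Blinfun (\<lambda>v::complex^'n. (\<Sum>j\<in>UNIV. v $ j * cpartial j f (w + axis i (p \<theta>))) / p \<theta>))"
  have fx: "blinfun_apply (fx w \<theta>) = (\<lambda>v. (\<Sum>j\<in>UNIV. v $ j * cpartial j f (w + axis i (p \<theta>))) / p \<theta>)"
    for w \<theta>
    unfolding fx_def
    by (rule bounded_linear_Blinfun_apply)
      (intro bounded_linear_compose[OF bounded_linear_divide] bounded_linear_sum
        bounded_linear_mult_const bounded_linear_vec_nth)
  have contfx: "continuous_on (ball z r \<times> cbox 0 1) (\<lambda>(w, \<theta>). fx w \<theta>)"
    unfolding split_beta
    by (intro continuous_on_blinfun_componentwise, unfold fx)
      (intro continuous_intros continuous_on_compose2[OF contp]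
          continuous_on_compose2[OF contpp[of UNIV]]
          bounded_linear.continuous_on[OF bounded_linear_axis], auto simp: p0 intro!: in_ball[unfolded mem_ball])
  have "((\<lambda>w. integral (cbox 0 1) (\<lambda>\<theta>. f (w + axis i (p \<theta>)) / p \<theta>)) has_derivative
      blinfun_apply (integral (cbox 0 1) (fx z))) (at z within ball z r)"
  proof (rule leibniz_rule[where fx = fx])
    fix w \<theta> assume w: "w \<in> ball z r"
    have "((\<lambda>w. f (w + axis i (p \<theta>))) has_derivative
        (\<lambda>v. \<Sum>j\<in>UNIV. v $ j * cpartial j f (w + axis i (p \<theta>)))) (at w)"
      by (rule has_derivative_compose[of "\<lambda>w. w + axis i (p \<theta>)" "\<lambda>v. v" w UNIV f,
            OF _ cdiff_at_has_derivative[OF f[OF in_ball[OF w]]]])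
        (auto intro!: derivative_eq_intros)
    note has_derivative_at_withinI[OF bounded_linear.has_derivative[OF bounded_linear_divide this]]
    then show "((\<lambda>w. f (w + axis i (p \<theta>)) / p \<theta>) has_derivative blinfun_apply (fx w \<theta>))
        (at w within ball z r)"
      by (simp only: fx)
  next
    fix w assume w: "w \<in> ball z r"
    show "(\<lambda>\<theta>. f (w + axis i (p \<theta>)) / p \<theta>) integrable_on cbox 0 1"
      by (intro integrable_continuous continuous_intros continuous_on_compose2[OF contf]
          contpp bounded_linear.continuous_on[OF bounded_linear_axis])
        (use w in_ball p0 in auto)
  qed (use contfx r in auto)
  then have "((\<lambda>w. integral (cbox 0 1) (\<lambda>\<theta>. f (w + axis i (p \<theta>)) / p \<theta>)) has_derivative
      blinfun_apply (integral (cbox 0 1) (fx z))) (at z)"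
    using r by (simp add: at_within_open[of z "ball z r"])
  moreover have "integral (cbox 0 1) (\<lambda>\<theta>. f (w + axis i (p \<theta>)) / p \<theta>) = cpartial i f w"
    if "w \<in> ball z r" for w
  proof -
    have "cdiff_at f u" if "u \<in> ball w (2 * r)" for u
      using \<open>w \<in> ball z r\<close> that dist_triangle[of z u w] r by (intro f) (auto simp: r_def)
    then show ?thesis
      using cpartial_integral[of w "2 * r" f r i] r by (simp add: integral_unique p_def)
  qed
  ultimately have D: "(cpartial i f has_derivative blinfun_apply (integral (cbox 0 1) (fx z))) (at z)"
    using r by (elim has_derivative_transform_within_open[of _ _ _ _ "ball z r"]) auto
  have int: "fx z integrable_on cbox 0 1"
  proof (rule integrable_continuous)
    have "continuous_on (cbox 0 1) (\<lambda>\<theta>. (\<lambda>(w, \<theta>). fx w \<theta>) (z, \<theta>))"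
      by (rule continuous_on_compose2[OF contfx]) (use r in \<open>auto intro!: continuous_intros\<close>)
    then show "continuous_on (cbox 0 1) (fx z)"
      by simp
  qed
  show "cdiff_at (cpartial i f) z"
  proof (rule cdiff_atI[OF D])
    fix c v
    have "blinfun_apply (fx z \<theta>) (c *s v) = c * blinfun_apply (fx z \<theta>) v" for \<theta>
      unfolding fx by (simp add: sum_distrib_left mult.assoc)
    then show "blinfun_apply (integral (cbox 0 1) (fx z)) (c *s v) =
        c * blinfun_apply (integral (cbox 0 1) (fx z)) v"
      unfolding blinfun_apply_integral[OF int] by simp
  qed
qed

section \<open>The strong maximum principle for subharmonic functions of class C2\<close>

text \<open>A relation instead of an iterated derivative: \<open>p\<close> and \<open>q\<close> are
  the first partial derivatives near \<open>z\<close>, and each is differentiated only along its own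
  axis at \<open>z\<close>. This form needs just the second derivatives that occur in the Laplacian
  and is easily checked for \<open>Re F\<close>, for the squared norm and for restrictions to
  complex lines.\<close>

definition has_laplacian :: "(complex \<Rightarrow> real) \<Rightarrow> real \<Rightarrow> complex \<Rightarrow> bool" where
  "has_laplacian u l z \<longleftrightarrow> (\<exists>p q a b.
     (\<forall>\<^sub>F w in nhds z. (u has_derivative (\<lambda>v. Re v * p w + Im v * q w)) (at w)) \<and>
     ((\<lambda>t. p (z + of_real t)) has_real_derivative a) (at 0) \<and>
     ((\<lambda>t. q (z + \<i> * of_real t)) has_real_derivative b) (at 0) \<and> l = a + b)"

lemma has_laplacianI:
  assumes "\<forall>\<^sub>F w in nhds z. (u has_derivative (\<lambda>v. Re v * p w + Im v * q w)) (at w)"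
    and "((\<lambda>t. p (z + of_real t)) has_real_derivative a) (at 0)"
    and "((\<lambda>t. q (z + \<i> * of_real t)) has_real_derivative b) (at 0)"
  shows "has_laplacian u (a + b) z"
  using assms unfolding has_laplacian_def by blast

lemma has_laplacianE:
  assumes "has_laplacian u l z"
  obtains p q a b where
    "\<forall>\<^sub>F w in nhds z. (u has_derivative (\<lambda>v. Re v * p w + Im v * q w)) (at w)"
    "((\<lambda>t. p (z + of_real t)) has_real_derivative a) (at 0)"
    "((\<lambda>t. q (z + \<i> * of_real t)) has_real_derivative b) (at 0)" "l = a + b"
  using assms unfolding has_laplacian_def by blast

lemma eventually_nhds_line:
  fixes z c :: complex
  assumes "\<forall>\<^sub>F w in nhds z. P w"
  shows "\<forall>\<^sub>F t in nhds (0::real). P (z + c * of_real t)"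
proof -
  have "((\<lambda>t. z + c * of_real t) \<longlongrightarrow> z + c * of_real 0) (at (0::real))"
    by (intro tendsto_intros)
  then have "((\<lambda>t. z + c * of_real t) \<longlongrightarrow> z) (nhds (0::real))"
    using tendsto_at_iff_tendsto_nhds[of "\<lambda>t. z + c * of_real t" "0::real"] by simp
  then show ?thesis
    using assms unfolding filterlim_iff by blast
qed

text \<open>Near \<open>z\<close> the derivative of \<open>u\<close> determines \<open>p\<close> and
  \<open>q\<close>, hence their derivatives at \<open>z\<close>. This allows the Laplacian of
  \<open>ln G\<close> to be computed twice, from the metric and from local constancy.\<close>

lemma has_laplacian_unique:
  assumes "has_laplacian u l z" "has_laplacian u l' z"
  shows "l = l'"
proof -
  obtain p q a b where 1:
    "\<forall>\<^sub>F w in nhds z. (u has_derivative (\<lambda>v. Re v * p w + Im v * q w)) (at w)"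
    "((\<lambda>t. p (z + of_real t)) has_real_derivative a) (at 0)"
    "((\<lambda>t. q (z + \<i> * of_real t)) has_real_derivative b) (at 0)" "l = a + b"
    using assms(1) by (rule has_laplacianE) blast
  obtain p' q' a' b' where 2:
    "\<forall>\<^sub>F w in nhds z. (u has_derivative (\<lambda>v. Re v * p' w + Im v * q' w)) (at w)"
    "((\<lambda>t. p' (z + of_real t)) has_real_derivative a') (at 0)"
    "((\<lambda>t. q' (z + \<i> * of_real t)) has_real_derivative b') (at 0)" "l' = a' + b'"
    using assms(2) by (rule has_laplacianE) blast
  have ev: "\<forall>\<^sub>F w in nhds z. p w = p' w \<and> q w = q' w"
    using 1(1) 2(1)
  proof eventually_elim
    case (elim w)
    then have "(\<lambda>v. Re v * p w + Im v * q w) = (\<lambda>v. Re v * p' w + Im v * q' w)"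
      by (rule has_derivative_unique)
    from fun_cong[OF this, of 1] fun_cong[OF this, of \<i>] show ?case by simp
  qed
  have "\<forall>\<^sub>F t in nhds (0::real). p (z + of_real t) = p' (z + of_real t)"
    using eventually_nhds_line[OF ev, of 1] by (auto elim: eventually_mono)
  then have "((\<lambda>t. p' (z + of_real t)) has_real_derivative a) (at 0)"
    using 1(2) by (subst (asm) DERIV_cong_ev[OF refl _ refl])
  then have "a = a'" using 2(2) DERIV_unique by blast
  moreover have "\<forall>\<^sub>F t in nhds (0::real). q (z + \<i> * of_real t) = q' (z + \<i> * of_real t)"
    using eventually_nhds_line[OF ev, of \<i>] by (auto elim: eventually_mono)
  then have "((\<lambda>t. q' (z + \<i> * of_real t)) has_real_derivative b) (at 0)"
    using 1(3) by (subst (asm) DERIV_cong_ev[OF refl _ refl])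
  then have "b = b'" using 2(3) DERIV_unique by blast
  ultimately show ?thesis using 1(4) 2(4) by simp
qed

lemma has_laplacian_cong:
  assumes "has_laplacian u l z" "open N" "z \<in> N" "\<And>w. w \<in> N \<Longrightarrow> u w = u' w"
  shows "has_laplacian u' l z"
proof -
  obtain p q a b where 1:
    "\<forall>\<^sub>F w in nhds z. (u has_derivative (\<lambda>v. Re v * p w + Im v * q w)) (at w)"
    "((\<lambda>t. p (z + of_real t)) has_real_derivative a) (at 0)"
    "((\<lambda>t. q (z + \<i> * of_real t)) has_real_derivative b) (at 0)" "l = a + b"
    using assms(1) by (rule has_laplacianE) blast
  have "\<forall>\<^sub>F w in nhds z. w \<in> N"
    using assms(2,3) by (rule eventually_nhds_in_open)
  with 1(1) have "\<forall>\<^sub>F w in nhds z. (u' has_derivative (\<lambda>v. Re v * p w + Im v * q w)) (at w)"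
    by eventually_elim (use assms in \<open>blast intro: has_derivative_transform_within_open\<close>)
  then show ?thesis unfolding 1(4) by (rule has_laplacianI[OF _ 1(2,3)])
qed

lemma has_laplacian_add:
  assumes "has_laplacian u l z" "has_laplacian u' l' z"
  shows "has_laplacian (\<lambda>w. u w + u' w) (l + l') z"
proof -
  obtain p q a b where 1:
    "\<forall>\<^sub>F w in nhds z. (u has_derivative (\<lambda>v. Re v * p w + Im v * q w)) (at w)"
    "((\<lambda>t. p (z + of_real t)) has_real_derivative a) (at 0)"
    "((\<lambda>t. q (z + \<i> * of_real t)) has_real_derivative b) (at 0)" "l = a + b"
    using assms(1) by (rule has_laplacianE) blast
  obtain p' q' a' b' where 2:
    "\<forall>\<^sub>F w in nhds z. (u' has_derivative (\<lambda>v. Re v * p' w + Im v * q' w)) (at w)"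
    "((\<lambda>t. p' (z + of_real t)) has_real_derivative a') (at 0)"
    "((\<lambda>t. q' (z + \<i> * of_real t)) has_real_derivative b') (at 0)" "l' = a' + b'"
    using assms(2) by (rule has_laplacianE) blast
  have "\<forall>\<^sub>F w in nhds z. ((\<lambda>w. u w + u' w) has_derivative
      (\<lambda>v. Re v * (p w + p' w) + Im v * (q w + q' w))) (at w)"
    using 1(1) 2(1)
    by eventually_elim (auto intro!: derivative_eq_intros simp: algebra_simps)
  from has_laplacianI[OF this DERIV_add[OF 1(2) 2(2)] DERIV_add[OF 1(3) 2(3)]]
  show ?thesis by (simp add: 1(4) 2(4) add_ac)
qed

lemma has_laplacian_cmult:
  assumes "has_laplacian u l z"
  shows "has_laplacian (\<lambda>w. c * u w) (c * l) z"
proof -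
  obtain p q a b where 1:
    "\<forall>\<^sub>F w in nhds z. (u has_derivative (\<lambda>v. Re v * p w + Im v * q w)) (at w)"
    "((\<lambda>t. p (z + of_real t)) has_real_derivative a) (at 0)"
    "((\<lambda>t. q (z + \<i> * of_real t)) has_real_derivative b) (at 0)" "l = a + b"
    using assms(1) by (rule has_laplacianE) blast
  have "\<forall>\<^sub>F w in nhds z. ((\<lambda>w. c * u w) has_derivative
      (\<lambda>v. Re v * (c * p w) + Im v * (c * q w))) (at w)"
    using 1(1)
    by eventually_elim (auto intro!: derivative_eq_intros simp: algebra_simps)
  from has_laplacianI[OF this DERIV_cmult[OF 1(2)] DERIV_cmult[OF 1(3)]]
  show ?thesis by (simp add: 1(4) algebra_simps)
qed

lemma has_laplacian_const: "has_laplacian (\<lambda>w. c) 0 z"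
  using has_laplacianI[where u = "\<lambda>w. c" and p = "\<lambda>w. 0" and q = "\<lambda>w. 0" and a = 0 and b = 0] by simp

lemma has_laplacian_norm_square: "has_laplacian (\<lambda>w. (cmod w)\<^sup>2) 4 z"
proof -
  have "\<forall>\<^sub>F w in nhds z. ((\<lambda>w. (cmod w)\<^sup>2) has_derivative
      (\<lambda>v. Re v * (2 * Re w) + Im v * (2 * Im w))) (at w)"
    unfolding cmod_power2
    by (intro always_eventually allI) (auto intro!: derivative_eq_intros)
  moreover have "((\<lambda>t. 2 * Re (z + of_real t)) has_real_derivative 2) (at 0)"
    and "((\<lambda>t. 2 * Im (z + \<i> * of_real t)) has_real_derivative 2) (at 0)"
    by (auto intro!: derivative_eq_intros)
  ultimately have "has_laplacian (\<lambda>w. (cmod w)\<^sup>2) (2 + 2) z"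
    by (rule has_laplacianI)
  then show ?thesis by simp
qed

text \<open>By the Cauchy-Riemann equations the partial derivatives are \<open>Re F'\<close> and
  \<open>- Im F'\<close>; differentiated along their axes they give \<open>Re F''\<close> and
  \<open>- Re F''\<close>, which cancel.\<close>

lemma has_laplacian_Re:
  assumes F: "F holomorphic_on S" and S: "open S" "z \<in> S"
  shows "has_laplacian (\<lambda>w. Re (F w)) 0 z"
proof -
  have F': "deriv F holomorphic_on S"
    using F S(1) by (rule holomorphic_deriv)
  have "\<forall>\<^sub>F w in nhds z. w \<in> S"
    using S by (rule eventually_nhds_in_open)
  then have 1: "\<forall>\<^sub>F w in nhds z. ((\<lambda>w. Re (F w)) has_derivative
      (\<lambda>v. Re v * Re (deriv F w) + Im v * (- Im (deriv F w)))) (at w)"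
  proof eventually_elim
    case (elim w)
    have "(F has_derivative (*) (deriv F w)) (at w)"
      using holomorphic_derivI[OF F S(1) elim, of UNIV] by (simp add: has_field_derivative_def)
    from has_derivative_Re[OF this] show ?case
      by (simp add: algebra_simps)
  qed
  define d where "d = deriv (deriv F) z"
  have d: "(deriv F has_field_derivative d) (at z)"
    unfolding d_def using holomorphic_derivI[OF F' S, of UNIV] by simp
  have line: "((\<lambda>t. deriv F (z + c * of_real t)) has_vector_derivative c * d) (at 0)" for c
  proof -
    have "((\<lambda>t. z + c * of_real t) has_vector_derivative c) (at 0)"
      by (auto intro!: derivative_eq_intros)
    then have "(deriv F \<circ> (\<lambda>t. z + c * of_real t) has_vector_derivative c * d) (at 0)"
      by (rule field_vector_diff_chain_at) (simp add: d)
    then show ?thesis by (simp add: o_def)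
  qed
  have "((\<lambda>t. Re (deriv F (z + of_real t))) has_real_derivative Re d) (at 0)"
    using has_derivative_Re[OF line[of 1, unfolded has_vector_derivative_def]]
    by (simp add: has_field_derivative_def mult_commute_abs)
  moreover have "((\<lambda>t. Im (deriv F (z + \<i> * of_real t))) has_real_derivative Re d) (at 0)"
    using has_derivative_Im[OF line[of \<i>, unfolded has_vector_derivative_def]]
    by (simp add: has_field_derivative_def mult_commute_abs)
  note DERIV_minus[OF this]
  ultimately have "has_laplacian (\<lambda>w. Re (F w)) (Re d + - Re d) z"
    by (rule has_laplacianI[OF 1])
  then show ?thesis by simp
qed

text \<open>After division by \<open>F z\<close> the values near \<open>z\<close> lie in the right
  half plane, where \<open>Ln\<close> is holomorphic; there the function is a constant plus
  \<open>2 * Re (Ln (F w / F z))\<close>.\<close>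

lemma has_laplacian_ln_norm:
  assumes F: "F holomorphic_on S" and S: "open S" "z \<in> S" and nz: "F z \<noteq> 0"
  shows "has_laplacian (\<lambda>w. ln ((cmod (F w))\<^sup>2)) 0 z"
proof -
  define G where "G = (\<lambda>w. F w / F z)"
  have G: "G holomorphic_on S"
    unfolding G_def using nz by (intro holomorphic_intros F) auto
  define N where "N = S \<inter> G -` {w. Re w > 0}"
  have N: "open N"
    unfolding N_def
    by (intro continuous_open_preimage holomorphic_on_imp_continuous_on[OF G] S(1)
        open_halfspace_Re_gt)
  have z: "z \<in> N" using S nz by (simp add: N_def G_def)
  have G0: "G w \<notin> \<real>\<^sub>\<le>\<^sub>0" "G w \<noteq> 0" if "w \<in> N" for w
    using that by (auto simp: N_def complex_nonpos_Reals_iff)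
  have "(\<lambda>w. Ln (G w)) holomorphic_on N"
    using G0 by (intro holomorphic_on_Ln' holomorphic_on_subset[OF G]) (auto simp: N_def)
  then have "has_laplacian (\<lambda>w. ln ((cmod (F z))\<^sup>2) + 2 * Re (Ln (G w))) (0 + 2 * 0) z"
    by (intro has_laplacian_add has_laplacian_const has_laplacian_cmult has_laplacian_Re[OF _ N z])
  moreover have "ln ((cmod (F z))\<^sup>2) + 2 * Re (Ln (G w)) = ln ((cmod (F w))\<^sup>2)" if "w \<in> N" for w
  proof -
    have "F w \<noteq> 0" using G0[OF that] by (auto simp: G_def)
    then show ?thesis
      using G0(2)[OF that] nz
      by (simp add: ln_realpow Re_Ln G_def norm_divide ln_div)
  qed
  ultimately show ?thesis
    using has_laplacian_cong[OF _ N z] by simp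
qed

section \<open>Maximum principles\<close>

lemma second_derivative_at_max:
  fixes g :: "real \<Rightarrow> real"
  assumes g: "\<forall>\<^sub>F t in nhds 0. (g has_real_derivative g' t) (at t)"
    and g': "(g' has_real_derivative a) (at 0)" and max: "\<forall>\<^sub>F t in nhds 0. g t \<le> g 0"
  shows "a \<le> 0"
proof (rule ccontr)
  assume "\<not> a \<le> 0"
  then have a: "a > 0" by simp
  from g max obtain e where e: "e > 0"
      "\<And>t. dist t 0 < e \<Longrightarrow> (g has_real_derivative g' t) (at t) \<and> g t \<le> g 0"
    using eventually_conj[OF g max] unfolding eventually_nhds_metric by blast
  have "g' 0 = 0"
    by (rule DERIV_local_max[of g _ 0 e]) (use e in \<open>auto simp: dist_real_def\<close>)
  \<comment> \<open>A positive second derivative makes \<open>g'\<close> positive just to the right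
    of its zero at 0, and the mean value theorem then yields a value of \<open>g\<close> above the
    maximum.\<close>
  moreover obtain d where d: "d > 0" "\<And>h. 0 < h \<Longrightarrow> h < d \<Longrightarrow> g' 0 < g' (0 + h)"
    using DERIV_pos_inc_right[OF g' a] by blast
  ultimately have pos: "g' h > 0" if "0 < h" "h < d" for h
    using that by fastforce
  define s where "s = min d e / 2"
  have s: "0 < s" "s < d" "s < e" using d(1) e(1) by (auto simp: s_def)
  obtain t where t: "0 < t" "t < s" "g s - g 0 = (s - 0) * g' t"
    using s MVT2[of 0 s g g'] e(2) by (auto simp: dist_real_def)
  have "s * g' t > 0"
    using s t pos[of t] by simp
  with t(3) have "g s > g 0"
    by simp
  then show False
    using e(2)[of s] s by (auto simp: dist_real_def)
qed

lemma laplacian_at_max: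
  assumes "has_laplacian u l z" and max: "\<forall>\<^sub>F w in nhds z. u w \<le> u z"
  shows "l \<le> 0"
proof -
  obtain p q a b where 1:
    "\<forall>\<^sub>F w in nhds z. (u has_derivative (\<lambda>v. Re v * p w + Im v * q w)) (at w)"
    "((\<lambda>t. p (z + of_real t)) has_real_derivative a) (at 0)"
    "((\<lambda>t. q (z + \<i> * of_real t)) has_real_derivative b) (at 0)" "l = a + b"
    using assms(1) by (rule has_laplacianE) blast
  have line: "\<forall>\<^sub>F t in nhds 0. ((\<lambda>t. u (z + c * of_real t)) has_real_derivative
      (Re c * p (z + c * of_real t) + Im c * q (z + c * of_real t))) (at t)" for c
    using eventually_nhds_line[OF 1(1), of c]
  proof eventually_elim
    case (elim t)
    have "((\<lambda>t. z + c * of_real t) has_derivative (\<lambda>h. c * of_real h)) (at t)"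
      by (auto intro!: derivative_eq_intros)
    note has_derivative_compose[OF this elim]
    moreover have "(\<lambda>h. Re (c * of_real h) * p (z + c * of_real t) + Im (c * of_real h) * q (z + c * of_real t)) =
        (*) (Re c * p (z + c * of_real t) + Im c * q (z + c * of_real t))"
      by (simp add: fun_eq_iff algebra_simps)
    ultimately show ?case
      by (simp only: has_field_derivative_def)
  qed
  have "a \<le> 0"
    using second_derivative_at_max[of "\<lambda>t. u (z + of_real t)" "\<lambda>t. p (z + of_real t)" a]
      line[of 1] eventually_nhds_line[OF max, of 1] 1(2) by simp
  moreover have "b \<le> 0"
    using second_derivative_at_max[of "\<lambda>t. u (z + \<i> * of_real t)" "\<lambda>t. q (z + \<i> * of_real t)" b]
      line[of \<i>] eventually_nhds_line[OF max, of \<i>] 1(3) by simp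
  ultimately show ?thesis by (simp add: 1(4))
qed

text \<open>A small multiple of \<open>(cmod z)\<^sup>2\<close> makes the Laplacian strictly
  positive, which excludes a maximum in the interior. The maximum over the closed disc therefore
  lies on the circle, and the multiple is arbitrary.\<close>

lemma weak_maximum_principle:
  assumes cont: "continuous_on (cball 0 R) v" and R: "R > 0"
    and lap: "\<And>z. z \<in> ball 0 R \<Longrightarrow> \<exists>l\<ge>0. has_laplacian v l z"
    and bd: "\<And>z. cmod z = R \<Longrightarrow> v z \<le> M"
  shows "v 0 \<le> M"
proof (rule field_le_epsilon)
  fix e :: real assume e: "e > 0"
  \<comment> \<open>With this factor the added term equals \<open>e\<close> on the circle of radius
    \<open>R\<close>.\<close>
  define \<eta> where "\<eta> = e / R\<^sup>2"
  have \<eta>: "\<eta> > 0" using e R by (simp add: \<eta>_def)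
  define w where "w = (\<lambda>z. v z + \<eta> * (cmod z)\<^sup>2)"
  have "continuous_on (cball 0 R) w"
    unfolding w_def by (intro continuous_intros cont)
  then obtain x where x: "x \<in> cball 0 R" "\<And>y. y \<in> cball 0 R \<Longrightarrow> w y \<le> w x"
    using continuous_attains_sup[of "cball 0 R" w] R by auto
  have "cmod x = R"
  proof (rule ccontr)
    assume "cmod x \<noteq> R"
    then have xb: "x \<in> ball 0 R" using x(1) by auto
    then obtain l where l: "l \<ge> 0" "has_laplacian v l x" using lap by blast
    have "has_laplacian w (l + \<eta> * 4) x"
      unfolding w_def by (intro has_laplacian_add has_laplacian_cmult has_laplacian_norm_square l)
    moreover have "\<forall>\<^sub>F y in nhds x. w y \<le> w x"
      using eventually_nhds_in_open[OF open_ball xb] by eventually_elim (use x(2) in auto)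
    ultimately show False
      using laplacian_at_max l(1) \<eta> by fastforce
  qed
  then have "w x \<le> M + e"
    using bd[of x] R by (simp add: w_def \<eta>_def)
  moreover have "w 0 \<le> w x" using x(2)[of 0] R by simp
  ultimately show "v 0 \<le> M + e" by (simp add: w_def)
qed

text \<open>The Poisson kernel with pole \<open>b\<close>, up to normalisation. The numerator makes
  it small on a circle whose radius is close to \<open>cmod b\<close>, as long as \<open>z\<close>
  keeps away from \<open>b\<close>.\<close>

lemma Re_Poisson:
  assumes "b \<noteq> z"
  shows "Re ((b + z) / (b - z)) = ((cmod b)\<^sup>2 - (cmod z)\<^sup>2) / (cmod (b - z))\<^sup>2"
  by (simp add: Re_divide' cmod_power2) (simp add: power2_eq_square algebra_simps)

text \<open>If \<open>u\<close> is smaller than its maximum \<open>u 0\<close> at \<open>a\<close>, then adding a small multiple of the real part of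
  \<open>(b + z) / (b - z)\<close>, with the pole \<open>b\<close> just outside the disc near \<open>a\<close>, contradicts the weak maximum
  principle: on the circle this Poisson kernel is below its value \<open>1\<close> at \<open>0\<close> except near \<open>a\<close>.\<close>

lemma strong_maximum_principle:
  assumes cont: "continuous_on (ball 0 S) u"
    and lap: "\<And>z. z \<in> ball 0 S \<Longrightarrow> \<exists>l\<ge>0. has_laplacian u l z"
    and max: "\<And>z. z \<in> ball 0 S \<Longrightarrow> u z \<le> u 0"
    and a: "a \<in> ball 0 S"
  shows "u a = u 0"
proof (rule ccontr)
  assume ne: "u a \<noteq> u 0"
  define R where "R = cmod a"
  have R: "0 < R" "R < S" using ne a by (auto simp: R_def)
  \<comment> \<open>Half of the gap at \<open>a\<close>: by continuity \<open>u\<close> stays below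
    \<open>u 0 - \<delta>\<close> on a whole disc around \<open>a\<close>.\<close>
  define \<delta> where "\<delta> = (u 0 - u a) / 2"
  have \<delta>: "\<delta> > 0" using ne max[OF a] by (simp add: \<delta>_def)
  have "isCont u a"
    using cont a by (simp add: continuous_on_eq_continuous_at)
  then have "\<forall>\<^sub>F z in nhds a. u z < u 0 - \<delta>"
    using \<delta> unfolding \<delta>_def
    by (intro order_tendstoD(2)[of u "u a"]) (auto simp: isCont_def tendsto_at_iff_tendsto_nhds field_simps)
  then obtain d where d: "d > 0" "\<And>z. dist z a < d \<Longrightarrow> u z < u 0 - \<delta>"
    unfolding eventually_nhds_metric by blast
  \<comment> \<open>The pole \<open>b\<close> lies at distance \<open>s * R\<close> from
    \<open>a\<close>. The bound \<open>1\<close> gives \<open>2 * s + s\<^sup>2 \<le> 3 * s\<close>;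
    the second bound keeps points at distance \<open>d\<close> from \<open>a\<close> at distance
    \<open>d / 2\<close> from \<open>b\<close>; the third makes \<open>3 * s * R\<^sup>2\<close> at
    most half of \<open>(d / 2)\<^sup>2\<close>, so that the kernel is at most \<open>1 / 2\<close>
    there.\<close>
  define s where "s = min 1 (min (d / (2 * R)) (d\<^sup>2 / (24 * R\<^sup>2)))"
  have s: "s > 0" "s \<le> 1" "s * R \<le> d / 2" "s * (24 * R\<^sup>2) \<le> d\<^sup>2"
  proof -
    show "s > 0" "s \<le> 1" using d R by (auto simp: s_def)
    have "s \<le> d / (2 * R)" "s \<le> d\<^sup>2 / (24 * R\<^sup>2)" by (auto simp: s_def)
    then show "s * R \<le> d / 2" "s * (24 * R\<^sup>2) \<le> d\<^sup>2"
      using R by (auto simp: field_simps)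
  qed
  define b where "b = (1 + of_real s) * a"
  have normb: "cmod b = (1 + s) * R"
  proof -
    have "b = of_real (1 + s) * a" by (simp add: b_def)
    then have "cmod b = \<bar>1 + s\<bar> * R" by (simp only: norm_mult norm_of_real R_def)
    then show ?thesis using s(1) by simp
  qed
  have nb: "b \<noteq> z" if "cmod z \<le> R" for z
  proof
    assume "b = z"
    then have "(1 + s) * R \<le> 1 * R" using normb that by simp
    moreover have "s * R > 0" using R s(1) by simp
    ultimately show False by (simp add: algebra_simps)
  qed
  define P where "P = (\<lambda>z. Re ((b + z) / (b - z)))"
  \<comment> \<open>An upper bound of the kernel on the circle, from
    \<open>cmod (b + z) \<le> (2 + s) * R\<close> and
    \<open>cmod (b - z) \<ge> s * R\<close>.\<close>
  define C where "C = (2 + s) / s"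
  have C: "C > 0" using s by (simp add: C_def)
  have PC: "P z \<le> C" if "cmod z = R" for z
  proof -
    have "s * R \<le> cmod (b - z)"
      using norm_triangle_ineq2[of b z] that normb by (simp add: algebra_simps)
    moreover have "cmod (b + z) \<le> (2 + s) * R"
      using norm_triangle_ineq[of b z] that normb by (simp add: algebra_simps)
    ultimately have "cmod (b + z) / cmod (b - z) \<le> ((2 + s) * R) / (s * R)"
      using R s by (intro frac_le) auto
    also have "\<dots> = C" using R by (simp add: C_def)
    finally show ?thesis
      unfolding P_def using complex_Re_le_cmod[of "(b + z) / (b - z)"] by (simp add: norm_divide)
  qed
  have Phalf: "P z \<le> 1 / 2" if z: "cmod z = R" and far: "dist z a \<ge> d" for z
  proof -
    have "cmod (b - a) = s * R"
    proof -
      have "b - a = of_real s * a" by (simp add: b_def algebra_simps)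
      then have "cmod (b - a) = \<bar>s\<bar> * R" by (simp only: norm_mult norm_of_real R_def)
      then show ?thesis using s(1) by simp
    qed
    moreover have "dist z a \<le> cmod (b - z) + cmod (b - a)"
      using norm_triangle_ineq4[of "b - a" "b - z"] by (simp add: dist_norm)
    ultimately have bz: "d / 2 \<le> cmod (b - z)"
      using s(3) far by simp
    then have "(d / 2)\<^sup>2 \<le> (cmod (b - z))\<^sup>2"
      using d(1) by (intro power_mono) auto
    have "(cmod b)\<^sup>2 - (cmod z)\<^sup>2 = R\<^sup>2 * (2 * s + s\<^sup>2)"
      by (simp add: normb z power2_eq_square algebra_simps)
    also have "\<dots> \<le> R\<^sup>2 * (3 * s)"
      using s by (intro mult_left_mono) (auto simp: power2_eq_square)
    also have "\<dots> \<le> d\<^sup>2 / 8" using s(4) by (simp add: mult_ac)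
    also have "\<dots> = (1 / 2) * (d / 2)\<^sup>2" by (simp add: power_divide)
    also have "\<dots> \<le> (1 / 2) * (cmod (b - z))\<^sup>2"
      using \<open>(d / 2)\<^sup>2 \<le> _\<close> by simp
    finally have "(cmod b)\<^sup>2 - (cmod z)\<^sup>2 \<le> (1 / 2) * (cmod (b - z))\<^sup>2" .
    moreover have "0 < (cmod (b - z))\<^sup>2" using bz d(1) by auto
    ultimately show ?thesis
      unfolding P_def Re_Poisson[OF nb[OF eq_refl[OF z]]] by (simp add: field_simps)
  qed
  \<comment> \<open>Near \<open>a\<close> the loss \<open>\<delta>\<close> of \<open>u\<close>
    absorbs \<open>\<epsilon> * P z\<close>, which is at most
    \<open>\<epsilon> * C = \<delta>\<close>; elsewhere on the circle the kernel contributes at most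
    \<open>\<epsilon> / 2\<close>. At the centre it contributes \<open>\<epsilon>\<close>, which is
    too much for the weak principle.\<close>
  define \<epsilon> where "\<epsilon> = \<delta> / C"
  have \<epsilon>: "\<epsilon> > 0" using \<delta> C by (simp add: \<epsilon>_def)
  have "u 0 + \<epsilon> * P 0 \<le> u 0 + \<epsilon> / 2"
  proof (rule weak_maximum_principle[where v = "\<lambda>z. u z + \<epsilon> * P z" and R = R])
    show "continuous_on (cball 0 R) (\<lambda>z. u z + \<epsilon> * P z)"
      unfolding P_def using R nb
      by (intro continuous_intros continuous_on_subset[OF cont]) auto
    show "\<exists>l\<ge>0. has_laplacian (\<lambda>z. u z + \<epsilon> * P z) l z" if z: "z \<in> ball 0 R" for z
    proof -
      obtain l where l: "l \<ge> 0" "has_laplacian u l z"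
        using lap[of z] z R by auto
      have "(\<lambda>z. (b + z) / (b - z)) holomorphic_on ball 0 R"
        using nb by (intro holomorphic_intros) auto
      then have "has_laplacian P 0 z"
        unfolding P_def using z by (intro has_laplacian_Re[of _ "ball 0 R"]) auto
      from has_laplacian_add[OF l(2) has_laplacian_cmult[OF this, of \<epsilon>]] l(1)
      show ?thesis by auto
    qed
    show "u z + \<epsilon> * P z \<le> u 0 + \<epsilon> / 2" if z: "cmod z = R" for z
    proof (cases "dist z a < d")
      case True
      have "\<epsilon> * P z \<le> \<epsilon> * C" using PC[OF z] \<epsilon> by simp
      then show ?thesis using d(2)[OF True] \<epsilon> C by (simp add: \<epsilon>_def)
    next
      case False
      have "\<epsilon> * P z \<le> \<epsilon> * (1 / 2)" using Phalf[OF z] False \<epsilon> by (intro mult_left_mono) auto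
      then show ?thesis using max[of z] z R by simp
    qed
  qed (use R in auto)
  moreover have "P 0 = 1" using nb[of 0] R by (simp add: P_def)
  ultimately show False using \<epsilon> by simp
qed

text \<open>Chain rule along \<open>\<xi> \<mapsto> z0 + \<xi> *s V\<close>: the real axis of the
  parameter moves in the direction \<open>V\<close>, the imaginary axis in the direction
  \<open>\<i> *s V\<close>. The sum is the Levi form of \<open>G\<close> at \<open>V\<close>, up to
  the factor 4.\<close>

lemma has_laplacian_complex_line:
  fixes G :: "complex^'n::finite \<Rightarrow> real"
  assumes S: "open S" "z0 + \<zeta> *s V \<in> S"
    and G: "\<And>w. w \<in> S \<Longrightarrow> (G has_derivative G' w) (at w)"
    and H: "\<And>v. ((\<lambda>w. G' w v) has_derivative H v) (at (z0 + \<zeta> *s V))"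
  shows "has_laplacian (\<lambda>\<xi>. G (z0 + \<xi> *s V)) (H V V + H (\<i> *s V) (\<i> *s V)) \<zeta>"
proof -
  have aff: "((\<lambda>\<xi>. z0 + \<xi> *s V) has_derivative (\<lambda>h. h *s V)) (at \<xi>)" for \<xi>
    using has_derivative_add[OF has_derivative_const[of z0] bounded_linear_imp_has_derivative,
        of "\<lambda>h. h *s V" "at \<xi>"] linear_smult_vec_left[of V]
    by (simp add: linear_conv_bounded_linear)
  have "continuous_on UNIV (\<lambda>\<xi>. z0 + \<xi> *s V)"
    using aff has_derivative_continuous by (blast intro: continuous_at_imp_continuous_on)
  then have "open ((\<lambda>\<xi>. z0 + \<xi> *s V) -` S)"
    using S(1) by (rule open_vimage[rotated])
  then have "\<forall>\<^sub>F \<xi> in nhds \<zeta>. \<xi> \<in> (\<lambda>\<xi>. z0 + \<xi> *s V) -` S"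
    using S(2) by (intro eventually_nhds_in_open) auto
  then have "\<forall>\<^sub>F \<xi> in nhds \<zeta>. ((\<lambda>\<xi>. G (z0 + \<xi> *s V)) has_derivative
      (\<lambda>v. Re v * G' (z0 + \<xi> *s V) V + Im v * G' (z0 + \<xi> *s V) (\<i> *s V))) (at \<xi>)"
  proof eventually_elim
    case (elim \<xi>)
    then have D: "(G has_derivative G' (z0 + \<xi> *s V)) (at (z0 + \<xi> *s V))" using G by simp
    have "(\<lambda>v. G' (z0 + \<xi> *s V) (v *s V)) =
        (\<lambda>v. Re v * G' (z0 + \<xi> *s V) V + Im v * G' (z0 + \<xi> *s V) (\<i> *s V))"
    proof
      fix v
      have "v *s V = Re v *\<^sub>R V + Im v *\<^sub>R (\<i> *s V)"
        by (simp add: vec_eq_iff complex_eq_iff)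
      then show "G' (z0 + \<xi> *s V) (v *s V) =
          Re v * G' (z0 + \<xi> *s V) V + Im v * G' (z0 + \<xi> *s V) (\<i> *s V)"
        using has_derivative_linear[OF D] by (simp add: linear_add linear_scale)
    qed
    with has_derivative_compose[OF aff D] show ?case by (simp only:)
  qed
  moreover have "((\<lambda>t. G' (z0 + (\<zeta> + c * of_real t) *s V) v) has_real_derivative H v (c *s V)) (at 0)" for c v
  proof -
    have "((\<lambda>t. \<zeta> + c * of_real t) has_derivative (\<lambda>h. c * of_real h)) (at 0)"
      by (auto intro!: derivative_eq_intros)
    from has_derivative_compose[OF this aff[of "\<zeta> + c * of_real 0"]]
    have "((\<lambda>t. z0 + (\<zeta> + c * of_real t) *s V) has_derivative (\<lambda>h. (c * of_real h) *s V)) (at 0)"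
      by simp
    from has_derivative_compose[OF this] H[of v]
    have "((\<lambda>t. G' (z0 + (\<zeta> + c * of_real t) *s V) v) has_derivative (\<lambda>h. H v ((c * of_real h) *s V))) (at 0)"
      by simp
    moreover have "(c * of_real h) *s V = h *\<^sub>R (c *s V)" for h
      by (simp add: vec_eq_iff complex_eq_iff algebra_simps)
    then have "(\<lambda>h. H v ((c * of_real h) *s V)) = (*) (H v (c *s V))"
      using has_derivative_linear[OF H[of v]] by (simp add: linear_scale fun_eq_iff)
    ultimately show ?thesis by (simp only: has_field_derivative_def)
  qed
  from this[of 1 V] this[of \<i> "\<i> *s V"]
  have "((\<lambda>t. G' (z0 + (\<zeta> + of_real t) *s V) V) has_real_derivative H V V) (at 0)"
    "((\<lambda>t. G' (z0 + (\<zeta> + \<i> * of_real t) *s V) (\<i> *s V)) has_real_derivative H (\<i> *s V) (\<i> *s V)) (at 0)"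
    by simp_all
  ultimately show ?thesis
    by (rule has_laplacianI)
qed

section \<open>Sheaves of abelian groups and their first cohomology\<close>

text \<open>The closure properties that make \<open>cohomologous\<close> an equivalence relation and
  the stalks abelian groups. They are verified for every sheaf occurring in the construction of the
  Ueda class.\<close>

locale ab_sheaf =
  fixes T :: "'a topology" and F :: "('a, 's, 'z) sheaf_scheme"
  assumes comm_group: "p \<in> topspace T \<Longrightarrow> comm_group (vals F p)"
    and open_sec: "s \<in> sections F U \<Longrightarrow> openin T U"
    and sec_closed: "s \<in> sections F U \<Longrightarrow> p \<in> U \<Longrightarrow> s p \<in> carrier (vals F p)"
    and sec_restrict: "s \<in> sections F U \<Longrightarrow> openin T V \<Longrightarrow> V \<subseteq> U \<Longrightarrow> s \<in> sections F V"
    and sec_mult: "s \<in> sections F U \<Longrightarrow> s' \<in> sections F U \<Longrightarrow> (\<lambda>p. s p \<otimes>\<^bsub>vals F p\<^esub> s' p) \<in> sections F U"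
    and sec_inv: "s \<in> sections F U \<Longrightarrow> (\<lambda>p. inv\<^bsub>vals F p\<^esub> (s p)) \<in> sections F U"
    and sec_one: "openin T U \<Longrightarrow> (\<lambda>p. \<one>\<^bsub>vals F p\<^esub>) \<in> sections F U"
begin

lemma in_topspace: "s \<in> sections F U \<Longrightarrow> p \<in> U \<Longrightarrow> p \<in> topspace T"
  using open_sec openin_subset by fastforce

lemma cocycleD:
  assumes "(U, c) \<in> cocycles T F" "x \<in> topspace T" "y \<in> topspace T"
  shows "openin T (U x)" "x \<in> U x" "c x y \<in> sections F (U x \<inter> U y)"
    and "p \<in> U x \<inter> U y \<Longrightarrow> c x y p \<in> carrier (vals F p)"
    and "z \<in> topspace T \<Longrightarrow> p \<in> U x \<inter> U y \<inter> U z \<Longrightarrow> c x y p \<otimes>\<^bsub>vals F p\<^esub> c y z p = c x z p"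
  using assms sec_closed[of "c x y" "U x \<inter> U y"] unfolding cocycles_def by auto

lemma cohomologousE:
  assumes "((U, c), (U', c')) \<in> cohomologous T F"
  obtains V b where "(U, c) \<in> cocycles T F" "(U', c') \<in> cocycles T F"
    and "\<And>x. x \<in> topspace T \<Longrightarrow> openin T (V x) \<and> x \<in> V x \<and> V x \<subseteq> U x \<inter> U' x \<and> b x \<in> sections F (V x)"
    and "\<And>x y p. x \<in> topspace T \<Longrightarrow> y \<in> topspace T \<Longrightarrow> p \<in> V x \<inter> V y \<Longrightarrow>
           b x p \<otimes>\<^bsub>vals F p\<^esub> c' x y p = c x y p \<otimes>\<^bsub>vals F p\<^esub> b y p"
  using assms unfolding cohomologous_def mem_Collect_eq prod.case
  by (elim conjE exE) (rule that, assumption, assumption, erule (1) bspec, blast)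

lemma cohomologousI:
  assumes "(U, c) \<in> cocycles T F" "(U', c') \<in> cocycles T F"
    and "\<And>x. x \<in> topspace T \<Longrightarrow> openin T (V x) \<and> x \<in> V x \<and> V x \<subseteq> U x \<inter> U' x \<and> b x \<in> sections F (V x)"
    and "\<And>x y p. x \<in> topspace T \<Longrightarrow> y \<in> topspace T \<Longrightarrow> p \<in> V x \<inter> V y \<Longrightarrow>
           b x p \<otimes>\<^bsub>vals F p\<^esub> c' x y p = c x y p \<otimes>\<^bsub>vals F p\<^esub> b y p"
  shows "((U, c), (U', c')) \<in> cohomologous T F"
  unfolding cohomologous_def mem_Collect_eq prod.case
  by (intro conjI exI[of _ V] exI[of _ b] ballI assms)

lemma cohomologous_refl:
  assumes "u \<in> cocycles T F"
  shows "(u, u) \<in> cohomologous T F"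
proof -
  obtain U c where u: "u = (U, c)" by force
  show ?thesis unfolding u
  proof (rule cohomologousI[where V = U and b = "\<lambda>x p. \<one>\<^bsub>vals F p\<^esub>"])
    fix x y p assume "x \<in> topspace T" "y \<in> topspace T" "p \<in> U x \<inter> U y"
    moreover from this have "p \<in> topspace T"
      using cocycleD(3)[OF assms[unfolded u]] in_topspace by blast
    then interpret comm_group "vals F p" by (rule comm_group)
    show "\<one>\<^bsub>vals F p\<^esub> \<otimes>\<^bsub>vals F p\<^esub> c x y p = c x y p \<otimes>\<^bsub>vals F p\<^esub> \<one>\<^bsub>vals F p\<^esub>"
      using cocycleD(4)[OF assms[unfolded u]] calculation by simp
  next
    fix x assume "x \<in> topspace T"
    then show "openin T (U x) \<and> x \<in> U x \<and> U x \<subseteq> U x \<inter> U x \<and> (\<lambda>p. \<one>\<^bsub>vals F p\<^esub>) \<in> sections F (U x)"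
      using cocycleD(1,2)[OF assms[unfolded u]] sec_one by simp
  qed (use assms u in auto)
qed

lemma cohomologous_sym:
  assumes "(u, u') \<in> cohomologous T F"
  shows "(u', u) \<in> cohomologous T F"
proof -
  obtain U c U' c' where u: "u = (U, c)" "u' = (U', c')" by force
  from assms obtain V b where c: "(U, c) \<in> cocycles T F" "(U', c') \<in> cocycles T F"
    and V: "\<And>x. x \<in> topspace T \<Longrightarrow> openin T (V x) \<and> x \<in> V x \<and> V x \<subseteq> U x \<inter> U' x \<and> b x \<in> sections F (V x)"
    and b: "\<And>x y p. x \<in> topspace T \<Longrightarrow> y \<in> topspace T \<Longrightarrow> p \<in> V x \<inter> V y \<Longrightarrow>
           b x p \<otimes>\<^bsub>vals F p\<^esub> c' x y p = c x y p \<otimes>\<^bsub>vals F p\<^esub> b y p"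
    unfolding u by (elim cohomologousE) blast
  show ?thesis unfolding u
  proof (rule cohomologousI[where V = V and b = "\<lambda>x p. inv\<^bsub>vals F p\<^esub> (b x p)"])
    fix x y p assume xy: "x \<in> topspace T" "y \<in> topspace T" and p: "p \<in> V x \<inter> V y"
    have "p \<in> topspace T"
      using V[OF xy(1)] p in_topspace by blast
    then interpret comm_group "vals F p" by (rule comm_group)
    have bx: "b x p \<in> carrier (vals F p)" and by': "b y p \<in> carrier (vals F p)"
      using V xy p sec_closed by blast+
    have "p \<in> U x \<inter> U y" "p \<in> U' x \<inter> U' y"
      using V xy p by blast+
    then have cc: "c x y p \<in> carrier (vals F p)" "c' x y p \<in> carrier (vals F p)"
      using cocycleD(4)[OF c(1) xy] cocycleD(4)[OF c(2) xy] by blast+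
    have "c' x y p = inv\<^bsub>vals F p\<^esub> b x p \<otimes>\<^bsub>vals F p\<^esub> (b x p \<otimes>\<^bsub>vals F p\<^esub> c' x y p)"
      using bx cc by (simp add: m_assoc[symmetric])
    also have "\<dots> = inv\<^bsub>vals F p\<^esub> b x p \<otimes>\<^bsub>vals F p\<^esub> c x y p \<otimes>\<^bsub>vals F p\<^esub> b y p"
      using b[OF xy p] bx by' cc by (simp add: m_assoc)
    finally show "inv\<^bsub>vals F p\<^esub> b x p \<otimes>\<^bsub>vals F p\<^esub> c x y p = c' x y p \<otimes>\<^bsub>vals F p\<^esub> inv\<^bsub>vals F p\<^esub> b y p"
      using bx by' cc by (simp add: m_assoc)
  qed (use c V sec_inv in blast)+
qed

lemma cohomologous_trans:
  assumes "(u, u') \<in> cohomologous T F" "(u', u'') \<in> cohomologous T F"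
  shows "(u, u'') \<in> cohomologous T F"
proof -
  obtain U c U' c' U'' c'' where u: "u = (U, c)" "u' = (U', c')" "u'' = (U'', c'')"
    by (metis surj_pair)
  from assms(1) obtain V b where c: "(U, c) \<in> cocycles T F" "(U', c') \<in> cocycles T F"
    and V: "\<And>x. x \<in> topspace T \<Longrightarrow> openin T (V x) \<and> x \<in> V x \<and> V x \<subseteq> U x \<inter> U' x \<and> b x \<in> sections F (V x)"
    and b: "\<And>x y p. x \<in> topspace T \<Longrightarrow> y \<in> topspace T \<Longrightarrow> p \<in> V x \<inter> V y \<Longrightarrow>
           b x p \<otimes>\<^bsub>vals F p\<^esub> c' x y p = c x y p \<otimes>\<^bsub>vals F p\<^esub> b y p"
    unfolding u by (elim cohomologousE) blast
  from assms(2) obtain V' b' where c'': "(U'', c'') \<in> cocycles T F"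
    and V': "\<And>x. x \<in> topspace T \<Longrightarrow> openin T (V' x) \<and> x \<in> V' x \<and> V' x \<subseteq> U' x \<inter> U'' x \<and> b' x \<in> sections F (V' x)"
    and b': "\<And>x y p. x \<in> topspace T \<Longrightarrow> y \<in> topspace T \<Longrightarrow> p \<in> V' x \<inter> V' y \<Longrightarrow>
           b' x p \<otimes>\<^bsub>vals F p\<^esub> c'' x y p = c' x y p \<otimes>\<^bsub>vals F p\<^esub> b' y p"
    unfolding u by (elim cohomologousE) blast
  show ?thesis unfolding u
  proof (rule cohomologousI[where V = "\<lambda>x. V x \<inter> V' x" and b = "\<lambda>x p. b x p \<otimes>\<^bsub>vals F p\<^esub> b' x p"])
    fix x assume x: "x \<in> topspace T"
    have "openin T (V x \<inter> V' x)" using V[OF x] V'[OF x] by blast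
    then have "b x \<in> sections F (V x \<inter> V' x)" "b' x \<in> sections F (V x \<inter> V' x)"
      using V[OF x] V'[OF x] sec_restrict by blast+
    then show "openin T (V x \<inter> V' x) \<and> x \<in> V x \<inter> V' x \<and> V x \<inter> V' x \<subseteq> U x \<inter> U'' x \<and>
        (\<lambda>p. b x p \<otimes>\<^bsub>vals F p\<^esub> b' x p) \<in> sections F (V x \<inter> V' x)"
      using V[OF x] V'[OF x] sec_mult by blast
  next
    fix x y p assume xy: "x \<in> topspace T" "y \<in> topspace T" and p: "p \<in> V x \<inter> V' x \<inter> (V y \<inter> V' y)"
    have "p \<in> topspace T"
      using V[OF xy(1)] p in_topspace by blast
    then interpret comm_group "vals F p" by (rule comm_group)
    have bx: "b x p \<in> carrier (vals F p)" "b y p \<in> carrier (vals F p)"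
      "b' x p \<in> carrier (vals F p)" "b' y p \<in> carrier (vals F p)"
      using V V' xy p sec_closed by blast+
    have "p \<in> U x \<inter> U y" "p \<in> U' x \<inter> U' y" "p \<in> U'' x \<inter> U'' y"
      using V V' xy p by blast+
    then have cc: "c x y p \<in> carrier (vals F p)" "c' x y p \<in> carrier (vals F p)"
        "c'' x y p \<in> carrier (vals F p)"
      using cocycleD(4)[OF c(1) xy] cocycleD(4)[OF c(2) xy] cocycleD(4)[OF c'' xy] by blast+
    have "b x p \<otimes>\<^bsub>vals F p\<^esub> b' x p \<otimes>\<^bsub>vals F p\<^esub> c'' x y p =
        b x p \<otimes>\<^bsub>vals F p\<^esub> (c' x y p \<otimes>\<^bsub>vals F p\<^esub> b' y p)"
      using b'[OF xy] p bx cc by (simp add: m_assoc)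
    also have "\<dots> = c x y p \<otimes>\<^bsub>vals F p\<^esub> b y p \<otimes>\<^bsub>vals F p\<^esub> b' y p"
      using b[OF xy] p bx cc by (simp add: m_assoc[symmetric])
    finally show "b x p \<otimes>\<^bsub>vals F p\<^esub> b' x p \<otimes>\<^bsub>vals F p\<^esub> c'' x y p =
        c x y p \<otimes>\<^bsub>vals F p\<^esub> (b y p \<otimes>\<^bsub>vals F p\<^esub> b' y p)"
      using bx cc by (simp add: m_assoc)
  qed (use c c'' in auto)
qed

lemma coh_class_eq:
  assumes "(u, v) \<in> cohomologous T F"
  shows "coh_class T F u = coh_class T F v"
  unfolding coh_class_def
  using cohomologous_trans cohomologous_sym assms by blast

text \<open>The maps between cohomology groups are defined as unions over all representatives.
  Cohomologous representatives contribute the same class, so the union is the contribution of any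
  one of them.\<close>

lemma UN_coh_class:
  assumes "\<And>i. i \<in> I \<Longrightarrow> (u, f i) \<in> cohomologous T F" and "I \<noteq> {}"
  shows "(\<Union>i\<in>I. coh_class T F (f i)) = coh_class T F u"
proof -
  have "coh_class T F (f i) = coh_class T F u" if "i \<in> I" for i
    using coh_class_eq[OF assms(1)[OF that]] by simp
  then show ?thesis using assms(2) by simp
qed

end

section \<open>Sheaf morphisms and the induced maps on cohomology\<close>

definition sheaf_hom ::
    "'a topology \<Rightarrow> ('a, 's, 'z) sheaf_scheme \<Rightarrow> ('a, 't, 'y) sheaf_scheme \<Rightarrow> ('a \<Rightarrow> 's \<Rightarrow> 't) \<Rightarrow> bool" where
  "sheaf_hom T F G h \<longleftrightarrow>
     (\<forall>p\<in>topspace T. h p \<in> hom (vals F p) (vals G p)) \<and>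
     (\<forall>U. \<forall>s\<in>sections F U. (\<lambda>p. h p (s p)) \<in> sections G U)"

definition push_cochain :: "('a \<Rightarrow> 's \<Rightarrow> 't) \<Rightarrow> ('a, 's) cochain \<Rightarrow> ('a, 't) cochain" where
  "push_cochain h u = (fst u, \<lambda>x y p. h p (snd u x y p))"

lemma push_cocycle:
  assumes F: "ab_sheaf T F" and h: "sheaf_hom T F G h" and u: "u \<in> cocycles T F"
  shows "push_cochain h u \<in> cocycles T G"
proof -
  interpret F: ab_sheaf T F by (rule F)
  obtain U c where uc: "u = (U, c)" by force
  note c = F.cocycleD[OF u[unfolded uc]]
  have "h p (c x y p) \<otimes>\<^bsub>vals G p\<^esub> h p (c y z p) = h p (c x z p)"
    if xyz: "x \<in> topspace T" "y \<in> topspace T" "z \<in> topspace T" and p: "p \<in> U x \<inter> U y \<inter> U z" for x y z p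
  proof -
    have "p \<in> topspace T" using c(1)[OF xyz(1) xyz(1)] p openin_subset by blast
    then have "h p \<in> hom (vals F p) (vals G p)" using h by (auto simp: sheaf_hom_def)
    moreover have "c x y p \<in> carrier (vals F p)" "c y z p \<in> carrier (vals F p)"
      using c(4) xyz p by blast+
    ultimately show ?thesis
      using c(5)[OF xyz p] hom_mult by fastforce
  qed
  then show ?thesis
    using c(1,2,3) h by (auto simp: cocycles_def push_cochain_def uc sheaf_hom_def)
qed

lemma push_cohomologous:
  assumes F: "ab_sheaf T F" and G: "ab_sheaf T G" and h: "sheaf_hom T F G h"
    and uv: "(u, v) \<in> cohomologous T F"
  shows "(push_cochain h u, push_cochain h v) \<in> cohomologous T G"
proof -
  interpret F: ab_sheaf T F by (rule F)
  interpret G: ab_sheaf T G by (rule G)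
  obtain U c U' c' where u: "u = (U, c)" "v = (U', c')" by force
  from uv obtain V b where c: "(U, c) \<in> cocycles T F" "(U', c') \<in> cocycles T F"
    and V: "\<And>x. x \<in> topspace T \<Longrightarrow> openin T (V x) \<and> x \<in> V x \<and> V x \<subseteq> U x \<inter> U' x \<and> b x \<in> sections F (V x)"
    and b: "\<And>x y p. x \<in> topspace T \<Longrightarrow> y \<in> topspace T \<Longrightarrow> p \<in> V x \<inter> V y \<Longrightarrow>
           b x p \<otimes>\<^bsub>vals F p\<^esub> c' x y p = c x y p \<otimes>\<^bsub>vals F p\<^esub> b y p"
    unfolding u by (elim F.cohomologousE) blast
  have push: "push_cochain h u = (U, \<lambda>x y p. h p (c x y p))"
    "push_cochain h v = (U', \<lambda>x y p. h p (c' x y p))"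
    by (simp_all add: push_cochain_def u)
  show ?thesis unfolding push
  proof (rule G.cohomologousI[where V = V and b = "\<lambda>x p. h p (b x p)"])
    show "(U, \<lambda>x y p. h p (c x y p)) \<in> cocycles T G" "(U', \<lambda>x y p. h p (c' x y p)) \<in> cocycles T G"
      using push_cocycle[OF F h] c push u by metis+
    show "openin T (V x) \<and> x \<in> V x \<and> V x \<subseteq> U x \<inter> U' x \<and> (\<lambda>p. h p (b x p)) \<in> sections G (V x)"
      if "x \<in> topspace T" for x
      using V[OF that] h by (auto simp: sheaf_hom_def)
  next
    fix x y p assume xy: "x \<in> topspace T" "y \<in> topspace T" and p: "p \<in> V x \<inter> V y"
    have "p \<in> topspace T" using V[OF xy(1)] p F.in_topspace by blast
    then have hp: "h p \<in> hom (vals F p) (vals G p)" using h by (auto simp: sheaf_hom_def)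
    have bb: "b x p \<in> carrier (vals F p)" "b y p \<in> carrier (vals F p)"
      using V xy p F.sec_closed by blast+
    have "p \<in> U x \<inter> U y" "p \<in> U' x \<inter> U' y"
      using V xy p by blast+
    then have "c x y p \<in> carrier (vals F p)" "c' x y p \<in> carrier (vals F p)"
      using F.cocycleD(4)[OF c(1) xy] F.cocycleD(4)[OF c(2) xy] by blast+
    then show "h p (b x p) \<otimes>\<^bsub>vals G p\<^esub> h p (c' x y p) = h p (c x y p) \<otimes>\<^bsub>vals G p\<^esub> h p (b y p)"
      using b[OF xy p] bb hom_mult[OF hp] by metis
  qed
qed

text \<open>Representatives of one class have cohomologous images, so the union in
  \<open>H1_map\<close> collapses. This makes the Ueda class computable on explicit
  cocycles.\<close>

lemma H1_map_coh_class:
  assumes F: "ab_sheaf T F" and G: "ab_sheaf T G" and h: "sheaf_hom T F G h"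
    and u: "u \<in> cocycles T F"
  shows "H1_map T G h (coh_class T F u) = coh_class T G (push_cochain h u)"
proof -
  have "H1_map T G h (coh_class T F u) = (\<Union>v\<in>coh_class T F u. coh_class T G (push_cochain h v))"
    unfolding H1_map_def push_cochain_def by (auto simp: split_beta)
  also have "\<dots> = coh_class T G (push_cochain h u)"
    using push_cohomologous[OF F G h] ab_sheaf.cohomologous_refl[OF F u]
    by (intro ab_sheaf.UN_coh_class[OF G]) (auto simp: coh_class_def)
  finally show ?thesis .
qed

section \<open>Germs and inverse images\<close>

lemma germI: "openin T N \<Longrightarrow> y \<in> N \<Longrightarrow> (\<And>x. x \<in> N \<Longrightarrow> g x = f x) \<Longrightarrow> g \<in> germ T y f"
  unfolding germ_def by blast

lemma germE:
  assumes "g \<in> germ T y f"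
  obtains N where "openin T N" "y \<in> N" "\<And>x. x \<in> N \<Longrightarrow> g x = f x"
  using assms unfolding germ_def by blast

lemma germ_self: "y \<in> topspace T \<Longrightarrow> f \<in> germ T y f"
  by (rule germI[of T "topspace T"]) auto

lemma germ_cong:
  assumes "openin T N" "y \<in> N" "\<And>x. x \<in> N \<Longrightarrow> f x = g x"
  shows "germ T y f = germ T y g"
proof -
  have "h \<in> germ T y f \<longleftrightarrow> h \<in> germ T y g" for h
  proof
    assume "h \<in> germ T y f"
    then obtain M where "openin T M" "y \<in> M" "\<And>x. x \<in> M \<Longrightarrow> h x = f x" by (rule germE) blast
    then show "h \<in> germ T y g" using assms by (intro germI[of T "M \<inter> N"]) auto
  next
    assume "h \<in> germ T y g"
    then obtain M where "openin T M" "y \<in> M" "\<And>x. x \<in> M \<Longrightarrow> h x = g x" by (rule germE) blast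
    then show "h \<in> germ T y f" using assms by (intro germI[of T "M \<inter> N"]) auto
  qed
  then show ?thesis by blast
qed

text \<open>The operations on stalks are defined by unions over representatives.  All representatives
  give the same germ, so the union may be evaluated at any of them.\<close>

lemma UN_germ_local:
  assumes y: "y \<in> topspace T"
    and loc: "\<And>N f'. openin T N \<Longrightarrow> (\<forall>x\<in>N. f' x = f x) \<Longrightarrow> \<forall>x\<in>N. \<Phi> f' x = \<Phi> f x"
  shows "(\<Union>f'\<in>germ T y f. germ T y (\<Phi> f')) = germ T y (\<Phi> f)"
proof -
  have "germ T y (\<Phi> f') = germ T y (\<Phi> f)" if "f' \<in> germ T y f" for f'
    using that loc by (elim germE) (metis germ_cong)
  then show ?thesis using germ_self[OF y] by auto
qed

text \<open>Two topologies are needed for the module structure of the structure sheaf of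
  \<open>Y\<close>, where germs on \<open>X\<close> multiply germs on the subspace;
  \<open>finer\<close> says that neighbourhoods for \<open>T\<close> can be shrunk to neighbourhoods
  for \<open>T'\<close>.\<close>

lemma UN_germ2:
  assumes y: "y \<in> topspace T" and y': "y \<in> topspace T'"
    and finer: "\<And>N. openin T N \<Longrightarrow> y \<in> N \<Longrightarrow> \<exists>M. openin T' M \<and> y \<in> M \<and> M \<subseteq> N"
  shows "(\<Union>f'\<in>germ T y f. \<Union>g'\<in>germ T' y g. germ T' y (\<lambda>x. m x (f' x) (g' x))) = germ T' y (\<lambda>x. m x (f x) (g x))"
proof -
  have "germ T' y (\<lambda>x. m x (f' x) (g' x)) = germ T' y (\<lambda>x. m x (f x) (g x))"
    if f': "f' \<in> germ T y f" and g': "g' \<in> germ T' y g" for f' g'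
  proof -
    obtain N where N: "openin T N" "y \<in> N" "\<And>x. x \<in> N \<Longrightarrow> f' x = f x"
      using f' by (rule germE) blast
    obtain N' where N': "openin T' N'" "y \<in> N'" "\<And>x. x \<in> N' \<Longrightarrow> g' x = g x"
      using g' by (rule germE) blast
    obtain M where "openin T' M" "y \<in> M" "M \<subseteq> N"
      using N finer by meson
    then show ?thesis
      using N N' by (intro germ_cong[of _ "M \<inter> N'"]) auto
  qed
  then show ?thesis using germ_self[OF y, of f] germ_self[OF y', of g] by blast
qed

lemma UN_germ2_same:
  assumes y: "y \<in> topspace T"
  shows "(\<Union>f'\<in>germ T y f. \<Union>g'\<in>germ T y g. germ T y (\<lambda>x. m x (f' x) (g' x))) = germ T y (\<lambda>x. m x (f x) (g x))"
  using UN_germ2[OF y y] by blast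

lemma stalk_mult:
  "y \<in> topspace T \<Longrightarrow> germ T y f \<otimes>\<^bsub>stalk T F y\<^esub> germ T y g = germ T y (\<lambda>x. f x \<otimes>\<^bsub>vals F x\<^esub> g x)"
  unfolding stalk_def by (simp add: UN_germ2_same[where m = "\<lambda>x. mult (vals F x)"])

lemma stalk_one: "\<one>\<^bsub>stalk T F y\<^esub> = germ T y (\<lambda>x. \<one>\<^bsub>vals F x\<^esub>)"
  by (simp add: stalk_def)

lemma stalk_carrierI: "f \<in> sections F U \<Longrightarrow> openin T U \<Longrightarrow> y \<in> U \<Longrightarrow> germ T y f \<in> carrier (stalk T F y)"
  unfolding stalk_def by auto

lemma vals_inverse_image [simp]: "vals (inverse_image X Y F) = stalk X F"
  by (simp add: inverse_image_def)

lemma inverse_image_section_iff: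
  "s \<in> sections (inverse_image X Y F) V \<longleftrightarrow> openin (subtopology X Y) V \<and>
     (\<forall>y\<in>V. \<exists>U f. openin X U \<and> y \<in> U \<and> f \<in> sections F U \<and> (\<forall>z\<in>U \<inter> V. s z = germ X z f))"
  by (simp add: inverse_image_def)

context ab_sheaf
begin

lemma stalkE:
  assumes "a \<in> carrier (stalk T F y)"
  obtains U f where "openin T U" "y \<in> U" "f \<in> sections F U" "a = germ T y f"
  using assms unfolding stalk_def by auto

lemma stalkE2:
  assumes "a \<in> carrier (stalk T F y)" "b \<in> carrier (stalk T F y)"
  obtains U f g where "openin T U" "y \<in> U" "f \<in> sections F U" "g \<in> sections F U"
    "a = germ T y f" "b = germ T y g"
proof -
  obtain U f where 1: "openin T U" "y \<in> U" "f \<in> sections F U" "a = germ T y f"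
    using assms(1) by (rule stalkE) blast
  obtain V g where 2: "openin T V" "y \<in> V" "g \<in> sections F V" "b = germ T y g"
    using assms(2) by (rule stalkE) blast
  show thesis
    using 1 2 by (intro that[of "U \<inter> V" f g]) (auto intro: sec_restrict)
qed

lemma germ_eq_on_section:
  assumes "f \<in> sections F U" "y \<in> U" "\<And>p. p \<in> U \<Longrightarrow> f' p = g' p"
  shows "germ T y f' = germ T y g'"
  by (rule germ_cong[OF open_sec[OF assms(1)] assms(2,3)])

lemma comm_group_stalk:
  assumes y: "y \<in> topspace T"
  shows "comm_group (stalk T F y)"
proof (rule comm_groupI)
  note [simp] = stalk_mult[OF y] stalk_one
  show "\<one>\<^bsub>stalk T F y\<^esub> \<in> carrier (stalk T F y)"
    unfolding stalk_one by (rule stalk_carrierI[OF sec_one, of "topspace T"]) (use y in auto)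
  fix a assume a: "a \<in> carrier (stalk T F y)"
  then obtain U f where f: "openin T U" "y \<in> U" "f \<in> sections F U" "a = germ T y f"
    by (rule stalkE) blast
  have G: "comm_group (vals F p)" "f p \<in> carrier (vals F p)" if "p \<in> U" for p
    using that f comm_group in_topspace sec_closed by blast+
  show "\<one>\<^bsub>stalk T F y\<^esub> \<otimes>\<^bsub>stalk T F y\<^esub> a = a"
    unfolding f(4) by simp (rule germ_eq_on_section[OF f(3,2)], use G in \<open>simp add: comm_group_def group_def monoid.l_one\<close>)
  have "germ T y (\<lambda>p. inv\<^bsub>vals F p\<^esub> (f p)) \<in> carrier (stalk T F y)"
    using f by (blast intro: stalk_carrierI sec_inv)
  moreover have "germ T y (\<lambda>p. inv\<^bsub>vals F p\<^esub> (f p)) \<otimes>\<^bsub>stalk T F y\<^esub> a = \<one>\<^bsub>stalk T F y\<^esub>"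
    unfolding f(4) by simp (rule germ_eq_on_section[OF f(3,2)], use G in \<open>simp add: comm_group_def group.l_inv\<close>)
  ultimately show "\<exists>b\<in>carrier (stalk T F y). b \<otimes>\<^bsub>stalk T F y\<^esub> a = \<one>\<^bsub>stalk T F y\<^esub>"
    by blast
  fix b assume b: "b \<in> carrier (stalk T F y)"
  obtain V f g where fg: "openin T V" "y \<in> V" "f \<in> sections F V" "g \<in> sections F V"
    "a = germ T y f" "b = germ T y g"
    using a b by (rule stalkE2) blast
  have G': "comm_group (vals F p)" "f p \<in> carrier (vals F p)" "g p \<in> carrier (vals F p)"
    if "p \<in> V" for p
    using that fg comm_group in_topspace sec_closed by blast+
  show "a \<otimes>\<^bsub>stalk T F y\<^esub> b \<in> carrier (stalk T F y)"
    unfolding fg(5,6) by simp (rule stalk_carrierI[OF sec_mult[OF fg(3,4)] fg(1,2)])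
  show "a \<otimes>\<^bsub>stalk T F y\<^esub> b = b \<otimes>\<^bsub>stalk T F y\<^esub> a"
    unfolding fg(5,6) by simp (rule germ_eq_on_section[OF fg(3,2)], use G' in \<open>simp add: comm_group_def comm_monoid.m_comm\<close>)
  fix c assume "c \<in> carrier (stalk T F y)"
  then obtain W k where k: "openin T W" "y \<in> W" "k \<in> sections F W" "c = germ T y k"
    by (rule stalkE) blast
  have "k p \<in> carrier (vals F p)" if "p \<in> W" for p
    using that k sec_closed by blast
  then have "f p \<otimes>\<^bsub>vals F p\<^esub> g p \<otimes>\<^bsub>vals F p\<^esub> k p = f p \<otimes>\<^bsub>vals F p\<^esub> (g p \<otimes>\<^bsub>vals F p\<^esub> k p)"
    if "p \<in> V \<inter> W" for p
    using that G'[of p] by (intro monoid.m_assoc) (auto simp: comm_group_def group_def)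
  then show "a \<otimes>\<^bsub>stalk T F y\<^esub> b \<otimes>\<^bsub>stalk T F y\<^esub> c = a \<otimes>\<^bsub>stalk T F y\<^esub> (b \<otimes>\<^bsub>stalk T F y\<^esub> c)"
    unfolding fg k by simp (rule germ_cong[of T "V \<inter> W"], use fg k in auto)
qed

lemma stalk_inv:
  assumes f: "f \<in> sections F U" "y \<in> U"
  shows "inv\<^bsub>stalk T F y\<^esub> (germ T y f) = germ T y (\<lambda>p. inv\<^bsub>vals F p\<^esub> (f p))"
proof -
  have y: "y \<in> topspace T" using in_topspace[OF f] .
  interpret S: comm_group "stalk T F y" by (rule comm_group_stalk[OF y])
  have op: "openin T U" using f open_sec by blast
  have "germ T y (\<lambda>p. inv\<^bsub>vals F p\<^esub> (f p)) \<otimes>\<^bsub>stalk T F y\<^esub> germ T y f = \<one>\<^bsub>stalk T F y\<^esub>"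
    unfolding stalk_mult[OF y] stalk_one
    by (rule germ_eq_on_section[OF f]) (use comm_group in_topspace[OF f(1)] sec_closed[OF f(1)] in
        \<open>simp add: comm_group_def group.l_inv\<close>)
  then show ?thesis
    using f op by (intro S.inv_equality stalk_carrierI sec_inv)
qed

lemma ab_sheaf_inverse_image:
  assumes Y: "Y \<subseteq> topspace T"
  shows "ab_sheaf (subtopology T Y) (inverse_image T Y F)"
proof (rule ab_sheaf.intro)
  let ?I = "inverse_image T Y F"
  show "comm_group (vals ?I p)" if "p \<in> topspace (subtopology T Y)" for p
    using that comm_group_stalk by simp
  fix s V assume s: "s \<in> sections ?I V"
  then have op: "openin (subtopology T Y) V"
    and loc: "\<And>y. y \<in> V \<Longrightarrow> \<exists>U f. openin T U \<and> y \<in> U \<and> f \<in> sections F U \<and> (\<forall>z\<in>U \<inter> V. s z = germ T z f)"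
    unfolding inverse_image_section_iff by blast+
  show "openin (subtopology T Y) V" by (rule op)
  show "s p \<in> carrier (vals ?I p)" if p: "p \<in> V" for p
  proof -
    obtain U f where "openin T U" "p \<in> U" "f \<in> sections F U" "\<forall>z\<in>U \<inter> V. s z = germ T z f"
      using loc[OF p] by blast
    then show ?thesis using p stalk_carrierI[of f F U T p] by simp
  qed
  show "s \<in> sections ?I W" if "openin (subtopology T Y) W" "W \<subseteq> V" for W
    unfolding inverse_image_section_iff
  proof (intro conjI ballI that(1))
    fix y assume "y \<in> W"
    then have "y \<in> V" using \<open>W \<subseteq> V\<close> by blast
    from loc[OF this]
    obtain U f where "openin T U" "y \<in> U" "f \<in> sections F U" "\<forall>z\<in>U \<inter> V. s z = germ T z f"
      by blast
    then show "\<exists>U f. openin T U \<and> y \<in> U \<and> f \<in> sections F U \<and> (\<forall>z\<in>U \<inter> W. s z = germ T z f)"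
      using \<open>W \<subseteq> V\<close> by (intro exI[of _ U] exI[of _ f]) auto
  qed
  show "(\<lambda>p. inv\<^bsub>vals ?I p\<^esub> (s p)) \<in> sections ?I V"
    unfolding inverse_image_section_iff
  proof (intro conjI op ballI)
    fix y assume "y \<in> V"
    from loc[OF this]
    obtain U f where "openin T U" "y \<in> U" "f \<in> sections F U" "\<forall>z\<in>U \<inter> V. s z = germ T z f"
      by blast
    then show "\<exists>U f. openin T U \<and> y \<in> U \<and> f \<in> sections F U \<and>
        (\<forall>z\<in>U \<inter> V. inv\<^bsub>vals ?I z\<^esub> s z = germ T z f)"
      using stalk_inv sec_inv by (intro exI[of _ U] exI[of _ "\<lambda>p. inv\<^bsub>vals F p\<^esub> (f p)"] conjI) auto
  qed
  fix s' assume s': "s' \<in> sections ?I V"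
  then have loc': "\<And>y. y \<in> V \<Longrightarrow> \<exists>U f. openin T U \<and> y \<in> U \<and> f \<in> sections F U \<and> (\<forall>z\<in>U \<inter> V. s' z = germ T z f)"
    unfolding inverse_image_section_iff by blast
  show "(\<lambda>p. s p \<otimes>\<^bsub>vals ?I p\<^esub> s' p) \<in> sections ?I V"
    unfolding inverse_image_section_iff
  proof (intro conjI op ballI)
    fix y assume y: "y \<in> V"
    from loc[OF y]
    obtain U f where 1: "openin T U" "y \<in> U" "f \<in> sections F U" "\<forall>z\<in>U \<inter> V. s z = germ T z f"
      by blast
    from loc'[OF y]
    obtain U' f' where 2: "openin T U'" "y \<in> U'" "f' \<in> sections F U'" "\<forall>z\<in>U' \<inter> V. s' z = germ T z f'"
      by blast
    have "openin T (U \<inter> U')" using 1 2 by blast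
    then have "f \<in> sections F (U \<inter> U')" "f' \<in> sections F (U \<inter> U')"
      using 1 2 sec_restrict by blast+
    note sec_mult[OF this]
    then show "\<exists>U f. openin T U \<and> y \<in> U \<and> f \<in> sections F U \<and>
        (\<forall>z\<in>U \<inter> V. s z \<otimes>\<^bsub>vals ?I z\<^esub> s' z = germ T z f)"
      using 1 2 \<open>openin T (U \<inter> U')\<close> in_topspace
      by (intro exI[of _ "U \<inter> U'"] exI[of _ "\<lambda>p. f p \<otimes>\<^bsub>vals F p\<^esub> f' p"] conjI) (auto simp: stalk_mult)
  qed
next
  fix U assume "openin (subtopology T Y) U"
  then show "(\<lambda>p. \<one>\<^bsub>vals (inverse_image T Y F) p\<^esub>) \<in> sections (inverse_image T Y F) U"
    using sec_one[OF openin_topspace] openin_subset[of "subtopology T Y" U]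
    unfolding inverse_image_section_iff
    by (intro conjI ballI exI[of _ "topspace T"] exI[of _ "\<lambda>p. \<one>\<^bsub>vals F p\<^esub>"]) (auto simp: stalk_one)
qed

lemma germ_section_inverse_image:
  assumes "s \<in> sections F U" "openin (subtopology T Y) V" "V \<subseteq> U"
  shows "(\<lambda>p. germ T p s) \<in> sections (inverse_image T Y F) V"
  using assms open_sec unfolding inverse_image_section_iff by blast

definition restrict_cochain :: "'a set \<Rightarrow> ('a, 's) cochain \<Rightarrow> ('a, ('a \<Rightarrow> 's) set) cochain" where
  "restrict_cochain Y u = (\<lambda>x. fst u x \<inter> Y, \<lambda>x y p. germ T p (snd u x y))"

lemma restrict_cocycle:
  assumes Y: "Y \<subseteq> topspace T" and u: "u \<in> cocycles T F"
  shows "restrict_cochain Y u \<in> cocycles (subtopology T Y) (inverse_image T Y F)"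
proof -
  obtain U c where uc: "u = (U, c)" by force
  note c = cocycleD[OF u[unfolded uc]]
  have top: "topspace (subtopology T Y) = Y" using Y by auto
  have op: "openin (subtopology T Y) (U x \<inter> Y)" if "x \<in> Y" for x
    using c(1)[of x x] that Y by (auto intro: openin_subtopology_Int)
  have "germ T p (c x y) \<otimes>\<^bsub>stalk T F p\<^esub> germ T p (c y z) = germ T p (c x z)"
    if xyz: "x \<in> Y" "y \<in> Y" "z \<in> Y" and p: "p \<in> U x \<inter> U y \<inter> U z" for x y z p
  proof -
    have t: "x \<in> topspace T" "y \<in> topspace T" "z \<in> topspace T" using xyz Y by auto
    have op: "openin T (U x \<inter> U y \<inter> U z)" using c(1) t by blast
    then have "p \<in> topspace T" using p openin_subset by blast
    then show ?thesis
      unfolding stalk_mult[OF \<open>p \<in> topspace T\<close>]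
      by (intro germ_cong[OF op]) (use c(5)[OF t] p in auto)
  qed
  moreover have "(\<lambda>p. germ T p (c x y)) \<in> sections (inverse_image T Y F) ((U x \<inter> Y) \<inter> (U y \<inter> Y))"
    if "x \<in> Y" "y \<in> Y" for x y
    using that Y op by (intro germ_section_inverse_image[OF c(3)[of x y]]) auto
  ultimately show ?thesis
    using op c(2) Y unfolding cocycles_def restrict_cochain_def uc top by (auto simp: subset_iff)
qed

lemma restrict_cohomologous:
  assumes Y: "Y \<subseteq> topspace T" and uv: "(u, v) \<in> cohomologous T F"
  shows "(restrict_cochain Y u, restrict_cochain Y v) \<in> cohomologous (subtopology T Y) (inverse_image T Y F)"
proof -
  interpret I: ab_sheaf "subtopology T Y" "inverse_image T Y F"
    by (rule ab_sheaf_inverse_image[OF Y])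
  obtain U c U' c' where u: "u = (U, c)" "v = (U', c')" by force
  from uv obtain V b where c: "(U, c) \<in> cocycles T F" "(U', c') \<in> cocycles T F"
    and V: "\<And>x. x \<in> topspace T \<Longrightarrow> openin T (V x) \<and> x \<in> V x \<and> V x \<subseteq> U x \<inter> U' x \<and> b x \<in> sections F (V x)"
    and b: "\<And>x y p. x \<in> topspace T \<Longrightarrow> y \<in> topspace T \<Longrightarrow> p \<in> V x \<inter> V y \<Longrightarrow>
           b x p \<otimes>\<^bsub>vals F p\<^esub> c' x y p = c x y p \<otimes>\<^bsub>vals F p\<^esub> b y p"
    unfolding u by (elim cohomologousE) blast
  have top: "topspace (subtopology T Y) = Y" using Y by auto
  have res: "restrict_cochain Y u = (\<lambda>x. U x \<inter> Y, \<lambda>x y p. germ T p (c x y))"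
    "restrict_cochain Y v = (\<lambda>x. U' x \<inter> Y, \<lambda>x y p. germ T p (c' x y))"
    by (simp_all add: restrict_cochain_def u)
  show ?thesis unfolding res
  proof (rule I.cohomologousI[where V = "\<lambda>x. V x \<inter> Y" and b = "\<lambda>x p. germ T p (b x)"], unfold top)
    show "(\<lambda>x. U x \<inter> Y, \<lambda>x y p. germ T p (c x y)) \<in> cocycles (subtopology T Y) (inverse_image T Y F)"
      "(\<lambda>x. U' x \<inter> Y, \<lambda>x y p. germ T p (c' x y)) \<in> cocycles (subtopology T Y) (inverse_image T Y F)"
      using restrict_cocycle[OF Y] c res u by metis+
    fix x assume x: "x \<in> Y"
    then have "openin (subtopology T Y) (V x \<inter> Y)"
      using V[of x] Y by (auto intro: openin_subtopology_Int)
    then show "openin (subtopology T Y) (V x \<inter> Y) \<and> x \<in> V x \<inter> Y \<and> V x \<inter> Y \<subseteq> U x \<inter> Y \<inter> (U' x \<inter> Y) \<and>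
       (\<lambda>p. germ T p (b x)) \<in> sections (inverse_image T Y F) (V x \<inter> Y)"
      using V[of x] x Y by (auto intro!: germ_section_inverse_image[of _ "V x"])
    fix y p assume y: "y \<in> Y" and p: "p \<in> V x \<inter> Y \<inter> (V y \<inter> Y)"
    have "openin T (V x \<inter> V y)" using V x y Y by blast
    moreover have "p \<in> topspace T" using p Y by blast
    ultimately show "germ T p (b x) \<otimes>\<^bsub>vals (inverse_image T Y F) p\<^esub> germ T p (c' x y) =
       germ T p (c x y) \<otimes>\<^bsub>vals (inverse_image T Y F) p\<^esub> germ T p (b y)"
      using x y p Y
      by (simp add: stalk_mult)
        (rule germ_cong[of T "V x \<inter> V y"], auto intro!: b)
  qed
qed

lemma H1_restrict_coh_class:
  assumes Y: "Y \<subseteq> topspace T" and u: "u \<in> cocycles T F"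
  shows "H1_restrict T Y F (coh_class T F u) =
    coh_class (subtopology T Y) (inverse_image T Y F) (restrict_cochain Y u)"
proof -
  have "H1_restrict T Y F (coh_class T F u) =
      (\<Union>v\<in>coh_class T F u. coh_class (subtopology T Y) (inverse_image T Y F) (restrict_cochain Y v))"
    unfolding H1_restrict_def restrict_cochain_def by (auto simp: split_beta)
  also have "\<dots> = coh_class (subtopology T Y) (inverse_image T Y F) (restrict_cochain Y u)"
    using restrict_cohomologous[OF Y] cohomologous_refl[OF u]
    by (intro ab_sheaf.UN_coh_class[OF ab_sheaf_inverse_image[OF Y]]) (auto simp: coh_class_def)
  finally show ?thesis .
qed

end

text \<open>The operation \<open>\<Phi>\<close> acts on functions and not on their values, because
  the logarithmic derivative at a point depends on the germ. Locality lets it descend to germs, and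
  these are the values of the sections of an inverse image.\<close>

lemma sheaf_hom_inverse_image:
  assumes F: "ab_sheaf X F" and Y: "Y \<subseteq> topspace X"
    and loc: "\<And>N f f'. openin X N \<Longrightarrow> (\<forall>x\<in>N. f' x = f x) \<Longrightarrow> \<forall>x\<in>N. \<Phi> f' x = \<Phi> f x"
    and sec: "\<And>U s. s \<in> sections F U \<Longrightarrow> \<Phi> s \<in> sections G U"
    and mult: "\<And>U s s' x. s \<in> sections F U \<Longrightarrow> s' \<in> sections F U \<Longrightarrow> x \<in> U \<Longrightarrow>
       \<Phi> (\<lambda>p. s p \<otimes>\<^bsub>vals F p\<^esub> s' p) x = \<Phi> s x \<otimes>\<^bsub>vals G x\<^esub> \<Phi> s' x"
  shows "sheaf_hom (subtopology X Y) (inverse_image X Y F) (inverse_image X Y G)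
    (\<lambda>p a. \<Union>f\<in>a. germ X p (\<Phi> f))"
proof -
  interpret F: ab_sheaf X F by (rule F)
  have UN: "(\<Union>f\<in>germ X p g. germ X p (\<Phi> f)) = germ X p (\<Phi> g)" if "p \<in> topspace X" for p g
    by (rule UN_germ_local[OF that loc])
  have "(\<Union>f\<in>a. germ X p (\<Phi> f)) \<in> carrier (stalk X G p)"
    if "p \<in> topspace X" "a \<in> carrier (stalk X F p)" for p a
    using that(2)
  proof (rule F.stalkE)
    fix U f assume "openin X U" "p \<in> U" "f \<in> sections F U" "a = germ X p f"
    then show ?thesis
      using sec stalk_carrierI[of "\<Phi> f" G U X p] by (simp add: UN[OF that(1)])
  qed
  moreover have "(\<Union>f\<in>a \<otimes>\<^bsub>stalk X F p\<^esub> b. germ X p (\<Phi> f)) =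
      (\<Union>f\<in>a. germ X p (\<Phi> f)) \<otimes>\<^bsub>stalk X G p\<^esub> (\<Union>f\<in>b. germ X p (\<Phi> f))"
    if p: "p \<in> topspace X" and ab: "a \<in> carrier (stalk X F p)" "b \<in> carrier (stalk X F p)" for p a b
  proof -
    obtain U f g where "openin X U" "p \<in> U" "f \<in> sections F U" "g \<in> sections F U"
      "a = germ X p f" "b = germ X p g"
      using ab by (rule F.stalkE2) blast
    then show ?thesis
      using mult[of f U g] by (simp add: UN[OF p] stalk_mult[OF p]) (rule germ_cong[of X U], auto)
  qed
  ultimately have "(\<lambda>a. \<Union>f\<in>a. germ X p (\<Phi> f)) \<in> hom (stalk X F p) (stalk X G p)"
    if "p \<in> topspace X" for p
    using that by (intro homI) simp_all
  moreover have "(\<lambda>p. \<Union>f\<in>s p. germ X p (\<Phi> f)) \<in> sections (inverse_image X Y G) U"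
    if s: "s \<in> sections (inverse_image X Y F) U" for s U
    unfolding inverse_image_section_iff
  proof (intro conjI ballI)
    show "openin (subtopology X Y) U" using that unfolding inverse_image_section_iff by blast
    fix y assume y: "y \<in> U"
    from s have "\<exists>N f. openin X N \<and> y \<in> N \<and> f \<in> sections F N \<and> (\<forall>z\<in>N \<inter> U. s z = germ X z f)"
      using y unfolding inverse_image_section_iff by (elim conjE) (erule (1) bspec)
    then obtain N f where "openin X N" "y \<in> N" "f \<in> sections F N" "\<forall>z\<in>N \<inter> U. s z = germ X z f"
      by blast
    then show "\<exists>N f. openin X N \<and> y \<in> N \<and> f \<in> sections G N \<and>
        (\<forall>z\<in>N \<inter> U. (\<Union>f\<in>s z. germ X z (\<Phi> f)) = germ X z f)"
      using sec UN F.in_topspace by (intro exI[of _ N] conjI exI[of _ "\<Phi> f"]) auto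
  qed
  ultimately show ?thesis
    unfolding sheaf_hom_def by simp
qed

lemma sheaf_hom_inverse_image_id:
  assumes F: "ab_sheaf X F" and "vals F = vals G" and "\<And>U. sections F U \<subseteq> sections G U"
  shows "sheaf_hom (subtopology X Y) (inverse_image X Y F) (inverse_image X Y G) (\<lambda>p m. m)"
proof -
  have "mult (stalk X F p) = mult (stalk X G p)" "carrier (stalk X F p) \<subseteq> carrier (stalk X G p)" for p
    using assms by (auto simp: stalk_def)
  then have "(\<lambda>m. m) \<in> hom (stalk X F p) (stalk X G p)" for p
    by (auto simp: hom_def)
  moreover have "sections (inverse_image X Y F) U \<subseteq> sections (inverse_image X Y G) U" for U
  proof
    fix s assume s: "s \<in> sections (inverse_image X Y F) U"
    show "s \<in> sections (inverse_image X Y G) U"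
      unfolding inverse_image_section_iff
    proof (intro conjI ballI)
      show "openin (subtopology X Y) U" using s unfolding inverse_image_section_iff by blast
      fix y assume y: "y \<in> U"
      from s have "\<exists>N f. openin X N \<and> y \<in> N \<and> f \<in> sections F N \<and> (\<forall>z\<in>N \<inter> U. s z = germ X z f)"
        using y unfolding inverse_image_section_iff by (elim conjE) (erule (1) bspec)
      then obtain N f where "openin X N" "y \<in> N" "f \<in> sections F N" "\<forall>z\<in>N \<inter> U. s z = germ X z f"
        by blast
      then show "\<exists>N f. openin X N \<and> y \<in> N \<and> f \<in> sections G N \<and> (\<forall>z\<in>N \<inter> U. s z = germ X z f)"
        using assms(3) by (intro exI[of _ N] exI[of _ f]) auto
    qed
  qed
  ultimately show ?thesis
    unfolding sheaf_hom_def by (simp add: subset_iff)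
qed

section \<open>Holomorphic functions and 1-forms on complex manifolds\<close>

definition holo_at :: "('a, 'n::finite) chart set \<Rightarrow> ('a \<Rightarrow> complex) \<Rightarrow> 'a \<Rightarrow> bool" where
  "holo_at A f x \<longleftrightarrow> (\<forall>(W, \<phi>)\<in>A. x \<in> W \<longrightarrow> cdiff_at (\<lambda>z. f (inv_into W \<phi> z)) (\<phi> x))"

lemma holo_fun_iff:
  assumes "\<And>W \<phi>. (W, \<phi>) \<in> A \<Longrightarrow> inj_on \<phi> W"
  shows "holo_fun A U f \<longleftrightarrow> (\<forall>x\<in>U. holo_at A f x)"
  unfolding holo_fun_def holo_at_def cholo_on_iff by fastforce

lemma cgrad_nth: "cgrad (W, \<phi>) f x $ i = cpartial i (\<lambda>z. f (inv_into W \<phi> z)) (\<phi> x)"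
  by (simp add: cgrad_def cpartial_def)

locale cmanifold =
  fixes X :: "'a topology" and A :: "('a, 'n::finite) chart set"
  assumes complex_manifold: "complex_manifold X A"
begin

lemma chartD:
  assumes "(W, \<phi>) \<in> A"
  shows "openin X W" "open (\<phi> ` W)" "inj_on \<phi> W"
    and "homeomorphic_map (subtopology X W) (top_of_set (\<phi> ` W)) \<phi>"
proof -
  have c: "is_chart X (W, \<phi>)"
    using complex_manifold assms unfolding complex_manifold_def by blast
  then show "openin X W" "open (\<phi> ` W)"
    and hm: "homeomorphic_map (subtopology X W) (top_of_set (\<phi> ` W)) \<phi>"
    by (auto simp: is_chart_def)
  have "topspace (subtopology X W) = W"
    using c openin_subset by (fastforce simp: is_chart_def)
  then show "inj_on \<phi> W"
    using homeomorphic_imp_injective_map[OF hm] by simp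
qed

lemma chart_inverse: "(W, \<phi>) \<in> A \<Longrightarrow> x \<in> W \<Longrightarrow> inv_into W \<phi> (\<phi> x) = x"
  by (simp add: chartD(3))

lemma chart_exists:
  assumes "x \<in> topspace X"
  obtains W \<phi> where "(W, \<phi>) \<in> A" "x \<in> W"
proof -
  have "\<exists>c\<in>A. x \<in> fst c"
    using assms complex_manifold unfolding complex_manifold_def by blast
  then show thesis using that by force
qed

lemma chart_transition:
  "(W, \<phi>) \<in> A \<Longrightarrow> (V, \<psi>) \<in> A \<Longrightarrow> cholo_on (\<phi> ` (W \<inter> V)) (\<lambda>z. \<psi> (inv_into W \<phi> z) $ i)"
  using complex_manifold unfolding complex_manifold_def transition_holo_def by fastforce

lemma open_chart_image:
  assumes "(W, \<phi>) \<in> A" "openin X U"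
  shows "open (\<phi> ` (U \<inter> W))"
proof -
  note c = chartD[OF assms(1)]
  have "openin (subtopology X W) (U \<inter> W)"
    using assms(2) by (auto simp: openin_subtopology)
  then have "openin (top_of_set (\<phi> ` W)) (\<phi> ` (U \<inter> W))"
    using homeomorphic_imp_open_map[OF c(4)] by (auto simp: open_map_def)
  then show ?thesis
    using c(2) by (simp add: openin_open_eq)
qed

lemma openin_chart_preimage:
  assumes "(W, \<phi>) \<in> A" "open S"
  shows "openin X {x \<in> W. \<phi> x \<in> S}"
proof -
  note c = chartD[OF assms(1)]
  have W: "W \<subseteq> topspace X" using c(1) by (rule openin_subset)
  have "continuous_map (subtopology X W) (top_of_set (\<phi> ` W)) \<phi>"
    using c(4) by (rule homeomorphic_imp_continuous_map)
  moreover have "openin (top_of_set (\<phi> ` W)) (\<phi> ` W \<inter> S)"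
    using assms(2) by auto
  ultimately have "openin (subtopology X W) {x \<in> topspace (subtopology X W). \<phi> x \<in> \<phi> ` W \<inter> S}"
    by (rule openin_continuous_map_preimage)
  moreover have "{x \<in> topspace (subtopology X W). \<phi> x \<in> \<phi> ` W \<inter> S} = {x \<in> W. \<phi> x \<in> S}"
    using W by auto
  ultimately show ?thesis
    by (simp only: openin_open_subtopology[OF c(1)])
qed

lemma holo_fun_iff_at: "holo_fun A U f \<longleftrightarrow> (\<forall>x\<in>U. holo_at A f x)"
  by (rule holo_fun_iff) (rule chartD)

lemma holo_atD: "holo_at A f x \<Longrightarrow> (W, \<phi>) \<in> A \<Longrightarrow> x \<in> W \<Longrightarrow> cdiff_at (\<lambda>z. f (inv_into W \<phi> z)) (\<phi> x)"
  unfolding holo_at_def by blast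

lemma chart_change:
  assumes "(W, \<phi>) \<in> A" "(V, \<psi>) \<in> A" "z \<in> \<psi> ` (W \<inter> V)"
  shows "f (inv_into V \<psi> z) = f (inv_into W \<phi> (\<phi> (inv_into V \<psi> z)))"
  using assms chart_inverse[of W \<phi>] chart_inverse[of V \<psi>] by auto

text \<open>Holomorphic transition functions carry complex differentiability from one chart at
  \<open>x\<close> to every other.\<close>

lemma holo_at_chart:
  assumes "(W, \<phi>) \<in> A" "x \<in> W" "cdiff_at (\<lambda>z. f (inv_into W \<phi> z)) (\<phi> x)"
  shows "holo_at A f x"
  unfolding holo_at_def
proof (safe)
  fix V \<psi> assume V: "(V, \<psi>) \<in> A" "x \<in> V"
  have op: "open (\<psi> ` (W \<inter> V))"
    using open_chart_image[OF V(1) chartD(1)[OF assms(1)]] .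
  have x: "\<psi> x \<in> \<psi> ` (W \<inter> V)" using assms V by auto
  have inv: "inv_into V \<psi> (\<psi> x) = x" using chart_inverse V by blast
  have "cdiff_at (\<lambda>z. f (inv_into W \<phi> (\<phi> (inv_into V \<psi> z)))) (\<psi> x)"
  proof (rule cdiff_at_compose)
    show "cdiff_at (\<lambda>z. f (inv_into W \<phi> z)) (\<phi> (inv_into V \<psi> (\<psi> x)))"
      using assms(3) inv by simp
    show "cdiff_at (\<lambda>z. \<phi> (inv_into V \<psi> z) $ i) (\<psi> x)" for i
      using chart_transition[OF V(1) assms(1)] x by (auto simp: cholo_on_iff Int_commute)
  qed
  then show "cdiff_at (\<lambda>z. f (inv_into V \<psi> z)) (\<psi> x)"
    by (rule cdiff_at_cong[OF _ op x]) (rule chart_change[OF assms(1) V(1)])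
qed

lemma chart_nbhd:
  assumes "(W, \<phi>) \<in> A" "x \<in> W" "openin X N" "x \<in> N"
  shows "open (\<phi> ` (N \<inter> W))" "\<phi> x \<in> \<phi> ` (N \<inter> W)"
    and "z \<in> \<phi> ` (N \<inter> W) \<Longrightarrow> inv_into W \<phi> z \<in> N \<inter> W"
    and "z \<in> \<phi> ` (N \<inter> W) \<Longrightarrow> \<phi> (inv_into W \<phi> z) = z"
  using open_chart_image[OF assms(1,3)] assms chart_inverse[OF assms(1)] by auto

lemma holo_at_cong:
  assumes "holo_at A f x" "openin X N" "x \<in> N" "\<And>y. y \<in> N \<Longrightarrow> g y = f y"
  shows "holo_at A g x"
proof -
  obtain W \<phi> where c: "(W, \<phi>) \<in> A" "x \<in> W"
    using chart_exists assms(2,3) openin_subset by (metis in_mono)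
  note n = chart_nbhd[OF c assms(2,3)]
  have "cdiff_at (\<lambda>z. g (inv_into W \<phi> z)) (\<phi> x)"
    using n(3) assms(4) by (intro cdiff_at_cong[OF holo_atD[OF assms(1) c] n(1,2)]) auto
  then show ?thesis using holo_at_chart c by blast
qed

lemma holo_at_const: "holo_at A (\<lambda>y. c) x"
  by (auto simp: holo_at_def)

lemma holo_at_add: "holo_at A f x \<Longrightarrow> holo_at A g x \<Longrightarrow> holo_at A (\<lambda>y. f y + g y) x"
  by (auto simp: holo_at_def intro!: cdiff_at_add)

lemma holo_at_mult: "holo_at A f x \<Longrightarrow> holo_at A g x \<Longrightarrow> holo_at A (\<lambda>y. f y * g y) x"
  by (auto simp: holo_at_def intro!: cdiff_at_mult)

lemma holo_at_minus: "holo_at A f x \<Longrightarrow> holo_at A (\<lambda>y. - f y) x"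
  by (auto simp: holo_at_def intro!: cdiff_at_minus)

lemma holo_at_compose_field:
  "holo_at A f x \<Longrightarrow> (g has_field_derivative g') (at (f x)) \<Longrightarrow> holo_at A (\<lambda>y. g (f y)) x"
  using chart_inverse
  by (auto simp: holo_at_def intro!: cdiff_at_compose_field[where g = g and g' = g'])

lemma holo_at_inverse: "holo_at A f x \<Longrightarrow> f x \<noteq> 0 \<Longrightarrow> holo_at A (\<lambda>y. inverse (f y)) x"
  by (rule holo_at_compose_field[OF _ DERIV_inverse])

lemma holo_at_coordinate:
  assumes "(W, \<phi>) \<in> A" "x \<in> W"
  shows "holo_at A (\<lambda>y. \<phi> y $ i) x"
proof (rule holo_at_chart[OF assms])
  note n = chart_nbhd[OF assms chartD(1)[OF assms(1)] assms(2)]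
  show "cdiff_at (\<lambda>z. \<phi> (inv_into W \<phi> z) $ i) (\<phi> x)"
    by (rule cdiff_at_cong[OF cdiff_at_nth n(1,2)]) (simp only: n(4))
qed

section \<open>Gradients in charts, differentials and logarithmic derivatives\<close>

lemma cgrad_cong:
  assumes "(W, \<phi>) \<in> A" "x \<in> W" "openin X N" "x \<in> N" "\<And>y. y \<in> N \<Longrightarrow> f y = g y"
  shows "cgrad (W, \<phi>) f x = cgrad (W, \<phi>) g x"
proof -
  note n = chart_nbhd[OF assms(1-4)]
  have "cpartial i (\<lambda>z. f (inv_into W \<phi> z)) (\<phi> x) = cpartial i (\<lambda>z. g (inv_into W \<phi> z)) (\<phi> x)" for i
    using n(3) assms(5) by (intro cpartial_cong[OF n(1,2)]) auto
  then show ?thesis by (simp add: vec_eq_iff cgrad_nth)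
qed

lemma holo_at_has_derivative:
  assumes "holo_at A f x" "(W, \<phi>) \<in> A" "x \<in> W"
  shows "((\<lambda>z. f (inv_into W \<phi> z)) has_derivative (\<lambda>v. \<Sum>i\<in>UNIV. v $ i * cgrad (W, \<phi>) f x $ i)) (at (\<phi> x))"
  using cdiff_at_has_derivative[OF holo_atD[OF assms]] by (simp add: cgrad_nth)

lemma cgrad_eqI:
  assumes "((\<lambda>z. f (inv_into W \<phi> z)) has_derivative (\<lambda>v. \<Sum>i\<in>UNIV. v $ i * a $ i)) (at (\<phi> x))"
  shows "cgrad (W, \<phi>) f x = a"
  using cpartial_eqI[OF assms] by (simp add: vec_eq_iff cgrad_nth)

lemma cgrad_compose_field:
  assumes "holo_at A f x" "(W, \<phi>) \<in> A" "x \<in> W" "(g has_field_derivative g') (at (f x))"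
  shows "cgrad (W, \<phi>) (\<lambda>y. g (f y)) x = g' *s cgrad (W, \<phi>) f x"
proof (rule cgrad_eqI)
  have "(g has_derivative (*) g') (at (f (inv_into W \<phi> (\<phi> x))))"
    using assms(4) chart_inverse[OF assms(2,3)] by (simp add: has_field_derivative_def)
  from has_derivative_compose[OF holo_at_has_derivative[OF assms(1-3)] this]
  show "((\<lambda>z. g (f (inv_into W \<phi> z))) has_derivative
      (\<lambda>v. \<Sum>i\<in>UNIV. v $ i * (g' *s cgrad (W, \<phi>) f x) $ i)) (at (\<phi> x))"
    by (simp add: sum_distrib_left mult.left_commute)
qed

lemma cgrad_mult:
  assumes "holo_at A f x" "holo_at A g x" "(W, \<phi>) \<in> A" "x \<in> W"
  shows "cgrad (W, \<phi>) (\<lambda>y. f y * g y) x = f x *s cgrad (W, \<phi>) g x + g x *s cgrad (W, \<phi>) f x"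
proof (rule cgrad_eqI)
  from has_derivative_mult[OF holo_at_has_derivative[OF assms(1,3,4)] holo_at_has_derivative[OF assms(2,3,4)]]
  have "((\<lambda>z. f (inv_into W \<phi> z) * g (inv_into W \<phi> z)) has_derivative
      (\<lambda>v. f x * (\<Sum>i\<in>UNIV. v $ i * cgrad (W, \<phi>) g x $ i) +
        (\<Sum>i\<in>UNIV. v $ i * cgrad (W, \<phi>) f x $ i) * g x)) (at (\<phi> x))"
    using chart_inverse[OF assms(3,4)] by simp
  moreover have "(\<lambda>v. f x * (\<Sum>i\<in>UNIV. v $ i * cgrad (W, \<phi>) g x $ i) +
        (\<Sum>i\<in>UNIV. v $ i * cgrad (W, \<phi>) f x $ i) * g x) =
      (\<lambda>v. \<Sum>i\<in>UNIV. v $ i * (f x *s cgrad (W, \<phi>) g x + g x *s cgrad (W, \<phi>) f x) $ i)"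
    by (simp add: fun_eq_iff sum_distrib_left sum_distrib_right sum.distrib[symmetric] algebra_simps)
  ultimately show "((\<lambda>z. f (inv_into W \<phi> z) * g (inv_into W \<phi> z)) has_derivative
      (\<lambda>v. \<Sum>i\<in>UNIV. v $ i * (f x *s cgrad (W, \<phi>) g x + g x *s cgrad (W, \<phi>) f x) $ i)) (at (\<phi> x))"
    by simp
qed

lemma cgrad_add:
  assumes "holo_at A f x" "holo_at A g x" "(W, \<phi>) \<in> A" "x \<in> W"
  shows "cgrad (W, \<phi>) (\<lambda>y. f y + g y) x = cgrad (W, \<phi>) f x + cgrad (W, \<phi>) g x"
proof (rule cgrad_eqI)
  from has_derivative_add[OF holo_at_has_derivative[OF assms(1,3,4)] holo_at_has_derivative[OF assms(2,3,4)]]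
  show "((\<lambda>z. f (inv_into W \<phi> z) + g (inv_into W \<phi> z)) has_derivative
      (\<lambda>v. \<Sum>i\<in>UNIV. v $ i * (cgrad (W, \<phi>) f x + cgrad (W, \<phi>) g x) $ i)) (at (\<phi> x))"
    by (simp add: sum.distrib[symmetric] algebra_simps)
qed

text \<open>The chain rule for a change of charts. It is the transformation rule in
  \<open>cotangent\<close>, so the differential of a holomorphic function is a covector.\<close>

lemma cgrad_chain:
  assumes f: "holo_at A f x" and c: "(W, \<phi>) \<in> A" "x \<in> W" and d: "(V, \<psi>) \<in> A" "x \<in> V"
  shows "cgrad (V, \<psi>) f x = (\<Sum>i\<in>UNIV. (cgrad (W, \<phi>) f x $ i) *s cgrad (V, \<psi>) (\<lambda>y. \<phi> y $ i) x)"
proof (rule cgrad_eqI)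
  have op: "open (\<psi> ` (W \<inter> V))" and x: "\<psi> x \<in> \<psi> ` (W \<inter> V)"
    using chart_nbhd[OF d chartD(1)[OF c(1)] c(2)] by auto
  have inv: "inv_into V \<psi> (\<psi> x) = x" using chart_inverse d by blast
  have "((\<lambda>z. \<phi> (inv_into V \<psi> z)) has_derivative
      (\<lambda>v. \<chi> i. \<Sum>k\<in>UNIV. v $ k * cgrad (V, \<psi>) (\<lambda>y. \<phi> y $ i) x $ k)) (at (\<psi> x))"
    by (intro has_derivative_vec_complex holo_at_has_derivative holo_at_coordinate[OF c] d)
  moreover have "((\<lambda>z. f (inv_into W \<phi> z)) has_derivative
      (\<lambda>v. \<Sum>i\<in>UNIV. v $ i * cgrad (W, \<phi>) f x $ i)) (at (\<phi> (inv_into V \<psi> (\<psi> x))))"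
    using holo_at_has_derivative[OF f c] inv by simp
  ultimately have "((\<lambda>z. f (inv_into W \<phi> (\<phi> (inv_into V \<psi> z)))) has_derivative
      (\<lambda>v. \<Sum>i\<in>UNIV. (\<chi> i. \<Sum>k\<in>UNIV. v $ k * cgrad (V, \<psi>) (\<lambda>y. \<phi> y $ i) x $ k) $ i * cgrad (W, \<phi>) f x $ i)) (at (\<psi> x))"
    by (rule has_derivative_compose)
  then have "((\<lambda>z. f (inv_into W \<phi> (\<phi> (inv_into V \<psi> z)))) has_derivative
      (\<lambda>v. \<Sum>i\<in>UNIV. (\<Sum>k\<in>UNIV. v $ k * cgrad (V, \<psi>) (\<lambda>y. \<phi> y $ i) x $ k) * cgrad (W, \<phi>) f x $ i)) (at (\<psi> x))"
    by simp
  moreover have "(\<Sum>i\<in>UNIV. (\<Sum>k\<in>UNIV. v $ k * cgrad (V, \<psi>) (\<lambda>y. \<phi> y $ i) x $ k) * cgrad (W, \<phi>) f x $ i) =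
      (\<Sum>k\<in>UNIV. v $ k * (\<Sum>i\<in>UNIV. (cgrad (W, \<phi>) f x $ i) *s cgrad (V, \<psi>) (\<lambda>y. \<phi> y $ i) x) $ k)" for v :: "complex^'n"
  proof -
    have "(\<Sum>i\<in>UNIV. (\<Sum>k\<in>UNIV. v $ k * cgrad (V, \<psi>) (\<lambda>y. \<phi> y $ i) x $ k) * cgrad (W, \<phi>) f x $ i) =
      (\<Sum>i\<in>UNIV. \<Sum>k\<in>UNIV. v $ k * (cgrad (W, \<phi>) f x $ i * cgrad (V, \<psi>) (\<lambda>y. \<phi> y $ i) x $ k))"
      by (simp add: sum_distrib_right sum_distrib_left mult_ac)
    also have "\<dots> = (\<Sum>k\<in>UNIV. \<Sum>i\<in>UNIV. v $ k * (cgrad (W, \<phi>) f x $ i * cgrad (V, \<psi>) (\<lambda>y. \<phi> y $ i) x $ k))"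
      by (rule sum.swap)
    finally show ?thesis by (simp add: sum_distrib_left)
  qed
  ultimately have "((\<lambda>z. f (inv_into W \<phi> (\<phi> (inv_into V \<psi> z)))) has_derivative
      (\<lambda>v. \<Sum>k\<in>UNIV. v $ k * (\<Sum>i\<in>UNIV. (cgrad (W, \<phi>) f x $ i) *s cgrad (V, \<psi>) (\<lambda>y. \<phi> y $ i) x) $ k)) (at (\<psi> x))"
    by (simp only:)
  then show "((\<lambda>z. f (inv_into V \<psi> z)) has_derivative
      (\<lambda>v. \<Sum>k\<in>UNIV. v $ k * (\<Sum>i\<in>UNIV. (cgrad (W, \<phi>) f x $ i) *s cgrad (V, \<psi>) (\<lambda>y. \<phi> y $ i) x) $ k)) (at (\<psi> x))"
    by (rule has_derivative_transform_within_open[OF _ op x]) (rule chart_change[OF c(1) d(1), symmetric])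
qed

text \<open>Partial derivatives of holomorphic functions are holomorphic in each chart; this is what
  makes differentials sections of \<open>Omega1 X A\<close>.\<close>

lemma holo_at_cgrad:
  assumes "openin X U" "\<And>y. y \<in> U \<Longrightarrow> holo_at A f y" "(W, \<phi>) \<in> A" "x \<in> U" "x \<in> W"
  shows "holo_at A (\<lambda>y. cgrad (W, \<phi>) f y $ i) x"
proof (rule holo_at_chart[OF assms(3,5)])
  note n = chart_nbhd[OF assms(3,5,1,4)]
  have "cholo_on (\<phi> ` (U \<inter> W)) (\<lambda>z. f (inv_into W \<phi> z))"
    using assms(2,3) by (auto simp: cholo_on_iff intro!: holo_atD)
  then have "cholo_on (\<phi> ` (U \<inter> W)) (cpartial i (\<lambda>z. f (inv_into W \<phi> z)))"
    by (rule cholo_on_cpartial[OF n(1)])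
  then have "cdiff_at (cpartial i (\<lambda>z. f (inv_into W \<phi> z))) (\<phi> x)"
    using n(2) unfolding cholo_on_iff by (rule bspec)
  then show "cdiff_at (\<lambda>z. cgrad (W, \<phi>) f (inv_into W \<phi> z) $ i) (\<phi> x)"
    by (rule cdiff_at_cong[OF _ n(1,2)]) (simp add: cgrad_nth n(4) del: image_Int)
qed

lemma ext_d_chart: "(W, \<phi>) \<in> A \<Longrightarrow> x \<in> W \<Longrightarrow> ext_d A f x (W, \<phi>) = cgrad (W, \<phi>) f x"
  by (simp add: ext_d_def)

lemma ext_d_cotangent:
  assumes "holo_at A f x"
  shows "ext_d A f x \<in> cotangent A x"
  unfolding cotangent_def mem_Collect_eq
proof (intro conjI allI ballI impI)
  fix c d assume "c \<in> A" "d \<in> A" "x \<in> fst c \<and> x \<in> fst d"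
  moreover obtain W \<phi> V \<psi> where "c = (W, \<phi>)" "d = (V, \<psi>)" by force
  ultimately show "ext_d A f x d = (\<Sum>i\<in>UNIV. (ext_d A f x c $ i) *s cgrad d (\<lambda>p. snd c p $ i) x)"
    using cgrad_chain[OF assms, of W \<phi> V \<psi>] by (simp add: ext_d_def)
qed (auto simp: ext_d_def)

lemma ext_d_cong:
  assumes "openin X N" "x \<in> N" "\<And>y. y \<in> N \<Longrightarrow> f y = g y"
  shows "ext_d A f x = ext_d A g x"
  unfolding ext_d_def using cgrad_cong[OF _ _ assms] by fastforce

lemma ext_d_add:
  "holo_at A f x \<Longrightarrow> holo_at A g x \<Longrightarrow> ext_d A (\<lambda>y. f y + g y) x = (\<lambda>c. ext_d A f x c + ext_d A g x c)"
  unfolding ext_d_def using cgrad_add by (fastforce simp: fun_eq_iff)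

lemma ext_d_minus:
  assumes "holo_at A f x"
  shows "ext_d A (\<lambda>y. - f y) x = (\<lambda>c. - ext_d A f x c)"
  unfolding ext_d_def using cgrad_compose_field[OF assms, of _ _ uminus "-1"]
  by (fastforce simp: fun_eq_iff vec_eq_iff intro!: derivative_eq_intros)

lemma ext_d_compose_field:
  assumes "holo_at A f x" "(g has_field_derivative g') (at (f x))"
  shows "ext_d A (\<lambda>y. g (f y)) x = (\<lambda>c. g' *s ext_d A f x c)"
  unfolding ext_d_def using cgrad_compose_field[OF assms(1) _ _ assms(2)]
  by (fastforce simp: fun_eq_iff)

lemma dlog_mult:
  assumes "holo_at A f x" "holo_at A g x" "f x \<noteq> 0" "g x \<noteq> 0"
  shows "dlog A (\<lambda>y. f y * g y) x = (\<lambda>c. dlog A f x c + dlog A g x c)"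
proof
  fix c
  show "dlog A (\<lambda>y. f y * g y) x c = dlog A f x c + dlog A g x c"
  proof (cases "c \<in> A \<and> x \<in> fst c")
    case True
    obtain W \<phi> where c: "c = (W, \<phi>)" by force
    show ?thesis
      using True cgrad_mult[OF assms(1,2), of W \<phi>] assms(3,4)
      by (simp add: dlog_def ext_d_def c vec_eq_iff field_simps)
  next
    case False
    then have "ext_d A h x c = 0" for h by (auto simp: ext_d_def)
    then show ?thesis by (simp add: dlog_def vec_eq_iff)
  qed
qed

text \<open>Holomorphy refers to charts only; continuity is obtained in a chart, and the resulting
  open set is pulled back to \<open>X\<close>.\<close>

lemma openin_holo_preimage:
  assumes f: "openin X U" "\<And>y. y \<in> U \<Longrightarrow> holo_at A f y" and S: "open S"
  shows "openin X {y \<in> U. f y \<in> S}"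
proof (subst openin_subopen, intro ballI)
  fix x assume "x \<in> {y \<in> U. f y \<in> S}"
  then have x: "x \<in> U" "f x \<in> S" by auto
  obtain W \<phi> where c: "(W, \<phi>) \<in> A" "x \<in> W"
    using chart_exists f(1) x openin_subset by (metis in_mono)
  define g where "g = (\<lambda>z. f (inv_into W \<phi> z))"
  note n = chart_nbhd[OF c f(1) x(1)]
  have "continuous_on (\<phi> ` (U \<inter> W)) g"
    unfolding g_def using f(2) c(1)
    by (intro continuous_at_imp_continuous_on ballI cdiff_at_continuous) (auto intro: holo_atD)
  then have op: "open (\<phi> ` (U \<inter> W) \<inter> g -` S)"
    by (intro continuous_open_preimage n(1) S)
  define N where "N = {y \<in> W. \<phi> y \<in> \<phi> ` (U \<inter> W) \<inter> g -` S}"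
  have "y \<in> {y \<in> U. f y \<in> S}" if y: "y \<in> N" for y
  proof -
    have W: "y \<in> W" using y by (simp add: N_def)
    obtain y' where y': "y' \<in> U \<inter> W" "\<phi> y = \<phi> y'" using y unfolding N_def by blast
    then have "y = y'" using chartD(3)[OF c(1)] W by (auto dest: inj_onD)
    then show ?thesis using y y' chart_inverse[OF c(1) W] by (simp add: N_def g_def)
  qed
  moreover have "openin X N" unfolding N_def by (rule openin_chart_preimage[OF c(1) op])
  moreover have "x \<in> N" using c x chart_inverse[OF c] by (auto simp: N_def g_def)
  ultimately show "\<exists>N. openin X N \<and> x \<in> N \<and> N \<subseteq> {y \<in> U. f y \<in> S}" by blast
qed

text \<open>As long as \<open>f y / f x\<close> stays in the right half plane its principal
  logarithm is holomorphic, and it is a primitive of the logarithmic derivative of \<open>f\<close>.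
  Hence \<open>dlog\<close> takes values in the exact forms.\<close>

lemma dlog_local_log:
  assumes f: "openin X U" "\<And>y. y \<in> U \<Longrightarrow> holo_at A f y" and x: "x \<in> U" and nz: "f x \<noteq> 0"
  obtains N where "openin X N" "x \<in> N" "N \<subseteq> U"
    "\<And>y. y \<in> N \<Longrightarrow> holo_at A (\<lambda>y. Ln (f y / f x)) y"
    "\<And>y. y \<in> N \<Longrightarrow> dlog A f y = ext_d A (\<lambda>y. Ln (f y / f x)) y"
proof -
  define N where "N = {y \<in> U. f y \<in> {w. Re (w / f x) > 0}}"
  have "open {w. Re (w / f x) > 0}"
    using nz by (intro open_Collect_less continuous_intros) auto
  then have "openin X N" unfolding N_def by (intro openin_holo_preimage f)
  have NU: "y \<in> U" "Re (f y / f x) > 0" if "y \<in> N" for y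
    using that by (auto simp: N_def)
  have der: "((\<lambda>w. Ln (w / f x)) has_field_derivative 1 / f y) (at (f y))" if "y \<in> N" for y
  proof -
    have "f y / f x \<notin> \<real>\<^sub>\<le>\<^sub>0" "f y \<noteq> 0"
      using NU(2)[OF that] by (auto simp: complex_nonpos_Reals_iff)
    then show ?thesis using nz by (auto intro!: derivative_eq_intros simp: field_simps)
  qed
  show thesis
  proof
    show "openin X N" by fact
    show "x \<in> N" using x nz by (simp add: N_def)
    show "N \<subseteq> U" using NU by blast
    show "holo_at A (\<lambda>y. Ln (f y / f x)) y" if "y \<in> N" for y
      by (rule holo_at_compose_field[OF f(2)[OF NU(1)[OF that]] der[OF that]])
    show "dlog A f y = ext_d A (\<lambda>y. Ln (f y / f x)) y" if "y \<in> N" for y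
      unfolding ext_d_compose_field[OF f(2)[OF NU(1)[OF that]] der[OF that]]
      by (simp add: dlog_def)
  qed
qed

section \<open>The sheaves of functions, units, 1-forms and exact forms\<close>

lemma O_section_iff: "f \<in> sections (O_sheaf X A) U \<longleftrightarrow> openin X U \<and> (\<forall>x\<in>U. holo_at A f x)"
  by (simp add: O_sheaf_def holo_fun_iff_at)

lemma units_section_iff:
  "f \<in> sections (units_sheaf (O_sheaf X A)) U \<longleftrightarrow> openin X U \<and> (\<forall>x\<in>U. holo_at A f x \<and> f x \<noteq> 0)"
  by (auto simp: units_sheaf_def O_section_iff)

lemma Omega1_section_iff:
  "\<omega> \<in> sections (Omega1 X A) U \<longleftrightarrow> openin X U \<and> (\<forall>x\<in>U. \<omega> x \<in> cotangent A x) \<and>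
     (\<forall>W \<phi> i x. (W, \<phi>) \<in> A \<longrightarrow> x \<in> U \<longrightarrow> x \<in> W \<longrightarrow> holo_at A (\<lambda>y. \<omega> y (W, \<phi>) $ i) x)"
  by (auto simp: Omega1_def holo_fun_iff_at)

lemma dO_section_iff:
  "\<omega> \<in> sections (dO_sheaf X A) U \<longleftrightarrow> openin X U \<and>
     (\<forall>x\<in>U. \<exists>N f. openin X N \<and> x \<in> N \<and> N \<subseteq> U \<and> (\<forall>y\<in>N. holo_at A f y) \<and> (\<forall>y\<in>N. \<omega> y = ext_d A f y))"
  by (simp only: dO_sheaf_def sheaf.simps mem_Collect_eq O_section_iff conj_ac)

lemma cotangent_transform:
  "\<omega> \<in> cotangent A x \<Longrightarrow> c \<in> A \<Longrightarrow> d \<in> A \<Longrightarrow> x \<in> fst c \<and> x \<in> fst d \<Longrightarrow>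
    \<omega> d = (\<Sum>i\<in>UNIV. (\<omega> c $ i) *s cgrad d (\<lambda>p. snd c p $ i) x)"
  unfolding cotangent_def by blast

lemma cotangent_outside: "\<omega> \<in> cotangent A x \<Longrightarrow> \<not> (c \<in> A \<and> x \<in> fst c) \<Longrightarrow> \<omega> c = 0"
  unfolding cotangent_def by blast

text \<open>The expansion of a covector in the differentials of the coordinates of one chart. By the
  transformation rule it holds for the components in all charts at once.\<close>

lemma cotangentD:
  assumes "\<omega> \<in> cotangent A x" "(W, \<phi>) \<in> A" "x \<in> W"
  shows "\<omega> = (\<lambda>d. \<Sum>i\<in>UNIV. (\<omega> (W, \<phi>) $ i) *s ext_d A (\<lambda>y. \<phi> y $ i) x d)"
proof
  fix d
  show "\<omega> d = (\<Sum>i\<in>UNIV. (\<omega> (W, \<phi>) $ i) *s ext_d A (\<lambda>y. \<phi> y $ i) x d)"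
  proof (cases "d \<in> A \<and> x \<in> fst d")
    case True
    with assms have "\<omega> d = (\<Sum>i\<in>UNIV. (\<omega> (W, \<phi>) $ i) *s cgrad d (\<lambda>p. snd (W, \<phi>) p $ i) x)"
      using cotangent_transform[OF assms(1,2), of d] by simp
    then show ?thesis using True by (simp add: ext_d_def)
  next
    case False
    then have "ext_d A h x d = 0" for h by (auto simp: ext_d_def)
    then show ?thesis using cotangent_outside[OF assms(1) False] by (simp add: vec_eq_iff)
  qed
qed

lemma cotangent_zero: "(\<lambda>c. 0) \<in> cotangent A x"
  by (simp add: cotangent_def vec_eq_iff)

lemma cotangent_add:
  assumes "\<omega> \<in> cotangent A x" "\<eta> \<in> cotangent A x"
  shows "(\<lambda>c. \<omega> c + \<eta> c) \<in> cotangent A x"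
  unfolding cotangent_def mem_Collect_eq
proof (intro conjI allI ballI impI)
  fix c d assume cd: "c \<in> A" "d \<in> A" "x \<in> fst c \<and> x \<in> fst d"
  show "\<omega> d + \<eta> d = (\<Sum>i\<in>UNIV. ((\<omega> c + \<eta> c) $ i) *s cgrad d (\<lambda>p. snd c p $ i) x)"
    unfolding cotangent_transform[OF assms(1) cd] cotangent_transform[OF assms(2) cd]
    by (simp add: vec_eq_iff sum.distrib distrib_right)
qed (use assms in \<open>simp add: cotangent_outside\<close>)

lemma cotangent_scale:
  assumes "\<omega> \<in> cotangent A x"
  shows "(\<lambda>c. a *s \<omega> c) \<in> cotangent A x"
  unfolding cotangent_def mem_Collect_eq
proof (intro conjI allI ballI impI)
  fix c d assume cd: "c \<in> A" "d \<in> A" "x \<in> fst c \<and> x \<in> fst d"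
  show "a *s \<omega> d = (\<Sum>i\<in>UNIV. ((a *s \<omega> c) $ i) *s cgrad d (\<lambda>p. snd c p $ i) x)"
    unfolding cotangent_transform[OF assms(1) cd]
    by (simp add: vec_eq_iff sum_distrib_left mult.assoc)
qed (use assms in \<open>simp add: cotangent_outside vec_eq_iff\<close>)

lemma cotangent_minus: "\<omega> \<in> cotangent A x \<Longrightarrow> (\<lambda>c. - \<omega> c) \<in> cotangent A x"
  using cotangent_scale[of \<omega> x "-1"] by (simp add: vec_eq_iff fun_eq_iff)

lemma comm_group_cotangent: "comm_group (cotangent_group A x)"
proof (rule comm_groupI)
  fix \<omega> assume "\<omega> \<in> carrier (cotangent_group A x)"
  then show "\<exists>\<eta>\<in>carrier (cotangent_group A x). \<eta> \<otimes>\<^bsub>cotangent_group A x\<^esub> \<omega> = \<one>\<^bsub>cotangent_group A x\<^esub>"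
    using cotangent_minus[of \<omega> x]
    by (intro bexI[of _ "\<lambda>c. - \<omega> c"]) (auto simp: cotangent_group_def)
qed (auto simp: cotangent_group_def cotangent_zero cotangent_add add_ac)

lemma cotangent_inv:
  assumes "\<omega> \<in> cotangent A x"
  shows "inv\<^bsub>cotangent_group A x\<^esub> \<omega> = (\<lambda>c. - \<omega> c)"
proof -
  interpret comm_group "cotangent_group A x" by (rule comm_group_cotangent)
  show ?thesis
    using assms cotangent_minus[OF assms]
    by (intro inv_equality) (auto simp: cotangent_group_def)
qed

lemma vals_sheaves [simp]:
  "vals (Omega1 X A) = cotangent_group A" "vals (dO_sheaf X A) = cotangent_group A"
  "vals (O_sheaf X A) = (\<lambda>x. add_complex)" "vals (units_sheaf F) = (\<lambda>x. mult_complex)"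
  "vals (O_sub X A Y) = (\<lambda>x. add_complex)"
  by (simp_all add: Omega1_def dO_sheaf_def O_sheaf_def units_sheaf_def O_sub_def)

lemma comm_group_mult_complex: "comm_group mult_complex"
  by (rule comm_groupI) (auto simp: mult_complex_def intro!: bexI[of _ "inverse _"])

lemma inv_mult_complex: "a \<noteq> 0 \<Longrightarrow> inv\<^bsub>mult_complex\<^esub> a = inverse a"
  using comm_group_mult_complex
  by (intro group.inv_equality) (auto simp: mult_complex_def comm_group_def)

lemma comm_group_add_complex: "comm_group add_complex"
  by (rule comm_groupI) (auto simp: add_complex_def intro!: exI[of _ "- _"])

lemma inv_add_complex: "inv\<^bsub>add_complex\<^esub> a = - a"
  using comm_group_add_complex
  by (intro group.inv_equality) (auto simp: add_complex_def comm_group_def)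

lemma ab_sheaf_units: "ab_sheaf X (units_sheaf (O_sheaf X A))"
proof (rule ab_sheaf.intro, unfold units_section_iff vals_sheaves)
  show "comm_group mult_complex" by (rule comm_group_mult_complex)
  fix f U assume f: "openin X U \<and> (\<forall>x\<in>U. holo_at A f x \<and> f x \<noteq> 0)"
  have "holo_at A (\<lambda>p. inv\<^bsub>mult_complex\<^esub> (f p)) x" if "x \<in> U" for x
    by (rule holo_at_cong[OF holo_at_inverse[of f x], of U]) (use f that in \<open>auto simp: inv_mult_complex\<close>)
  then show "openin X U \<and> (\<forall>x\<in>U. holo_at A (\<lambda>p. inv\<^bsub>mult_complex\<^esub> (f p)) x \<and> inv\<^bsub>mult_complex\<^esub> (f x) \<noteq> 0)"
    using f by (auto simp: inv_mult_complex)
qed (auto simp: mult_complex_def intro!: holo_at_mult holo_at_const)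

lemma ab_sheaf_O: "ab_sheaf X (O_sheaf X A)"
proof (rule ab_sheaf.intro, unfold O_section_iff vals_sheaves)
  show "comm_group add_complex" by (rule comm_group_add_complex)
qed (auto simp: inv_add_complex intro!: holo_at_minus, auto simp: add_complex_def intro!: holo_at_add holo_at_const)

lemma ab_sheaf_Omega1: "ab_sheaf X (Omega1 X A)"
proof (rule ab_sheaf.intro, unfold vals_sheaves)
  show "comm_group (cotangent_group A p)" for p by (rule comm_group_cotangent)
  show "openin X U \<Longrightarrow> (\<lambda>p. \<one>\<^bsub>cotangent_group A p\<^esub>) \<in> sections (Omega1 X A) U" for U
    by (auto simp: Omega1_section_iff cotangent_group_def cotangent_zero holo_at_const)
  fix \<omega> U assume \<omega>: "\<omega> \<in> sections (Omega1 X A) U"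
  then show "openin X U" "\<And>p. p \<in> U \<Longrightarrow> \<omega> p \<in> carrier (cotangent_group A p)"
    "\<And>V. openin X V \<Longrightarrow> V \<subseteq> U \<Longrightarrow> \<omega> \<in> sections (Omega1 X A) V"
    by (auto simp: Omega1_section_iff cotangent_group_def)
  have "holo_at A (\<lambda>p. (inv\<^bsub>cotangent_group A p\<^esub> (\<omega> p)) (W, \<phi>) $ i) x"
    if "(W, \<phi>) \<in> A" "x \<in> U" "x \<in> W" for W \<phi> i x
    by (rule holo_at_cong[OF holo_at_minus[of "\<lambda>p. \<omega> p (W, \<phi>) $ i" x], of U])
      (use \<omega> that in \<open>auto simp: Omega1_section_iff cotangent_inv\<close>)
  then show "(\<lambda>p. inv\<^bsub>cotangent_group A p\<^esub> (\<omega> p)) \<in> sections (Omega1 X A) U"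
    using \<omega> by (auto simp: Omega1_section_iff cotangent_inv intro: cotangent_minus)
  fix \<eta> assume \<eta>: "\<eta> \<in> sections (Omega1 X A) U"
  show "(\<lambda>p. \<omega> p \<otimes>\<^bsub>cotangent_group A p\<^esub> \<eta> p) \<in> sections (Omega1 X A) U"
    using \<omega> \<eta> by (auto simp: Omega1_section_iff cotangent_group_def intro!: cotangent_add holo_at_add)
qed

lemma ab_sheaf_dO: "ab_sheaf X (dO_sheaf X A)"
proof (rule ab_sheaf.intro, unfold vals_sheaves)
  show "comm_group (cotangent_group A p)" for p by (rule comm_group_cotangent)
  have zero: "ext_d A (\<lambda>y. 0) p = (\<lambda>c. 0)" for p
    using ext_d_compose_field[OF holo_at_const[of 0 p], of "\<lambda>w. w * 0" 0]
    by (simp add: vec_eq_iff fun_eq_iff)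
  show "openin X U \<Longrightarrow> (\<lambda>p. \<one>\<^bsub>cotangent_group A p\<^esub>) \<in> sections (dO_sheaf X A) U" for U
    unfolding dO_section_iff
    by (intro conjI ballI exI[of _ U] exI[of _ "\<lambda>x. 0"]) (auto simp: cotangent_group_def holo_at_const zero)
  fix \<omega> U assume \<omega>: "\<omega> \<in> sections (dO_sheaf X A) U"
  then show op: "openin X U" by (simp add: dO_section_iff)
  have loc: "\<exists>N f. openin X N \<and> x \<in> N \<and> N \<subseteq> U \<and> (\<forall>y\<in>N. holo_at A f y) \<and> (\<forall>y\<in>N. \<omega> y = ext_d A f y)"
    if "x \<in> U" for x
    using \<omega> that unfolding dO_section_iff by (elim conjE) (erule (1) bspec)
  show "\<omega> p \<in> carrier (cotangent_group A p)" if "p \<in> U" for p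
    using loc[OF that] ext_d_cotangent by (auto simp: cotangent_group_def)
  show "\<omega> \<in> sections (dO_sheaf X A) V" if V: "openin X V" "V \<subseteq> U" for V
    unfolding dO_section_iff
  proof (intro conjI ballI V(1))
    fix x assume x: "x \<in> V"
    then obtain N f where "openin X N" "x \<in> N" "\<forall>y\<in>N. holo_at A f y" "\<forall>y\<in>N. \<omega> y = ext_d A f y"
      using loc[of x] V(2) by blast
    then show "\<exists>N f. openin X N \<and> x \<in> N \<and> N \<subseteq> V \<and> (\<forall>y\<in>N. holo_at A f y) \<and> (\<forall>y\<in>N. \<omega> y = ext_d A f y)"
      using V x by (intro exI[of _ "N \<inter> V"] exI[of _ f]) auto
  qed
  show "(\<lambda>p. inv\<^bsub>cotangent_group A p\<^esub> (\<omega> p)) \<in> sections (dO_sheaf X A) U"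
    unfolding dO_section_iff
  proof (intro conjI ballI op)
    fix x assume x: "x \<in> U"
    then obtain N f where f: "openin X N" "x \<in> N" "N \<subseteq> U" "\<forall>y\<in>N. holo_at A f y" "\<forall>y\<in>N. \<omega> y = ext_d A f y"
      using loc[of x] by blast
    then have "inv\<^bsub>cotangent_group A y\<^esub> (\<omega> y) = ext_d A (\<lambda>y. - f y) y" if "y \<in> N" for y
      using that by (simp add: ext_d_minus cotangent_inv[OF ext_d_cotangent])
    then show "\<exists>N f. openin X N \<and> x \<in> N \<and> N \<subseteq> U \<and> (\<forall>y\<in>N. holo_at A f y) \<and>
        (\<forall>y\<in>N. inv\<^bsub>cotangent_group A y\<^esub> (\<omega> y) = ext_d A f y)"
      using f by (intro exI[of _ N] exI[of _ "\<lambda>y. - f y"]) (auto intro: holo_at_minus)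
  qed
  fix \<eta> assume \<eta>: "\<eta> \<in> sections (dO_sheaf X A) U"
  have loc': "\<exists>N f. openin X N \<and> x \<in> N \<and> N \<subseteq> U \<and> (\<forall>y\<in>N. holo_at A f y) \<and> (\<forall>y\<in>N. \<eta> y = ext_d A f y)"
    if "x \<in> U" for x
    using \<eta> that unfolding dO_section_iff by (elim conjE) (erule (1) bspec)
  show "(\<lambda>p. \<omega> p \<otimes>\<^bsub>cotangent_group A p\<^esub> \<eta> p) \<in> sections (dO_sheaf X A) U"
    unfolding dO_section_iff
  proof (intro conjI ballI op)
    fix x assume x: "x \<in> U"
    obtain N f where f: "openin X N" "x \<in> N" "N \<subseteq> U" "\<forall>y\<in>N. holo_at A f y" "\<forall>y\<in>N. \<omega> y = ext_d A f y"
      using loc[OF x] by blast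
    obtain M g where g: "openin X M" "x \<in> M" "\<forall>y\<in>M. holo_at A g y" "\<forall>y\<in>M. \<eta> y = ext_d A g y"
      using loc'[OF x] by blast
    have "\<omega> y \<otimes>\<^bsub>cotangent_group A y\<^esub> \<eta> y = ext_d A (\<lambda>y. f y + g y) y" if "y \<in> N \<inter> M" for y
      using that f g by (simp add: ext_d_add cotangent_group_def)
    then show "\<exists>N f. openin X N \<and> x \<in> N \<and> N \<subseteq> U \<and> (\<forall>y\<in>N. holo_at A f y) \<and>
        (\<forall>y\<in>N. \<omega> y \<otimes>\<^bsub>cotangent_group A y\<^esub> \<eta> y = ext_d A f y)"
      using f g by (intro exI[of _ "N \<inter> M"] exI[of _ "\<lambda>y. f y + g y"]) (auto intro: holo_at_add)
  qed
qed

lemma ext_d_section: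
  assumes "openin X U" "\<And>y. y \<in> U \<Longrightarrow> holo_at A f y"
  shows "ext_d A f \<in> sections (Omega1 X A) U"
proof -
  have "holo_at A (\<lambda>y. ext_d A f y (W, \<phi>) $ i) x" if "(W, \<phi>) \<in> A" "x \<in> U" "x \<in> W" for W \<phi> i x
  proof (rule holo_at_cong[OF holo_at_cgrad[OF assms that]])
    show "openin X W" using that(1) by (rule chartD)
  qed (use that in \<open>auto simp: ext_d_chart\<close>)
  then show ?thesis
    using assms ext_d_cotangent by (auto simp: Omega1_section_iff)
qed

lemma dO_subset_Omega1: "sections (dO_sheaf X A) U \<subseteq> sections (Omega1 X A) U"
proof
  fix \<omega> assume \<omega>: "\<omega> \<in> sections (dO_sheaf X A) U"
  have loc: "\<exists>N f. openin X N \<and> x \<in> N \<and> N \<subseteq> U \<and> (\<forall>y\<in>N. holo_at A f y) \<and> (\<forall>y\<in>N. \<omega> y = ext_d A f y)"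
    if "x \<in> U" for x
    using \<omega> that unfolding dO_section_iff by (elim conjE) (erule (1) bspec)
  have 1: "\<omega> x \<in> cotangent A x" if "x \<in> U" for x
    using loc[OF that] ext_d_cotangent by auto
  have 2: "holo_at A (\<lambda>y. \<omega> y (W, \<phi>) $ i) x" if W: "(W, \<phi>) \<in> A" "x \<in> U" "x \<in> W" for W \<phi> i x
  proof -
    obtain N f where f: "openin X N" "x \<in> N" "\<forall>y\<in>N. holo_at A f y" "\<forall>y\<in>N. \<omega> y = ext_d A f y"
      using loc[OF W(2)] by blast
    then have "ext_d A f \<in> sections (Omega1 X A) N" by (intro ext_d_section) auto
    then have "holo_at A (\<lambda>y. ext_d A f y (W, \<phi>) $ i) x"
      using W f(2) by (auto simp: Omega1_section_iff)
    then show ?thesis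
      by (rule holo_at_cong[OF _ f(1,2)]) (use f(4) in auto)
  qed
  show "\<omega> \<in> sections (Omega1 X A) U"
    using \<omega> 1 2 unfolding Omega1_section_iff dO_section_iff by auto
qed

lemma dlog_section:
  assumes "f \<in> sections (units_sheaf (O_sheaf X A)) U"
  shows "dlog A f \<in> sections (dO_sheaf X A) U"
  unfolding dO_section_iff
proof (intro conjI ballI)
  show op: "openin X U" using assms by (simp add: units_section_iff)
  fix x assume x: "x \<in> U"
  obtain N where "openin X N" "x \<in> N" "N \<subseteq> U"
    "\<And>y. y \<in> N \<Longrightarrow> holo_at A (\<lambda>y. Ln (f y / f x)) y"
    "\<And>y. y \<in> N \<Longrightarrow> dlog A f y = ext_d A (\<lambda>y. Ln (f y / f x)) y"
    using assms x unfolding units_section_iff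
    by (elim conjE) (rule dlog_local_log[OF op, of f x], auto)
  then show "\<exists>N g. openin X N \<and> x \<in> N \<and> N \<subseteq> U \<and> (\<forall>y\<in>N. holo_at A g y) \<and> (\<forall>y\<in>N. dlog A f y = ext_d A g y)"
    by (intro exI[of _ N] exI[of _ "\<lambda>y. Ln (f y / f x)"]) auto
qed

lemma dlog_sheaf_hom:
  assumes "Y \<subseteq> topspace X"
  shows "sheaf_hom (subtopology X Y) (inverse_image X Y (units_sheaf (O_sheaf X A)))
    (inverse_image X Y (dO_sheaf X A)) (\<lambda>p a. \<Union>f\<in>a. germ X p (dlog A f))"
proof (rule sheaf_hom_inverse_image[OF ab_sheaf_units assms])
  fix N and f f' :: "'a \<Rightarrow> complex" assume "openin X N" "\<forall>x\<in>N. f' x = f x"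
  then show "\<forall>x\<in>N. dlog A f' x = dlog A f x"
    using ext_d_cong[of N _ f' f] by (simp add: dlog_def)
next
  fix U s assume "s \<in> sections (units_sheaf (O_sheaf X A)) U"
  then show "dlog A s \<in> sections (dO_sheaf X A) U" by (rule dlog_section)
next
  fix U s s' x
  assume "s \<in> sections (units_sheaf (O_sheaf X A)) U" "s' \<in> sections (units_sheaf (O_sheaf X A)) U" "x \<in> U"
  then show "dlog A (\<lambda>p. s p \<otimes>\<^bsub>vals (units_sheaf (O_sheaf X A)) p\<^esub> s' p) x =
      dlog A s x \<otimes>\<^bsub>vals (dO_sheaf X A) x\<^esub> dlog A s' x"
    using dlog_mult[of s x s'] by (simp add: units_section_iff mult_complex_def cotangent_group_def)
qed

lemma dO_Omega1_sheaf_hom: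
  "sheaf_hom (subtopology X Y) (inverse_image X Y (dO_sheaf X A)) (inverse_image X Y (Omega1 X A)) (\<lambda>p m. m)"
  by (rule sheaf_hom_inverse_image_id[OF ab_sheaf_dO _ dO_subset_Omega1]) simp

end

section \<open>Tensor products and the pullback of a module\<close>

text \<open>Closure under the operations puts the tensor relations into the free abelian group on
  pairs; bilinearity of the tensors then comes from the relations themselves.\<close>

locale tensor_data =
  fixes R :: "'r ring" and M :: "('r, 'm) module" and N :: "('r, 'k) module"
  assumes add_M: "m \<in> carrier M \<Longrightarrow> m' \<in> carrier M \<Longrightarrow> m \<oplus>\<^bsub>M\<^esub> m' \<in> carrier M"
    and add_N: "n \<in> carrier N \<Longrightarrow> n' \<in> carrier N \<Longrightarrow> n \<oplus>\<^bsub>N\<^esub> n' \<in> carrier N"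
    and smult_M: "a \<in> carrier R \<Longrightarrow> m \<in> carrier M \<Longrightarrow> a \<odot>\<^bsub>M\<^esub> m \<in> carrier M"
    and smult_N: "a \<in> carrier R \<Longrightarrow> n \<in> carrier N \<Longrightarrow> a \<odot>\<^bsub>N\<^esub> n \<in> carrier N"
begin

abbreviation "G \<equiv> free_Abelian_group (carrier M \<times> carrier N)"
abbreviation "K \<equiv> tensor_kernel R M N"

lemma relations_subset: "tensor_relations R M N \<subseteq> carrier G"
proof -
  interpret G: comm_group G by (rule abelian_free_Abelian_group)
  have diff: "x - y \<in> carrier G" if "x \<in> carrier G" "y \<in> carrier G" for x y
    using that keys_diff[of x y] by auto
  have frag: "frag_of (m, n) \<in> carrier G" if "m \<in> carrier M" "n \<in> carrier N" for m n
    using that by (simp only: frag_of_in_free_Abelian_group mem_Times_iff fst_conv snd_conv)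
  show ?thesis
    unfolding tensor_relations_def
    by (intro Un_least subsetI)
      (elim CollectE exE conjE, simp only:, intro diff frag add_M add_N smult_M smult_N, assumption+)+
qed

lemma subgroup_kernel: "subgroup K G"
  unfolding tensor_kernel_def
  by (rule group.generate_is_subgroup[OF group_free_Abelian_group relations_subset])

lemma comm_group_tensor: "comm_group (tensor_group R M N)"
  unfolding tensor_group_def
  by (rule comm_group.abelian_FactGroup[OF abelian_free_Abelian_group subgroup_kernel])

lemma relation_in_kernel: "x \<in> tensor_relations R M N \<Longrightarrow> x \<in> K"
  unfolding tensor_kernel_def by (rule generate.incl)

lemma coset_eq:
  assumes "x - y \<in> K"
  shows "K #>\<^bsub>G\<^esub> x = K #>\<^bsub>G\<^esub> y"
proof -
  have add: "a + b \<in> K" if "a \<in> K" "b \<in> K" for a b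
    using subgroup.m_closed[OF subgroup_kernel that] by simp
  have minus: "- a \<in> K" if "a \<in> K" for a
    using subgroup.m_inv_closed[OF subgroup_kernel that] subgroup.mem_carrier[OF subgroup_kernel that]
    by simp
  have "K #>\<^bsub>G\<^esub> x \<subseteq> K #>\<^bsub>G\<^esub> y" if "x - y \<in> K" for x y
  proof
    fix w assume "w \<in> K #>\<^bsub>G\<^esub> x"
    then obtain a where a: "a \<in> K" "w = a + x" by (auto simp: r_coset_def)
    then show "w \<in> K #>\<^bsub>G\<^esub> y"
      using add[OF a(1) that] by (auto simp: r_coset_def intro!: bexI[of _ "a + (x - y)"])
  qed
  from this[OF assms] this[of y x] minus[OF assms] show ?thesis by auto
qed

lemma tensor_elem_closed:
  "m \<in> carrier M \<Longrightarrow> n \<in> carrier N \<Longrightarrow> tensor_elem R M N m n \<in> carrier (tensor_group R M N)"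
  unfolding tensor_group_def tensor_elem_def FactGroup_def RCOSETS_def by auto

lemma tensor_mult:
  assumes "x \<in> carrier G" "y \<in> carrier G"
  shows "(K #>\<^bsub>G\<^esub> x) \<otimes>\<^bsub>tensor_group R M N\<^esub> (K #>\<^bsub>G\<^esub> y) = K #>\<^bsub>G\<^esub> (x + y)"
proof -
  have "K \<lhd> G"
    by (rule comm_group.subgroup_imp_normal[OF abelian_free_Abelian_group subgroup_kernel])
  from normal.rcos_sum[OF this assms] show ?thesis
    by (simp add: tensor_group_def FactGroup_def)
qed

lemma frag_of_closed: "m \<in> carrier M \<Longrightarrow> n \<in> carrier N \<Longrightarrow> frag_of (m, n) \<in> carrier G"
  by (simp only: frag_of_in_free_Abelian_group mem_Times_iff fst_conv snd_conv)

lemma tensor_add_left: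
  assumes "m \<in> carrier M" "m' \<in> carrier M" "n \<in> carrier N"
  shows "tensor_elem R M N (m \<oplus>\<^bsub>M\<^esub> m') n = tensor_elem R M N m n \<otimes>\<^bsub>tensor_group R M N\<^esub> tensor_elem R M N m' n"
  unfolding tensor_elem_def tensor_mult[OF frag_of_closed[OF assms(1,3)] frag_of_closed[OF assms(2,3)]]
proof (rule coset_eq)
  have "frag_of (m \<oplus>\<^bsub>M\<^esub> m', n) - frag_of (m, n) - frag_of (m', n) \<in> K"
    by (rule relation_in_kernel) (unfold tensor_relations_def, use assms in blast)
  then show "frag_of (m \<oplus>\<^bsub>M\<^esub> m', n) - (frag_of (m, n) + frag_of (m', n)) \<in> K"
    by (simp add: diff_diff_eq)
qed

lemma tensor_add_right:
  assumes "m \<in> carrier M" "n \<in> carrier N" "n' \<in> carrier N"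
  shows "tensor_elem R M N m (n \<oplus>\<^bsub>N\<^esub> n') = tensor_elem R M N m n \<otimes>\<^bsub>tensor_group R M N\<^esub> tensor_elem R M N m n'"
  unfolding tensor_elem_def tensor_mult[OF frag_of_closed[OF assms(1,2)] frag_of_closed[OF assms(1,3)]]
proof (rule coset_eq)
  have "frag_of (m, n \<oplus>\<^bsub>N\<^esub> n') - frag_of (m, n) - frag_of (m, n') \<in> K"
    by (rule relation_in_kernel) (unfold tensor_relations_def, use assms in blast)
  then show "frag_of (m, n \<oplus>\<^bsub>N\<^esub> n') - (frag_of (m, n) + frag_of (m, n')) \<in> K"
    by (simp add: diff_diff_eq)
qed

lemma tensor_smult:
  assumes "a \<in> carrier R" "m \<in> carrier M" "n \<in> carrier N"
  shows "tensor_elem R M N (a \<odot>\<^bsub>M\<^esub> m) n = tensor_elem R M N m (a \<odot>\<^bsub>N\<^esub> n)"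
  unfolding tensor_elem_def
proof (rule coset_eq)
  show "frag_of (a \<odot>\<^bsub>M\<^esub> m, n) - frag_of (m, a \<odot>\<^bsub>N\<^esub> n) \<in> K"
    by (rule relation_in_kernel) (unfold tensor_relations_def, use assms in blast)
qed

end

text \<open>Sections of the pullback are locally sums of \<open>k\<close> tensors, indexed by an
  initial segment of the naturals; concatenating two such families represents the sum of two
  sections.\<close>

lemma (in comm_monoid) finprod_lessThan_append:
  fixes k l :: nat
  assumes "\<And>j. j < k \<Longrightarrow> f j \<in> carrier G" "\<And>j. j < l \<Longrightarrow> g j \<in> carrier G"
  shows "finprod G (\<lambda>j. if j < k then f j else g (j - k)) {..<k + l} = finprod G f {..<k} \<otimes> finprod G g {..<l}"
  using assms(2)
proof (induction l)
  case 0
  have "finprod G (\<lambda>j. if j < k then f j else g (j - k)) {..<k} = finprod G f {..<k}"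
    by (rule finprod_cong) (use assms in \<open>auto simp: simp_implies_def\<close>)
  then show ?case using assms(1) by (simp add: Pi_def)
next
  case (Suc l)
  let ?h = "\<lambda>j. if j < k then f j else g (j - k)"
  have h: "?h j \<in> carrier G" if "j < k + Suc l" for j
    using that assms(1) Suc.prems by auto
  have "finprod G ?h {..<k + Suc l} = ?h (k + l) \<otimes> finprod G ?h {..<k + l}"
  proof -
    have "{..<k + Suc l} = insert (k + l) {..<k + l}" by auto
    then show ?thesis
      by (simp only:) (rule finprod_insert, use h[of "k + l"] h in \<open>auto simp del: if_split\<close>)
  qed
  also have "\<dots> = g l \<otimes> (finprod G f {..<k} \<otimes> finprod G g {..<l})"
    using Suc by simp
  also have "\<dots> = finprod G f {..<k} \<otimes> (g l \<otimes> finprod G g {..<l})"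
    using assms(1) Suc.prems by (intro m_lcomm) (auto intro!: finprod_closed)
  also have "\<dots> = finprod G f {..<k} \<otimes> finprod G g {..<Suc l}"
    using Suc.prems by (simp add: lessThan_Suc Pi_def)
  finally show ?case .
qed

lemma (in comm_group) finprod_inv:
  assumes "finite I" "\<And>i. i \<in> I \<Longrightarrow> f i \<in> carrier G"
  shows "finprod G (\<lambda>i. inv (f i)) I = inv (finprod G f I)"
  using assms
proof (induction I rule: finite_induct)
  case (insert i I)
  then show ?case by (simp add: Pi_def inv_mult)
qed simp

section \<open>Elementary tensors in the stalks of the pulled-back cotangent sheaf\<close>

locale csub = cmanifold X A for X :: "'a topology" and A :: "('a, 'n::finite) chart set" +
  fixes Y :: "'a set"
  assumes Y_subset: "Y \<subseteq> topspace X"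
begin

abbreviation "T \<equiv> subtopology X Y"
abbreviation "\<Omega> \<equiv> Omega1 X A"

lemma topspace_Int_Y [simp]: "topspace X \<inter> Y = Y"
  using Y_subset by auto

lemma topspace_T: "topspace T = Y"
  by simp

lemma openin_T_Int: "openin X U \<Longrightarrow> openin T (U \<inter> Y)"
  by (auto simp: openin_subtopology)

lemma O_sub_section_iff:
  "f \<in> sections (O_sub X A Y) V \<longleftrightarrow> openin T V \<and>
     (\<forall>y\<in>V. \<exists>U g. openin X U \<and> y \<in> U \<and> (\<forall>x\<in>U. holo_at A g x) \<and> (\<forall>x\<in>U \<inter> V. f x = g x))"
  by (simp only: O_sub_def sheaf.simps mem_Collect_eq O_section_iff conj_ac)

lemma O_sub_sectionE:
  assumes "f \<in> sections (O_sub X A Y) V" "y \<in> V"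
  obtains U g where "openin X U" "y \<in> U" "\<forall>x\<in>U. holo_at A g x" "\<forall>x\<in>U \<inter> V. f x = g x"
proof -
  have "\<exists>U g. openin X U \<and> y \<in> U \<and> (\<forall>x\<in>U. holo_at A g x) \<and> (\<forall>x\<in>U \<inter> V. f x = g x)"
    using assms unfolding O_sub_section_iff by (elim conjE) (erule (1) bspec)
  then show thesis using that by blast
qed

lemma O_sub_sectionI:
  assumes "openin T V"
    and "\<And>y. y \<in> V \<Longrightarrow> \<exists>U g. openin X U \<and> y \<in> U \<and> (\<forall>x\<in>U. holo_at A g x) \<and> (\<forall>x\<in>U \<inter> V. f x = g x)"
  shows "f \<in> sections (O_sub X A Y) V"
  unfolding O_sub_section_iff by (intro conjI ballI assms)

lemma O_sub_const: "openin T V \<Longrightarrow> (\<lambda>x. c) \<in> sections (O_sub X A Y) V"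
  using openin_subset[of T V] Y_subset
  by (intro O_sub_sectionI) (auto intro!: exI[of _ "topspace X"] exI[of _ "\<lambda>x. c"] holo_at_const)

lemma O_sub_add:
  assumes "f \<in> sections (O_sub X A Y) V" "g \<in> sections (O_sub X A Y) V"
  shows "(\<lambda>x. f x + g x) \<in> sections (O_sub X A Y) V"
proof (rule O_sub_sectionI)
  show "openin T V" using assms by (simp add: O_sub_section_iff)
  fix y assume y: "y \<in> V"
  obtain U f' where f: "openin X U" "y \<in> U" "\<forall>x\<in>U. holo_at A f' x" "\<forall>x\<in>U \<inter> V. f x = f' x"
    using assms(1) y by (rule O_sub_sectionE)
  obtain U' g' where g: "openin X U'" "y \<in> U'" "\<forall>x\<in>U'. holo_at A g' x" "\<forall>x\<in>U' \<inter> V. g x = g' x"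
    using assms(2) y by (rule O_sub_sectionE)
  show "\<exists>U h. openin X U \<and> y \<in> U \<and> (\<forall>x\<in>U. holo_at A h x) \<and> (\<forall>x\<in>U \<inter> V. f x + g x = h x)"
    using f g by (intro exI[of _ "U \<inter> U'"] exI[of _ "\<lambda>x. f' x + g' x"]) (auto intro: holo_at_add)
qed

lemma O_sub_mult_holo:
  assumes "g \<in> sections (O_sub X A Y) V" "openin X U" "\<forall>x\<in>U. holo_at A f x" "V \<subseteq> U"
  shows "(\<lambda>x. f x * g x) \<in> sections (O_sub X A Y) V"
proof (rule O_sub_sectionI)
  show "openin T V" using assms by (simp add: O_sub_section_iff)
  fix y assume y: "y \<in> V"
  obtain U' g' where g: "openin X U'" "y \<in> U'" "\<forall>x\<in>U'. holo_at A g' x" "\<forall>x\<in>U' \<inter> V. g x = g' x"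
    using assms(1) y by (rule O_sub_sectionE)
  show "\<exists>U h. openin X U \<and> y \<in> U \<and> (\<forall>x\<in>U. holo_at A h x) \<and> (\<forall>x\<in>U \<inter> V. f x * g x = h x)"
    using g assms y by (intro exI[of _ "U \<inter> U'"] exI[of _ "\<lambda>x. f x * g' x"]) (auto intro: holo_at_mult)
qed

lemma O_sub_minus:
  assumes "f \<in> sections (O_sub X A Y) V"
  shows "(\<lambda>x. - f x) \<in> sections (O_sub X A Y) V"
proof -
  have "V \<subseteq> topspace X"
    using assms openin_subset[of T V] Y_subset by (auto simp: O_sub_section_iff)
  from O_sub_mult_holo[OF assms openin_topspace _ this, of "\<lambda>x. -1"] show ?thesis
    by (simp add: holo_at_const)
qed

lemma O_sub_restrict:
  assumes "f \<in> sections (O_sub X A Y) V" "openin T W" "W \<subseteq> V"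
  shows "f \<in> sections (O_sub X A Y) W"
proof (rule O_sub_sectionI[OF assms(2)])
  fix y assume "y \<in> W"
  then have "y \<in> V" using assms(3) by blast
  with assms(1) obtain U g where "openin X U" "y \<in> U" "\<forall>x\<in>U. holo_at A g x" "\<forall>x\<in>U \<inter> V. f x = g x"
    by (rule O_sub_sectionE)
  then show "\<exists>U g. openin X U \<and> y \<in> U \<and> (\<forall>x\<in>U. holo_at A g x) \<and> (\<forall>x\<in>U \<inter> W. f x = g x)"
    using assms(3) by (intro exI[of _ U] exI[of _ g]) auto
qed

lemma ab_sheaf_O_sub: "ab_sheaf T (O_sub X A Y)"
proof (rule ab_sheaf.intro, unfold vals_sheaves inv_add_complex)
  show "comm_group add_complex" by (rule comm_group_add_complex)
  fix f V assume f: "f \<in> sections (O_sub X A Y) V"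
  show "openin T V" using f by (simp add: O_sub_section_iff)
  show "f p \<in> carrier add_complex" for p by (simp add: add_complex_def)
  show "f \<in> sections (O_sub X A Y) W" if "openin T W" "W \<subseteq> V" for W
    using O_sub_restrict[OF f that] .
  show "(\<lambda>p. - f p) \<in> sections (O_sub X A Y) V" by (rule O_sub_minus[OF f])
  fix g assume g: "g \<in> sections (O_sub X A Y) V"
  show "(\<lambda>p. f p \<otimes>\<^bsub>add_complex\<^esub> g p) \<in> sections (O_sub X A Y) V"
    using O_sub_add[OF f g] by (simp add: add_complex_def)
next
  fix U assume "openin T U"
  then show "(\<lambda>p. \<one>\<^bsub>add_complex\<^esub>) \<in> sections (O_sub X A Y) U"
    using O_sub_const[of U 0] by (simp add: add_complex_def)
qed

lemma Omega1_scale: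
  assumes "\<omega> \<in> sections \<Omega> U" "\<And>x. x \<in> U \<Longrightarrow> holo_at A f x"
  shows "(\<lambda>x c. f x *s \<omega> x c) \<in> sections \<Omega> U"
  using assms by (auto simp: Omega1_section_iff intro: cotangent_scale holo_at_mult)

abbreviation "stalk_Omega z \<equiv> stalk_module X \<Omega> z"
abbreviation "stalk_OY z \<equiv> O_sub_stalk_module X A Y z"
abbreviation "pe \<equiv> pullback_elem X A Y \<Omega>"
abbreviation "P \<equiv> pullback_stalk X A Y \<Omega>"

lemma stalk_Omega_simps [simp]: "carrier (stalk_Omega z) = carrier (stalk X \<Omega> z)" "add (stalk_Omega z) = mult (stalk X \<Omega> z)"
  by (simp_all add: stalk_module_def)

lemma stalk_OY_simps [simp]: "carrier (stalk_OY z) = carrier (stalk T (O_sub X A Y) z)"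
    "add (stalk_OY z) = mult (stalk T (O_sub X A Y) z)"
  by (simp_all add: O_sub_stalk_module_def)

lemma carrier_O_stalk [simp]: "carrier (O_stalk X A z) = carrier (stalk X (O_sheaf X A) z)"
  by (simp add: O_stalk_def)

lemma smult_M_germ:
  assumes "z \<in> Y"
  shows "germ X z f \<odot>\<^bsub>stalk_Omega z\<^esub> germ X z \<omega> = germ X z (\<lambda>x c. f x *s \<omega> x c)"
proof -
  have "z \<in> topspace X" using assms Y_subset by blast
  from UN_germ2_same[OF this, where m = "\<lambda>x a w c. a *s w c"] show ?thesis
    by (simp add: stalk_module_def Omega1_def)
qed

lemma smult_N_germ:
  assumes "z \<in> Y"
  shows "germ X z f \<odot>\<^bsub>stalk_OY z\<^esub> germ T z g = germ T z (\<lambda>x. f x * g x)"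
proof -
  have "(\<Union>f'\<in>germ X z f. \<Union>g'\<in>germ T z g. germ T z (\<lambda>x. (\<lambda>_. (*)) x (f' x) (g' x))) =
      germ T z (\<lambda>x. (\<lambda>_. (*)) x (f x) (g x))"
  proof (rule UN_germ2)
    show "z \<in> topspace X" using assms Y_subset by blast
    show "z \<in> topspace T" using assms by simp
    show "\<exists>M. openin T M \<and> z \<in> M \<and> M \<subseteq> N" if "openin X N" "z \<in> N" for N
      using that assms openin_T_Int by (intro exI[of _ "N \<inter> Y"]) auto
  qed
  then show ?thesis by (simp add: O_sub_stalk_module_def)
qed

lemma germ_T_carrier:
  "g \<in> sections (O_sub X A Y) V \<Longrightarrow> z \<in> V \<Longrightarrow> germ T z g \<in> carrier (stalk T (O_sub X A Y) z)"
  by (rule stalk_carrierI) (auto simp: O_sub_section_iff)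

lemma germ_\<Omega>_carrier:
  "\<omega> \<in> sections \<Omega> U \<Longrightarrow> z \<in> U \<Longrightarrow> germ X z \<omega> \<in> carrier (stalk X \<Omega> z)"
  by (rule stalk_carrierI) (auto simp: Omega1_section_iff)

lemma tensor_data_stalk:
  assumes z: "z \<in> Y"
  shows "tensor_data (O_stalk X A z) (stalk_Omega z) (stalk_OY z)"
proof -
  have zX: "z \<in> topspace X" using z Y_subset by blast
  interpret S: comm_group "stalk X \<Omega> z"
    by (rule ab_sheaf.comm_group_stalk[OF ab_sheaf_Omega1 zX])
  interpret S': comm_group "stalk T (O_sub X A Y) z"
    by (rule ab_sheaf.comm_group_stalk[OF ab_sheaf_O_sub]) (use z in simp)
  show ?thesis
  proof (rule tensor_data.intro, unfold stalk_Omega_simps stalk_OY_simps carrier_O_stalk)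
    fix a assume "a \<in> carrier (stalk X (O_sheaf X A) z)"
    then obtain U f where f: "openin X U" "z \<in> U" "\<forall>x\<in>U. holo_at A f x" "a = germ X z f"
      using ab_sheaf.stalkE[OF ab_sheaf_O] unfolding O_section_iff by metis
    show "a \<odot>\<^bsub>stalk_Omega z\<^esub> m \<in> carrier (stalk X \<Omega> z)" if m: "m \<in> carrier (stalk X \<Omega> z)" for m
    proof -
      obtain V \<omega> where \<omega>: "openin X V" "z \<in> V" "\<omega> \<in> sections \<Omega> V" "m = germ X z \<omega>"
        using m by (rule ab_sheaf.stalkE[OF ab_sheaf_Omega1])
      have "\<omega> \<in> sections \<Omega> (U \<inter> V)"
        using \<omega> f by (intro ab_sheaf.sec_restrict[OF ab_sheaf_Omega1 \<omega>(3)]) auto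
      then have "(\<lambda>x c. f x *s \<omega> x c) \<in> sections \<Omega> (U \<inter> V)"
        using f(3) by (intro Omega1_scale) auto
      from germ_\<Omega>_carrier[OF this, of z] show ?thesis
        using f \<omega> by (simp add: smult_M_germ[OF z])
    qed
    show "a \<odot>\<^bsub>stalk_OY z\<^esub> n \<in> carrier (stalk T (O_sub X A Y) z)" if n: "n \<in> carrier (stalk T (O_sub X A Y) z)" for n
    proof -
      obtain V g where g: "openin T V" "z \<in> V" "g \<in> sections (O_sub X A Y) V" "n = germ T z g"
        using n by (rule ab_sheaf.stalkE[OF ab_sheaf_O_sub])
      have op: "openin T (V \<inter> (U \<inter> Y))"
        using g(1) openin_T_Int[OF f(1)] by (rule openin_Int)
      have "g \<in> sections (O_sub X A Y) (V \<inter> (U \<inter> Y))"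
        by (rule O_sub_restrict[OF g(3) op]) auto
      then have "(\<lambda>x. f x * g x) \<in> sections (O_sub X A Y) (V \<inter> (U \<inter> Y))"
        by (rule O_sub_mult_holo[OF _ f(1,3)]) auto
      from germ_T_carrier[OF this, of z] show ?thesis
        using f g z by (simp add: smult_N_germ[OF z])
    qed
  qed (rule S.m_closed S'.m_closed; assumption)+
qed

lemma comm_group_pullback: "z \<in> Y \<Longrightarrow> comm_group (P z)"
  unfolding pullback_stalk_def by (rule tensor_data.comm_group_tensor[OF tensor_data_stalk])

lemma pe_closed:
  "z \<in> Y \<Longrightarrow> m \<in> carrier (stalk X \<Omega> z) \<Longrightarrow> n \<in> carrier (stalk T (O_sub X A Y) z) \<Longrightarrow> pe z m n \<in> carrier (P z)"
  unfolding pullback_stalk_def pullback_elem_def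
  using tensor_data.tensor_elem_closed[OF tensor_data_stalk] by simp

lemma pe_mult_left:
  "z \<in> Y \<Longrightarrow> m \<in> carrier (stalk X \<Omega> z) \<Longrightarrow> m' \<in> carrier (stalk X \<Omega> z) \<Longrightarrow> n \<in> carrier (stalk T (O_sub X A Y) z) \<Longrightarrow>
    pe z (m \<otimes>\<^bsub>stalk X \<Omega> z\<^esub> m') n = pe z m n \<otimes>\<^bsub>P z\<^esub> pe z m' n"
  unfolding pullback_stalk_def pullback_elem_def
  using tensor_data.tensor_add_left[OF tensor_data_stalk, of z m m' n] by simp

lemma pe_mult_right:
  "z \<in> Y \<Longrightarrow> m \<in> carrier (stalk X \<Omega> z) \<Longrightarrow> n \<in> carrier (stalk T (O_sub X A Y) z) \<Longrightarrow> n' \<in> carrier (stalk T (O_sub X A Y) z) \<Longrightarrow>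
    pe z m (n \<otimes>\<^bsub>stalk T (O_sub X A Y) z\<^esub> n') = pe z m n \<otimes>\<^bsub>P z\<^esub> pe z m n'"
  unfolding pullback_stalk_def pullback_elem_def
  using tensor_data.tensor_add_right[OF tensor_data_stalk, of z m n n'] by simp

lemma pe_add_left:
  assumes "z \<in> Y" "z \<in> U" "\<omega> \<in> sections \<Omega> U" "\<eta> \<in> sections \<Omega> U" "n \<in> carrier (stalk T (O_sub X A Y) z)"
  shows "pe z (germ X z (\<lambda>x c. \<omega> x c + \<eta> x c)) n = pe z (germ X z \<omega>) n \<otimes>\<^bsub>P z\<^esub> pe z (germ X z \<eta>) n"
proof -
  have "germ X z (\<lambda>x c. \<omega> x c + \<eta> x c) = germ X z \<omega> \<otimes>\<^bsub>stalk X \<Omega> z\<^esub> germ X z \<eta>"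
    using assms Y_subset by (subst stalk_mult) (auto simp: cotangent_group_def)
  then show ?thesis
    using pe_mult_left[OF assms(1) germ_\<Omega>_carrier[OF assms(3,2)] germ_\<Omega>_carrier[OF assms(4,2)] assms(5)] by simp
qed

lemma pe_add_right:
  assumes "z \<in> Y" "z \<in> V" "f \<in> sections (O_sub X A Y) V" "g \<in> sections (O_sub X A Y) V" "m \<in> carrier (stalk X \<Omega> z)"
  shows "pe z m (germ T z (\<lambda>x. f x + g x)) = pe z m (germ T z f) \<otimes>\<^bsub>P z\<^esub> pe z m (germ T z g)"
proof -
  have "germ T z (\<lambda>x. f x + g x) = germ T z f \<otimes>\<^bsub>stalk T (O_sub X A Y) z\<^esub> germ T z g"
    using assms by (subst stalk_mult) (auto simp: add_complex_def)
  then show ?thesis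
    using pe_mult_right[OF assms(1,5) germ_T_carrier[OF assms(3,2)] germ_T_carrier[OF assms(4,2)]] by simp
qed

lemma pe_scale:
  assumes z: "z \<in> Y" "z \<in> U" and \<omega>: "\<omega> \<in> sections \<Omega> U" and f: "\<And>x. x \<in> U \<Longrightarrow> holo_at A f x"
    and g: "g \<in> sections (O_sub X A Y) V" "z \<in> V"
  shows "pe z (germ X z (\<lambda>x c. f x *s \<omega> x c)) (germ T z g) = pe z (germ X z \<omega>) (germ T z (\<lambda>x. f x * g x))"
proof -
  have "openin X U" using \<omega> by (simp add: Omega1_section_iff)
  then have "germ X z f \<in> carrier (stalk X (O_sheaf X A) z)"
    using z f by (intro stalk_carrierI[of f _ U]) (auto simp: O_section_iff)
  then show ?thesis
    using tensor_data.tensor_smult[OF tensor_data_stalk[OF z(1)], of "germ X z f" "germ X z \<omega>" "germ T z g"]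
      germ_\<Omega>_carrier[OF \<omega> z(2)] germ_T_carrier[OF g]
    by (simp add: pullback_elem_def smult_M_germ[OF z(1)] smult_N_germ[OF z(1)])
qed

text \<open>From \<open>0 = 0 + 0\<close> this tensor is equal to its own square, hence to the unit
  of the group.\<close>

lemma pe_zero_left:
  assumes z: "z \<in> Y" and n: "n \<in> carrier (stalk T (O_sub X A Y) z)"
  shows "pe z (germ X z (\<lambda>x c. 0)) n = \<one>\<^bsub>P z\<^esub>"
proof -
  interpret P: comm_group "P z" by (rule comm_group_pullback[OF z])
  have sec: "(\<lambda>x c. 0) \<in> sections \<Omega> (topspace X)"
    by (auto simp: Omega1_section_iff cotangent_zero holo_at_const)
  have zX: "z \<in> topspace X" using z Y_subset by blast
  have c: "pe z (germ X z (\<lambda>x c. 0)) n \<in> carrier (P z)"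
    by (rule pe_closed[OF z germ_\<Omega>_carrier[OF sec zX] n])
  have "pe z (germ X z (\<lambda>x c. 0)) n = pe z (germ X z (\<lambda>x c. 0)) n \<otimes>\<^bsub>P z\<^esub> pe z (germ X z (\<lambda>x c. 0)) n"
    using pe_add_left[OF z zX sec sec n] by simp
  then show ?thesis using c P.l_cancel_one' by metis
qed

lemma pe_zero_right:
  assumes z: "z \<in> Y" and m: "m \<in> carrier (stalk X \<Omega> z)"
  shows "pe z m (germ T z (\<lambda>x. 0)) = \<one>\<^bsub>P z\<^esub>"
proof -
  interpret P: comm_group "P z" by (rule comm_group_pullback[OF z])
  have sec: "(\<lambda>x. 0) \<in> sections (O_sub X A Y) Y"
    by (rule O_sub_const) (use openin_topspace[of T] in simp)
  have c: "pe z m (germ T z (\<lambda>x. 0)) \<in> carrier (P z)"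
    by (rule pe_closed[OF z m germ_T_carrier[OF sec z]])
  have "pe z m (germ T z (\<lambda>x. 0)) = pe z m (germ T z (\<lambda>x. 0)) \<otimes>\<^bsub>P z\<^esub> pe z m (germ T z (\<lambda>x. 0))"
    using pe_add_right[OF z z sec sec m] by simp
  then show ?thesis using c P.l_cancel_one' by metis
qed

lemma pe_minus_right:
  assumes z: "z \<in> Y" "z \<in> V" and g: "g \<in> sections (O_sub X A Y) V" and m: "m \<in> carrier (stalk X \<Omega> z)"
  shows "pe z m (germ T z (\<lambda>x. - g x)) = inv\<^bsub>P z\<^esub> (pe z m (germ T z g))"
proof -
  interpret P: comm_group "P z" by (rule comm_group_pullback[OF z(1)])
  have "pe z m (germ T z (\<lambda>x. - g x)) \<otimes>\<^bsub>P z\<^esub> pe z m (germ T z g) = \<one>\<^bsub>P z\<^esub>"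
    using pe_add_right[OF z O_sub_minus[OF g] g m] pe_zero_right[OF z(1) m] by simp
  then show ?thesis
    using pe_closed[OF z(1) m germ_T_carrier[OF g z(2)]]
      pe_closed[OF z(1) m germ_T_carrier[OF O_sub_minus[OF g] z(2)]] P.inv_equality by metis
qed

lemma Omega1_sum:
  assumes "openin X U" "\<And>j. j \<in> J \<Longrightarrow> \<eta> j \<in> sections \<Omega> U"
  shows "(\<lambda>x c. \<Sum>j\<in>J. \<eta> j x c) \<in> sections \<Omega> U"
  using assms(2)
proof (induction J rule: infinite_finite_induct)
  case (insert j J)
  then have "(\<lambda>x c. \<Sum>j\<in>J. \<eta> j x c) \<in> sections \<Omega> U" "\<eta> j \<in> sections \<Omega> U" by auto
  from ab_sheaf.sec_mult[OF ab_sheaf_Omega1 this(2,1)] insert.hyps show ?case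
    by (simp add: cotangent_group_def)
qed (use assms(1) in \<open>auto simp: Omega1_section_iff cotangent_zero holo_at_const\<close>)

lemma pe_sum_left:
  assumes z: "z \<in> Y" "z \<in> U" and J: "finite J" and \<eta>: "\<And>j. j \<in> J \<Longrightarrow> \<eta> j \<in> sections \<Omega> U"
    and U: "openin X U" and n: "n \<in> carrier (stalk T (O_sub X A Y) z)"
  shows "pe z (germ X z (\<lambda>x c. \<Sum>j\<in>J. \<eta> j x c)) n = finprod (P z) (\<lambda>j. pe z (germ X z (\<eta> j)) n) J"
  using J \<eta>
proof (induction J rule: finite_induct)
  case empty
  interpret P: comm_group "P z" by (rule comm_group_pullback[OF z(1)])
  show ?case using pe_zero_left[OF z(1) n] by simp
next
  case (insert j J)
  interpret P: comm_group "P z" by (rule comm_group_pullback[OF z(1)])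
  have cl: "pe z (germ X z (\<eta> i)) n \<in> carrier (P z)" if "i \<in> insert j J" for i
    by (rule pe_closed[OF z(1) germ_\<Omega>_carrier[OF insert.prems[OF that] z(2)] n])
  have "pe z (germ X z (\<lambda>x c. \<eta> j x c + (\<Sum>j\<in>J. \<eta> j x c))) n =
      pe z (germ X z (\<eta> j)) n \<otimes>\<^bsub>P z\<^esub> pe z (germ X z (\<lambda>x c. \<Sum>j\<in>J. \<eta> j x c)) n"
    using insert.prems by (intro pe_add_left[OF z _ _ n] Omega1_sum U) auto
  then show ?case
    using insert cl by (simp add: Pi_def)
qed

text \<open>A form is expanded in the differentials of the coordinates, and its holomorphic
  coefficients are moved across the tensor sign to the function on \<open>Y\<close>. In this normal
  form equality of tensors follows from equality of coefficient functions along
  \<open>Y\<close>.\<close>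

lemma pe_expand:
  assumes z: "z \<in> Y" "z \<in> U" "z \<in> W" and c: "(W, \<phi>) \<in> A" and \<omega>: "\<omega> \<in> sections \<Omega> U"
    and g: "g \<in> sections (O_sub X A Y) V" "z \<in> V"
  shows "pe z (germ X z \<omega>) (germ T z g) =
    finprod (P z) (\<lambda>j. pe z (germ X z (ext_d A (\<lambda>x. \<phi> x $ j))) (germ T z (\<lambda>x. \<omega> x (W, \<phi>) $ j * g x))) UNIV"
proof -
  interpret P: comm_group "P z" by (rule comm_group_pullback[OF z(1)])
  have U: "openin X U" using \<omega> by (simp add: Omega1_section_iff)
  have UW: "openin X (U \<inter> W)" using U chartD(1)[OF c] by blast
  have dz: "ext_d A (\<lambda>x. \<phi> x $ j) \<in> sections \<Omega> (U \<inter> W)" for j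
    by (rule ext_d_section[OF UW]) (use holo_at_coordinate[OF c] in auto)
  have coef: "holo_at A (\<lambda>x. \<omega> x (W, \<phi>) $ j) x" if "x \<in> U \<inter> W" for j x
    using \<omega> c that by (auto simp: Omega1_section_iff)
  define \<eta> where "\<eta> = (\<lambda>j x d. (\<omega> x (W, \<phi>) $ j) *s ext_d A (\<lambda>x. \<phi> x $ j) x d)"
  have \<eta>: "\<eta> j \<in> sections \<Omega> (U \<inter> W)" for j
    unfolding \<eta>_def by (rule Omega1_scale[OF dz coef])
  have "germ X z \<omega> = germ X z (\<lambda>x d. \<Sum>j\<in>UNIV. \<eta> j x d)"
  proof (rule germ_cong[OF UW])
    fix x assume "x \<in> U \<inter> W"
    then show "\<omega> x = (\<lambda>d. \<Sum>j\<in>UNIV. \<eta> j x d)"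
      unfolding \<eta>_def using \<omega> c by (intro cotangentD) (auto simp: Omega1_section_iff)
  qed (use z in auto)
  then have "pe z (germ X z \<omega>) (germ T z g) = finprod (P z) (\<lambda>j. pe z (germ X z (\<eta> j)) (germ T z g)) UNIV"
    using z pe_sum_left[OF z(1), of "U \<inter> W" UNIV \<eta> "germ T z g"] \<eta> UW germ_T_carrier[OF g] by simp
  moreover have "pe z (germ X z (\<eta> j)) (germ T z g) =
      pe z (germ X z (ext_d A (\<lambda>x. \<phi> x $ j))) (germ T z (\<lambda>x. \<omega> x (W, \<phi>) $ j * g x))" for j
    unfolding \<eta>_def using z by (intro pe_scale[OF z(1) _ dz coef g]) auto
  ultimately show ?thesis by simp
qed

section \<open>The sheaf of sections of the pullback\<close>

lemma pullback_section_iff: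
  "s \<in> sections (module_pullback X A Y \<Omega>) V \<longleftrightarrow> openin T V \<and>
     (\<forall>y\<in>V. \<exists>N (k::nat) m h. y \<in> N \<and> N \<subseteq> V \<and> openin T N \<and>
        (\<forall>j<k. m j \<in> sections (inverse_image X Y \<Omega>) N \<and> h j \<in> sections (O_sub X A Y) N) \<and>
        (\<forall>z\<in>N. s z = finprod (P z) (\<lambda>j. pe z (m j z) (germ T z (h j))) {..<k}))"
  by (simp add: module_pullback_def)

lemma vals_pullback [simp]: "vals (module_pullback X A Y \<Omega>) = P"
  by (simp add: module_pullback_def)

lemma pullback_sectionE:
  assumes "s \<in> sections (module_pullback X A Y \<Omega>) V" "y \<in> V"
  obtains N and k :: nat and m h where "y \<in> N" "N \<subseteq> V" "openin T N"
    "\<forall>j<k. m j \<in> sections (inverse_image X Y \<Omega>) N"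
    "\<forall>j<k. h j \<in> sections (O_sub X A Y) N"
    "\<forall>z\<in>N. s z = finprod (P z) (\<lambda>j. pe z (m j z) (germ T z (h j))) {..<k}"
proof -
  have "\<exists>N (k::nat) m h. y \<in> N \<and> N \<subseteq> V \<and> openin T N \<and>
        (\<forall>j<k. m j \<in> sections (inverse_image X Y \<Omega>) N \<and> h j \<in> sections (O_sub X A Y) N) \<and>
        (\<forall>z\<in>N. s z = finprod (P z) (\<lambda>j. pe z (m j z) (germ T z (h j))) {..<k})"
    using assms unfolding pullback_section_iff by (elim conjE) (erule (1) bspec)
  then obtain N m h and k :: nat where *: "y \<in> N \<and> N \<subseteq> V \<and> openin T N \<and>
        (\<forall>j<k. m j \<in> sections (inverse_image X Y \<Omega>) N \<and> h j \<in> sections (O_sub X A Y) N) \<and>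
        (\<forall>z\<in>N. s z = finprod (P z) (\<lambda>j. pe z (m j z) (germ T z (h j))) {..<k})"
    by (elim exE)
  show thesis by (rule that[of N k m h]) (use * in auto)
qed

lemma pullback_sectionI:
  assumes "openin T V"
    and "\<And>y. y \<in> V \<Longrightarrow> \<exists>N (k::nat) m h. y \<in> N \<and> N \<subseteq> V \<and> openin T N \<and>
        (\<forall>j<k. m j \<in> sections (inverse_image X Y \<Omega>) N \<and> h j \<in> sections (O_sub X A Y) N) \<and>
        (\<forall>z\<in>N. s z = finprod (P z) (\<lambda>j. pe z (m j z) (germ T z (h j))) {..<k})"
  shows "s \<in> sections (module_pullback X A Y \<Omega>) V"
  unfolding pullback_section_iff by (intro conjI ballI assms)

lemma inverse_image_\<Omega>: "ab_sheaf T (inverse_image X Y \<Omega>)"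
  by (rule ab_sheaf.ab_sheaf_inverse_image[OF ab_sheaf_Omega1 Y_subset])

lemma pe_sections_closed:
  assumes "m \<in> sections (inverse_image X Y \<Omega>) V" "h \<in> sections (O_sub X A Y) V" "z \<in> V"
  shows "pe z (m z) (germ T z h) \<in> carrier (P z)" "z \<in> Y"
proof -
  show "z \<in> Y"
    using ab_sheaf.in_topspace[OF inverse_image_\<Omega> assms(1,3)] by simp
  then show "pe z (m z) (germ T z h) \<in> carrier (P z)"
    using ab_sheaf.sec_closed[OF inverse_image_\<Omega> assms(1,3)] germ_T_carrier[OF assms(2,3)]
    by (intro pe_closed) auto
qed

lemma ab_sheaf_pullback: "ab_sheaf T (module_pullback X A Y \<Omega>)"
proof (rule ab_sheaf.intro, unfold vals_pullback)
  show "comm_group (P p)" if "p \<in> topspace T" for p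
    using that comm_group_pullback by simp
  show "(\<lambda>p. \<one>\<^bsub>P p\<^esub>) \<in> sections (module_pullback X A Y \<Omega>) U" if U: "openin T U" for U
  proof (rule pullback_sectionI[OF U])
    \<comment> \<open>The unit section is the empty sum of tensors. With \<open>k = 0\<close>
      nothing is asked of the two families, so \<open>undefined\<close> serves for both.\<close>
    fix y assume y: "y \<in> U"
    have "\<one>\<^bsub>P z\<^esub> = finprod (P z) (\<lambda>j. pe z ((undefined :: nat \<Rightarrow> 'a \<Rightarrow> _) j z) (germ T z (undefined j))) {..<0}"
      if "z \<in> U" for z
    proof -
      have "z \<in> Y" using that U openin_subset[of T U] by auto
      then interpret comm_group "P z" by (rule comm_group_pullback)
      show ?thesis by simp
    qed
    with y U show "\<exists>N (k::nat) m h. y \<in> N \<and> N \<subseteq> U \<and> openin T N \<and>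
        (\<forall>j<k. m j \<in> sections (inverse_image X Y \<Omega>) N \<and> h j \<in> sections (O_sub X A Y) N) \<and>
        (\<forall>z\<in>N. \<one>\<^bsub>P z\<^esub> = finprod (P z) (\<lambda>j. pe z (m j z) (germ T z (h j))) {..<k})"
      by (intro exI[of _ U] exI[of _ 0] exI[of _ undefined]) auto
  qed
  fix s V assume s: "s \<in> sections (module_pullback X A Y \<Omega>) V"
  show op: "openin T V" using s by (simp add: pullback_section_iff)
  show "s p \<in> carrier (P p)" if p: "p \<in> V" for p
  proof -
    obtain N and k :: nat and m h where *: "p \<in> N" "N \<subseteq> V" "openin T N"
      "\<forall>j<k. m j \<in> sections (inverse_image X Y \<Omega>) N"
      "\<forall>j<k. h j \<in> sections (O_sub X A Y) N"
      "\<forall>z\<in>N. s z = finprod (P z) (\<lambda>j. pe z (m j z) (germ T z (h j))) {..<k}"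
      using s p by (rule pullback_sectionE)
    have "p \<in> Y" using *(1,3) openin_subset[of T N] by auto
    then interpret comm_group "P p" by (rule comm_group_pullback)
    show ?thesis
      unfolding *(6)[rule_format, OF *(1)] using pe_sections_closed(1)[OF *(4)[rule_format] *(5)[rule_format] *(1)] by (intro finprod_closed) auto
  qed
  show "s \<in> sections (module_pullback X A Y \<Omega>) W" if W: "openin T W" "W \<subseteq> V" for W
  proof (rule pullback_sectionI[OF W(1)])
    fix y assume y: "y \<in> W"
    then have "y \<in> V" using W(2) by blast
    with s obtain N and k :: nat and m h where *: "y \<in> N" "N \<subseteq> V" "openin T N"
      "\<forall>j<k. m j \<in> sections (inverse_image X Y \<Omega>) N"
      "\<forall>j<k. h j \<in> sections (O_sub X A Y) N"
      "\<forall>z\<in>N. s z = finprod (P z) (\<lambda>j. pe z (m j z) (germ T z (h j))) {..<k}"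
      by (rule pullback_sectionE)
    have NW: "openin T (N \<inter> W)" using *(3) W(1) by blast
    then have "m j \<in> sections (inverse_image X Y \<Omega>) (N \<inter> W)" "h j \<in> sections (O_sub X A Y) (N \<inter> W)"
      if "j < k" for j
      using ab_sheaf.sec_restrict[OF inverse_image_\<Omega> *(4)[rule_format, OF that] NW] O_sub_restrict[OF *(5)[rule_format, OF that] NW]
      by auto
    then show "\<exists>N (k::nat) m h. y \<in> N \<and> N \<subseteq> W \<and> openin T N \<and>
        (\<forall>j<k. m j \<in> sections (inverse_image X Y \<Omega>) N \<and> h j \<in> sections (O_sub X A Y) N) \<and>
        (\<forall>z\<in>N. s z = finprod (P z) (\<lambda>j. pe z (m j z) (germ T z (h j))) {..<k})"
      using * y NW by (intro exI[of _ "N \<inter> W"] exI[of _ k] exI[of _ m] exI[of _ h]) auto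
  qed
  show "(\<lambda>p. inv\<^bsub>P p\<^esub> (s p)) \<in> sections (module_pullback X A Y \<Omega>) V"
  proof (rule pullback_sectionI[OF op])
    \<comment> \<open>A sum of tensors is inverted by negating the function factor in each of
      them.\<close>
    fix y assume y: "y \<in> V"
    with s obtain N and k :: nat and m h where *: "y \<in> N" "N \<subseteq> V" "openin T N"
      "\<forall>j<k. m j \<in> sections (inverse_image X Y \<Omega>) N"
      "\<forall>j<k. h j \<in> sections (O_sub X A Y) N"
      "\<forall>z\<in>N. s z = finprod (P z) (\<lambda>j. pe z (m j z) (germ T z (h j))) {..<k}"
      by (rule pullback_sectionE)
    have "inv\<^bsub>P z\<^esub> (s z) = finprod (P z) (\<lambda>j. pe z (m j z) (germ T z (\<lambda>x. - h j x))) {..<k}" if z: "z \<in> N" for z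
    proof -
      have zY: "z \<in> Y" using z *(3) openin_subset[of T N] by auto
      then interpret comm_group "P z" by (rule comm_group_pullback)
      have cl: "pe z (m j z) (germ T z (h j)) \<in> carrier (P z)" if "j < k" for j
        by (rule pe_sections_closed(1)[OF *(4)[rule_format, OF that] *(5)[rule_format, OF that] z])
      have eq: "pe z (m j z) (germ T z (\<lambda>x. - h j x)) = inv\<^bsub>P z\<^esub> (pe z (m j z) (germ T z (h j)))" if "j < k" for j
        using ab_sheaf.sec_closed[OF inverse_image_\<Omega> *(4)[rule_format, OF that] z]
        by (intro pe_minus_right[OF zY z *(5)[rule_format, OF that]]) simp
      have "inv\<^bsub>P z\<^esub> (s z) = finprod (P z) (\<lambda>j. inv\<^bsub>P z\<^esub> (pe z (m j z) (germ T z (h j)))) {..<k}"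
        unfolding *(6)[rule_format, OF z] using cl by (intro finprod_inv[symmetric]) auto
      also have "\<dots> = finprod (P z) (\<lambda>j. pe z (m j z) (germ T z (\<lambda>x. - h j x))) {..<k}"
        by (rule finprod_cong) (use cl eq in \<open>auto simp: simp_implies_def\<close>)
      finally show ?thesis .
    qed
    then show "\<exists>N (k::nat) m h. y \<in> N \<and> N \<subseteq> V \<and> openin T N \<and>
        (\<forall>j<k. m j \<in> sections (inverse_image X Y \<Omega>) N \<and> h j \<in> sections (O_sub X A Y) N) \<and>
        (\<forall>z\<in>N. inv\<^bsub>P z\<^esub> (s z) = finprod (P z) (\<lambda>j. pe z (m j z) (germ T z (h j))) {..<k})"
      using * O_sub_minus by (intro exI[of _ N] exI[of _ k] exI[of _ m] exI[of _ "\<lambda>j x. - h j x"]) auto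
  qed
  fix s' assume s': "s' \<in> sections (module_pullback X A Y \<Omega>) V"
  show "(\<lambda>p. s p \<otimes>\<^bsub>P p\<^esub> s' p) \<in> sections (module_pullback X A Y \<Omega>) V"
  proof (rule pullback_sectionI[OF op])
    fix y assume y: "y \<in> V"
    with s obtain N and k :: nat and m h where *: "y \<in> N" "N \<subseteq> V" "openin T N"
      "\<forall>j<k. m j \<in> sections (inverse_image X Y \<Omega>) N"
      "\<forall>j<k. h j \<in> sections (O_sub X A Y) N"
      "\<forall>z\<in>N. s z = finprod (P z) (\<lambda>j. pe z (m j z) (germ T z (h j))) {..<k}"
      by (rule pullback_sectionE)
    from s' y obtain N' and k' :: nat and m' h' where **: "y \<in> N'" "N' \<subseteq> V" "openin T N'"
      "\<forall>j<k'. m' j \<in> sections (inverse_image X Y \<Omega>) N'"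
      "\<forall>j<k'. h' j \<in> sections (O_sub X A Y) N'"
      "\<forall>z\<in>N'. s' z = finprod (P z) (\<lambda>j. pe z (m' j z) (germ T z (h' j))) {..<k'}"
      by (rule pullback_sectionE)
    have NN: "openin T (N \<inter> N')" using *(3) **(3) by blast
    \<comment> \<open>The local sums for the two sections are concatenated, the second one shifted
      by \<open>k\<close>.\<close>
    define m2 where "m2 = (\<lambda>j. if j < k then m j else m' (j - k))"
    define h2 where "h2 = (\<lambda>j. if j < k then h j else h' (j - k))"
    have 1: "m j \<in> sections (inverse_image X Y \<Omega>) (N \<inter> N')" "h j \<in> sections (O_sub X A Y) (N \<inter> N')"
      if "j < k" for j
      using ab_sheaf.sec_restrict[OF inverse_image_\<Omega> *(4)[rule_format, OF that] NN] O_sub_restrict[OF *(5)[rule_format, OF that] NN]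
      by auto
    have 2: "m' j \<in> sections (inverse_image X Y \<Omega>) (N \<inter> N')" "h' j \<in> sections (O_sub X A Y) (N \<inter> N')"
      if "j < k'" for j
      using ab_sheaf.sec_restrict[OF inverse_image_\<Omega> **(4)[rule_format, OF that] NN] O_sub_restrict[OF **(5)[rule_format, OF that] NN]
      by auto
    have "s z \<otimes>\<^bsub>P z\<^esub> s' z = finprod (P z) (\<lambda>j. pe z (m2 j z) (germ T z (h2 j))) {..<k + k'}" if z: "z \<in> N \<inter> N'" for z
    proof -
      have zY: "z \<in> Y" using z *(3) openin_subset[of T N] by auto
      then interpret comm_group "P z" by (rule comm_group_pullback)
      have "(\<lambda>j. pe z (m2 j z) (germ T z (h2 j))) =
          (\<lambda>j. if j < k then pe z (m j z) (germ T z (h j)) else pe z (m' (j - k) z) (germ T z (h' (j - k))))"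
        by (simp add: m2_def h2_def fun_eq_iff)
      then have "finprod (P z) (\<lambda>j. pe z (m2 j z) (germ T z (h2 j))) {..<k + k'} =
          finprod (P z) (\<lambda>j. pe z (m j z) (germ T z (h j))) {..<k} \<otimes>\<^bsub>P z\<^esub>
          finprod (P z) (\<lambda>j. pe z (m' j z) (germ T z (h' j))) {..<k'}"
        using finprod_lessThan_append[of k "\<lambda>j. pe z (m j z) (germ T z (h j))" k' "\<lambda>j. pe z (m' j z) (germ T z (h' j))"]
          pe_sections_closed(1)[OF 1 z] pe_sections_closed(1)[OF 2 z] by simp
      then show ?thesis using *(6)[rule_format, of z] **(6)[rule_format, of z] z by simp
    qed
    moreover have "m2 j \<in> sections (inverse_image X Y \<Omega>) (N \<inter> N') \<and> h2 j \<in> sections (O_sub X A Y) (N \<inter> N')"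
      if "j < k + k'" for j
      using 1[of j] 2[of "j - k"] that by (auto simp: m2_def h2_def)
    ultimately show "\<exists>N (k::nat) m h. y \<in> N \<and> N \<subseteq> V \<and> openin T N \<and>
        (\<forall>j<k. m j \<in> sections (inverse_image X Y \<Omega>) N \<and> h j \<in> sections (O_sub X A Y) N) \<and>
        (\<forall>z\<in>N. s z \<otimes>\<^bsub>P z\<^esub> s' z = finprod (P z) (\<lambda>j. pe z (m j z) (germ T z (h j))) {..<k})"
      using * ** NN by (intro exI[of _ "N \<inter> N'"] exI[of _ "k + k'"] exI[of _ m2] exI[of _ h2]) auto
  qed
qed

lemma pullback_sheaf_hom:
  "sheaf_hom T (inverse_image X Y \<Omega>) (module_pullback X A Y \<Omega>) (\<lambda>p m. pe p m (germ T p (\<lambda>x. 1)))"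
  unfolding sheaf_hom_def vals_pullback vals_inverse_image topspace_T
proof (intro conjI ballI allI)
  have one: "(\<lambda>x. 1) \<in> sections (O_sub X A Y) V" if "openin T V" for V
    using that by (rule O_sub_const)
  have oneY: "germ T p (\<lambda>x. 1) \<in> carrier (stalk T (O_sub X A Y) p)" if "p \<in> Y" for p
    by (rule germ_T_carrier[OF one[of Y] that]) (use openin_topspace[of T] in simp)
  show "(\<lambda>m. pe p m (germ T p (\<lambda>x. 1))) \<in> hom (stalk X \<Omega> p) (P p)" if "p \<in> Y" for p
    using that oneY by (intro homI pe_closed pe_mult_left)
  fix U s assume s: "s \<in> sections (inverse_image X Y \<Omega>) U"
  have op: "openin T U" using ab_sheaf.open_sec[OF inverse_image_\<Omega> s] .
  show "(\<lambda>p. pe p (s p) (germ T p (\<lambda>x. 1))) \<in> sections (module_pullback X A Y \<Omega>) U"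
  proof (rule pullback_sectionI[OF op])
    fix y assume y: "y \<in> U"
    have "pe z (s z) (germ T z (\<lambda>x. 1)) = finprod (P z) (\<lambda>j. pe z (s z) (germ T z (\<lambda>x. 1))) {..<1::nat}"
      if "z \<in> U" for z
    proof -
      note cl = pe_sections_closed[OF s one[OF op] that]
      interpret comm_group "P z" by (rule comm_group_pullback[OF cl(2)])
      show ?thesis using cl by (simp add: lessThan_Suc)
    qed
    then show "\<exists>N (k::nat) m h. y \<in> N \<and> N \<subseteq> U \<and> openin T N \<and>
        (\<forall>j<k. m j \<in> sections (inverse_image X Y \<Omega>) N \<and> h j \<in> sections (O_sub X A Y) N) \<and>
        (\<forall>z\<in>N. pe z (s z) (germ T z (\<lambda>x. 1)) = finprod (P z) (\<lambda>j. pe z (m j z) (germ T z (h j))) {..<k})"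
      using s one[OF op] y op by (intro exI[of _ U] exI[of _ 1] exI[of _ "\<lambda>j. s"] exI[of _ "\<lambda>j x. 1"]) auto
  qed
qed

end

section \<open>Line bundles\<close>

lemma local_triv_bij:
  assumes "local_triv T L t"
  shows "bij_betw (\<lambda>e. (bundle_proj L e, snd t e)) (over L (fst t)) (fst t \<times> UNIV)" "openin T (fst t)"
proof -
  obtain U \<tau> where t: "t = (U, \<tau>)" by force
  have op: "openin T U" and hm: "homeomorphic_map (subtopology (bundle_space L) (over L U))
      (prod_topology (subtopology T U) euclidean) (\<lambda>e. (bundle_proj L e, \<tau> e))"
    using assms by (auto simp: local_triv_def t)
  have top: "topspace (subtopology (bundle_space L) (over L U)) = over L U"
    by (auto simp: over_def)
  have top': "topspace (prod_topology (subtopology T U) euclidean) = U \<times> UNIV"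
    using openin_subset[OF op] by auto
  show "bij_betw (\<lambda>e. (bundle_proj L e, snd t e)) (over L (fst t)) (fst t \<times> UNIV)"
    using homeomorphic_imp_injective_map[OF hm] homeomorphic_imp_surjective_map[OF hm]
    unfolding top top' t bij_betw_def by simp
  show "openin T (fst t)" using op t by simp
qed

text \<open>A trivialization is bijective from the bundle over \<open>fst t\<close> to the product,
  so exactly one vector over \<open>x\<close> has coordinate 1 and the definite description in
  \<open>local_frame\<close> is meaningful.\<close>

lemma local_frame:
  assumes "local_triv T L t" "x \<in> fst t"
  shows "local_frame L t x \<in> over L {x}" "snd t (local_frame L t x) = 1"
proof -
  note b = local_triv_bij(1)[OF assms(1)]
  have "(x, 1) \<in> (\<lambda>e. (bundle_proj L e, snd t e)) ` over L (fst t)"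
    using bij_betw_imp_surj_on[OF b] assms(2) by simp
  then obtain e where e: "e \<in> over L (fst t)" "bundle_proj L e = x" "snd t e = 1"
    by auto
  have "\<exists>!e. e \<in> over L {x} \<and> snd t e = 1"
  proof (rule ex1I[of _ e])
    show "e \<in> over L {x} \<and> snd t e = 1" using e by (auto simp: over_def)
    fix e' assume "e' \<in> over L {x} \<and> snd t e' = 1"
    then show "e' = e"
      using inj_onD[OF bij_betw_imp_inj_on[OF b], of e' e] e assms(2) by (auto simp: over_def)
  qed
  from theI'[OF this] show "local_frame L t x \<in> over L {x}" "snd t (local_frame L t x) = 1"
    unfolding local_frame_def by auto
qed

lemma trivs_compatibleD:
  assumes "trivs_compatible S L t t'" "e \<in> over L {x}" "x \<in> fst t" "x \<in> fst t'"
  shows "snd t e = transition L t t' x * snd t' e"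
  using assms unfolding trivs_compatible_def over_def by fastforce

locale cbundle = cmanifold X A for X :: "'a topology" and A :: "('a, 'n::finite) chart set" +
  fixes L :: "('a, 'e) line_bundle"
  assumes line_bundle: "holomorphic_line_bundle X (O_sheaf X A) L"
begin

abbreviation "htriv \<equiv> holo_triv X (O_sheaf X A) L"

lemma htrivI: "t \<in> bundle_trivs L \<Longrightarrow> htriv t"
  using line_bundle unfolding holomorphic_line_bundle_def holo_triv_def by blast

lemma htriv_open: "htriv t \<Longrightarrow> openin X (fst t)"
  unfolding holo_triv_def using local_triv_bij(2) by blast

lemma bundle_triv_exists:
  assumes "x \<in> topspace X"
  obtains t where "t \<in> bundle_trivs L" "x \<in> fst t"
  using assms line_bundle unfolding holomorphic_line_bundle_def by blast

lemma htriv_frame: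
  assumes "htriv t" "x \<in> fst t"
  shows "local_frame L t x \<in> over L {x}" "snd t (local_frame L t x) = 1"
proof -
  have "local_triv X L t" using assms(1) unfolding holo_triv_def by blast
  from local_frame[OF this assms(2)]
  show "local_frame L t x \<in> over L {x}" "snd t (local_frame L t x) = 1" by auto
qed

text \<open>\<open>holo_triv\<close> compares a trivialization only with members of
  \<open>bundle_trivs L\<close>. The transition between two arbitrary ones is therefore factored
  through a member \<open>s\<close>, and its holomorphy and cocycle rule are derived from this
  factorization.\<close>

lemma transition_via:
  assumes "htriv t" "htriv t'" "s \<in> bundle_trivs L" "x \<in> fst t" "x \<in> fst t'" "x \<in> fst s"
  shows "transition L t t' x = transition L t s x * transition L s t' x"
proof -
  have "trivs_compatible (O_sheaf X A) L t s" using assms(1,3) unfolding holo_triv_def by blast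
  from trivs_compatibleD[OF this htriv_frame(1)[OF assms(2,5)] assms(4,6)]
  show ?thesis by (simp add: transition_def)
qed

lemma transition_inverse:
  assumes "htriv t" "s \<in> bundle_trivs L" "x \<in> fst t" "x \<in> fst s"
  shows "transition L s t x * transition L t s x = 1"
proof -
  have "trivs_compatible (O_sheaf X A) L s t" using assms(1,2) unfolding holo_triv_def by blast
  from trivs_compatibleD[OF this htriv_frame(1)[OF htrivI[OF assms(2)] assms(4)] assms(4,3)]
  show ?thesis using htriv_frame(2)[OF htrivI[OF assms(2)] assms(4)] by (simp add: transition_def)
qed

lemma transition_cocycle:
  assumes "htriv t" "htriv t'" "htriv t''" "x \<in> fst t" "x \<in> fst t'" "x \<in> fst t''"
  shows "transition L t t' x * transition L t' t'' x = transition L t t'' x"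
proof -
  have "x \<in> topspace X" using htriv_open[OF assms(1)] assms(4) openin_subset by blast
  then obtain s where s: "s \<in> bundle_trivs L" "x \<in> fst s" by (rule bundle_triv_exists)
  have "transition L t t' x * transition L t' t'' x =
      transition L t s x * (transition L s t' x * transition L t' s x) * transition L s t'' x"
    using assms s by (simp add: transition_via[of t t' s] transition_via[of t' t'' s])
  also have "\<dots> = transition L t t'' x"
    using assms s by (simp add: transition_inverse transition_via[of t t'' s])
  finally show ?thesis .
qed

lemma transition_section:
  assumes "htriv t" "htriv t'"
  shows "transition L t t' \<in> sections (units_sheaf (O_sheaf X A)) (fst t \<inter> fst t')"
  unfolding units_section_iff
proof (intro conjI ballI)
  show op: "openin X (fst t \<inter> fst t')" using htriv_open assms by blast
  fix x assume x: "x \<in> fst t \<inter> fst t'"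
  then have "x \<in> topspace X" using op openin_subset by blast
  then obtain s where s: "s \<in> bundle_trivs L" "x \<in> fst s" by (rule bundle_triv_exists)
  have 1: "transition L t s \<in> sections (units_sheaf (O_sheaf X A)) (fst t \<inter> fst s)"
    "transition L s t' \<in> sections (units_sheaf (O_sheaf X A)) (fst s \<inter> fst t')"
    using assms s unfolding holo_triv_def trivs_compatible_def by blast+
  have "holo_at A (\<lambda>y. transition L t s y * transition L s t' y) x"
    using 1 x s by (intro holo_at_mult) (auto simp: units_section_iff)
  then show "holo_at A (transition L t t') x"
  proof (rule holo_at_cong)
    show "openin X (fst t \<inter> fst t' \<inter> fst s)" using op htriv_open[OF htrivI[OF s(1)]] by blast
  qed (use x s assms transition_via in auto)
  show "transition L t t' x \<noteq> 0"
    using 1 x s assms transition_via[of t t' s x] by (auto simp: units_section_iff)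
qed

definition triv_family :: "('a \<Rightarrow> 'a set \<times> ('e \<Rightarrow> complex)) \<Rightarrow> bool" where
  "triv_family t \<longleftrightarrow> (\<forall>x\<in>topspace X. htriv (t x) \<and> x \<in> fst (t x))"

definition triv_cochain :: "('a \<Rightarrow> 'a set \<times> ('e \<Rightarrow> complex)) \<Rightarrow> ('a, complex) cochain" where
  "triv_cochain t = (\<lambda>x. fst (t x), \<lambda>x y. transition L (t x) (t y))"

lemma triv_cocycle:
  assumes "triv_family t"
  shows "triv_cochain t \<in> cocycles X (units_sheaf (O_sheaf X A))"
  using assms htriv_open transition_section transition_cocycle
  unfolding triv_family_def triv_cochain_def cocycles_def by (auto simp: mult_complex_def)

text \<open>The transition functions from one family of trivializations to the other form the
  0-cochain that relates both cocycles.\<close>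

lemma triv_cohomologous:
  assumes "triv_family t" "triv_family t'"
  shows "(triv_cochain t, triv_cochain t') \<in> cohomologous X (units_sheaf (O_sheaf X A))"
  unfolding triv_cochain_def
proof (rule ab_sheaf.cohomologousI[OF ab_sheaf_units,
      where V = "\<lambda>x. fst (t x) \<inter> fst (t' x)" and b = "\<lambda>x. transition L (t x) (t' x)"])
  show "(\<lambda>x. fst (t x), \<lambda>x y. transition L (t x) (t y)) \<in> cocycles X (units_sheaf (O_sheaf X A))"
    "(\<lambda>x. fst (t' x), \<lambda>x y. transition L (t' x) (t' y)) \<in> cocycles X (units_sheaf (O_sheaf X A))"
    using triv_cocycle[OF assms(1)] triv_cocycle[OF assms(2)] by (simp_all add: triv_cochain_def)
  fix x assume x: "x \<in> topspace X"
  show "openin X (fst (t x) \<inter> fst (t' x)) \<and> x \<in> fst (t x) \<inter> fst (t' x) \<and>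
      fst (t x) \<inter> fst (t' x) \<subseteq> fst (t x) \<inter> fst (t' x) \<and>
      transition L (t x) (t' x) \<in> sections (units_sheaf (O_sheaf X A)) (fst (t x) \<inter> fst (t' x))"
  proof -
    have "htriv (t x)" "htriv (t' x)" "x \<in> fst (t x) \<inter> fst (t' x)"
      using assms x unfolding triv_family_def by auto
    then show ?thesis
      using htriv_open[of "t x"] htriv_open[of "t' x"] transition_section[of "t x" "t' x"] by auto
  qed
  fix y p assume "y \<in> topspace X" "p \<in> fst (t x) \<inter> fst (t' x) \<inter> (fst (t y) \<inter> fst (t' y))"
  then show "transition L (t x) (t' x) p \<otimes>\<^bsub>vals (units_sheaf (O_sheaf X A)) p\<^esub> transition L (t' x) (t' y) p =
      transition L (t x) (t y) p \<otimes>\<^bsub>vals (units_sheaf (O_sheaf X A)) p\<^esub> transition L (t y) (t' y) p"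
    using assms x transition_cocycle unfolding triv_family_def by (auto simp: mult_complex_def)
qed

lemma bundle_class_eq:
  assumes "triv_family t"
  shows "bundle_class X (O_sheaf X A) L = coh_class X (units_sheaf (O_sheaf X A)) (triv_cochain t)"
proof -
  have "bundle_class X (O_sheaf X A) L =
      (\<Union>t\<in>{t. triv_family t}. coh_class X (units_sheaf (O_sheaf X A)) (triv_cochain t))"
    by (simp add: bundle_class_def triv_family_def triv_cochain_def)
  also have "\<dots> = coh_class X (units_sheaf (O_sheaf X A)) (triv_cochain t)"
    using assms triv_cohomologous by (intro ab_sheaf.UN_coh_class[OF ab_sheaf_units]) auto
  finally show ?thesis .
qed

lemma weight_transition:
  assumes h: "hermitian_metric L h" and t: "t \<in> bundle_trivs L" "t' \<in> bundle_trivs L"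
    and x: "x \<in> fst t" "x \<in> fst t'"
  shows "weight L h t' x = weight L h t x * (cmod (transition L t t' x))\<^sup>2" "weight L h t x > 0"
proof -
  show "weight L h t x > 0" using h t x unfolding hermitian_metric_def by blast
  let ?e = "local_frame L t' x"
  have "?e \<in> over L {x}" using htriv_frame[OF htrivI[OF t(2)] x(2)] by blast
  then have "h ?e ?e = of_real (weight L h t x) * snd t ?e * cnj (snd t ?e)"
    using h t x unfolding hermitian_metric_def by blast
  also have "\<dots> = of_real (weight L h t x * (cmod (snd t ?e))\<^sup>2)"
    using complex_norm_square[of "snd t ?e"] by simp
  finally show "weight L h t' x = weight L h t x * (cmod (transition L t t' x))\<^sup>2"
    by (simp add: weight_def transition_def)
qed

end

locale csub_bundle = csub X A Y + cbundle X A L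
  for X :: "'a topology" and A :: "('a, 'n::finite) chart set" and Y :: "'a set"
    and L :: "('a, 'e) line_bundle"
begin

abbreviation "LY \<equiv> restrict_bundle L Y"

lemma over_LY: "x \<in> Y \<Longrightarrow> over LY {x} = over L {x}"
  by (auto simp: over_def restrict_bundle_def)

text \<open>The transition cocycle is traced through the restriction to \<open>Y\<close> and the
  three induced maps. The outcome is the cocycle of the tensors of \<open>dlog\<close> of the
  transition functions with 1; the second part provides the cocycle property for the comparison with
  the trivial cocycle.\<close>

lemma ueda_class_eq:
  assumes t: "triv_family t"
  shows "ueda_class X A Y L = coh_class T (module_pullback X A Y \<Omega>) (push_cochain
      (\<lambda>p a. pe p (\<Union>f\<in>a. germ X p (dlog A f)) (germ T p (\<lambda>x. 1)))
      (ab_sheaf.restrict_cochain X Y (triv_cochain t)))"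
    and "push_cochain (\<lambda>p a. pe p (\<Union>f\<in>a. germ X p (dlog A f)) (germ T p (\<lambda>x. 1)))
      (ab_sheaf.restrict_cochain X Y (triv_cochain t)) \<in> cocycles T (module_pullback X A Y \<Omega>)"
proof -
  let ?U = "units_sheaf (O_sheaf X A)"
  let ?r = "ab_sheaf.restrict_cochain X Y (triv_cochain t)"
  let ?d = "push_cochain (\<lambda>p a. \<Union>f\<in>a. germ X p (dlog A f)) ?r"
  let ?i = "push_cochain (\<lambda>p m. m) ?d"
  have IU: "ab_sheaf T (inverse_image X Y ?U)"
    by (rule ab_sheaf.ab_sheaf_inverse_image[OF ab_sheaf_units Y_subset])
  have IdO: "ab_sheaf T (inverse_image X Y (dO_sheaf X A))"
    by (rule ab_sheaf.ab_sheaf_inverse_image[OF ab_sheaf_dO Y_subset])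
  have r: "?r \<in> cocycles T (inverse_image X Y ?U)"
    by (rule ab_sheaf.restrict_cocycle[OF ab_sheaf_units Y_subset triv_cocycle[OF t]])
  have d: "?d \<in> cocycles T (inverse_image X Y (dO_sheaf X A))"
    by (rule push_cocycle[OF IU dlog_sheaf_hom[OF Y_subset] r])
  have i: "?i \<in> cocycles T (inverse_image X Y \<Omega>)"
    by (rule push_cocycle[OF IdO dO_Omega1_sheaf_hom d])
  have eq: "push_cochain (\<lambda>p m. pe p m (germ T p (\<lambda>x. 1))) ?i =
      push_cochain (\<lambda>p a. pe p (\<Union>f\<in>a. germ X p (dlog A f)) (germ T p (\<lambda>x. 1))) ?r"
    by (simp add: push_cochain_def)
  have "ueda_class X A Y L = H1_map T (module_pullback X A Y \<Omega>) (\<lambda>p m. pe p m (germ T p (\<lambda>x. 1)))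
      (H1_map T (inverse_image X Y \<Omega>) (\<lambda>p m. m)
        (H1_map T (inverse_image X Y (dO_sheaf X A)) (\<lambda>p a. \<Union>f\<in>a. germ X p (dlog A f))
          (H1_restrict X Y ?U (coh_class X ?U (triv_cochain t)))))"
    unfolding ueda_class_def Let_def bundle_class_eq[OF t] ..
  also have "\<dots> = coh_class T (module_pullback X A Y \<Omega>) (push_cochain (\<lambda>p m. pe p m (germ T p (\<lambda>x. 1))) ?i)"
    unfolding ab_sheaf.H1_restrict_coh_class[OF ab_sheaf_units Y_subset triv_cocycle[OF t]]
      H1_map_coh_class[OF IU IdO dlog_sheaf_hom[OF Y_subset] r]
      H1_map_coh_class[OF IdO inverse_image_\<Omega> dO_Omega1_sheaf_hom d]
      H1_map_coh_class[OF inverse_image_\<Omega> ab_sheaf_pullback pullback_sheaf_hom i] ..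
  finally show "ueda_class X A Y L = coh_class T (module_pullback X A Y \<Omega>) (push_cochain
      (\<lambda>p a. pe p (\<Union>f\<in>a. germ X p (dlog A f)) (germ T p (\<lambda>x. 1))) ?r)"
    unfolding eq .
  show "push_cochain (\<lambda>p a. pe p (\<Union>f\<in>a. germ X p (dlog A f)) (germ T p (\<lambda>x. 1))) ?r
      \<in> cocycles T (module_pullback X A Y \<Omega>)"
    using push_cocycle[OF inverse_image_\<Omega> pullback_sheaf_hom i] unfolding eq .
qed

lemma ueda_cochain_apply:
  assumes "p \<in> Y"
  shows "snd (push_cochain (\<lambda>p a. pe p (\<Union>f\<in>a. germ X p (dlog A f)) (germ T p (\<lambda>x. 1)))
      (ab_sheaf.restrict_cochain X Y (triv_cochain t))) x y p =
    pe p (germ X p (dlog A (transition L (t x) (t y)))) (germ T p (\<lambda>x. 1))"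
proof -
  have "p \<in> topspace X" using assms Y_subset by blast
  then have "(\<Union>f\<in>germ X p g. germ X p (dlog A f)) = germ X p (dlog A g)" for g
  proof (rule UN_germ_local)
    fix N and f' :: "'a \<Rightarrow> complex" assume "openin X N" "\<forall>x\<in>N. f' x = g x"
    then show "\<forall>x\<in>N. dlog A f' x = dlog A g x"
      using ext_d_cong[of N _ f' g] by (simp add: dlog_def)
  qed
  then show ?thesis
    by (simp add: push_cochain_def ab_sheaf.restrict_cochain_def[OF ab_sheaf_units] triv_cochain_def)
qed

text \<open>The transition functions of a unitary flat structure have modulus 1, so the square norm of its
  frames is a global function on \<open>Y\<close>.\<close>

lemma flat_frame_norm:
  assumes flat: "unitary_flat T (O_sub X A Y) LY" and h: "hermitian_metric L h"
  obtains G :: "'a \<Rightarrow> real" where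
    "\<And>y t. y \<in> Y \<Longrightarrow> t \<in> bundle_trivs L \<Longrightarrow> y \<in> fst t \<Longrightarrow>
      \<exists>N F. openin X N \<and> y \<in> N \<and> N \<subseteq> fst t \<and> (\<forall>p\<in>N. holo_at A F p \<and> F p \<noteq> 0) \<and>
        (\<forall>p\<in>N \<inter> Y. G p = weight L h t p * (cmod (F p))\<^sup>2)"
proof -
  obtain \<T> where \<T>: "\<forall>t\<in>\<T>. holo_triv T (O_sub X A Y) LY t" "\<forall>x\<in>topspace T. \<exists>t\<in>\<T>. x \<in> fst t"
    "\<forall>t\<in>\<T>. \<forall>t'\<in>\<T>. locally_constant_on T (fst t \<inter> fst t') (transition LY t t') \<and>
        (\<forall>x\<in>fst t \<inter> fst t'. cmod (transition LY t t' x) = 1)"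
    using flat unfolding unitary_flat_def by blast
  define \<sigma> where "\<sigma> y = (SOME t. t \<in> \<T> \<and> y \<in> fst t)" for y
  have \<sigma>: "\<sigma> y \<in> \<T> \<and> y \<in> fst (\<sigma> y)" if "y \<in> Y" for y
  proof -
    have "\<exists>t. t \<in> \<T> \<and> y \<in> fst t" using \<T>(2) that unfolding topspace_T by blast
    then show ?thesis unfolding \<sigma>_def by (rule someI_ex)
  qed
  define fr where "fr t y = local_frame LY t y" for t y
  have fr: "fr t y \<in> over L {y}" "snd t (fr t y) = 1" if "t \<in> \<T>" "y \<in> fst t" "y \<in> Y" for t y
    using local_frame[of T LY t y] \<T>(1) that over_LY unfolding fr_def holo_triv_def by blast+
  \<comment> \<open>The norm is taken in an arbitrarily chosen flat frame at each point;
    \<open>norm_eq\<close> below makes it independent of that choice.\<close>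
  define G where "G y = Re (h (fr (\<sigma> y) y) (fr (\<sigma> y) y))" for y
  \<comment> \<open>Both flat frames are measured in the coordinate of an ambient trivialization
    \<open>s\<close>. They differ by a transition function of modulus 1, which disappears from the
    modulus of the coordinate.\<close>
  have norm_eq: "cmod (snd s (fr t y)) = cmod (snd s (fr t' y))"
    if t: "t \<in> \<T>" "t' \<in> \<T>" and s: "s \<in> bundle_trivs L" and y: "y \<in> Y" "y \<in> fst t" "y \<in> fst t'" "y \<in> fst s" for t t' s y
  proof -
    have sY: "(fst s \<inter> Y, snd s) \<in> bundle_trivs LY"
      using s image_eqI[of _ "\<lambda>(U, \<tau>). (U \<inter> Y, \<tau>)" s "bundle_trivs L"]
      by (simp add: restrict_bundle_def split_beta)
    then have comp: "trivs_compatible (O_sub X A Y) LY t (fst s \<inter> Y, snd s)"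
      using \<T>(1) t(1) unfolding holo_triv_def by blast
    define c where "c = transition LY t (fst s \<inter> Y, snd s) y"
    have c: "snd t e = c * snd s e" if "e \<in> over L {y}" for e
      using trivs_compatibleD[OF comp, of e y] that y over_LY by (simp add: c_def)
    have "1 = c * snd s (fr t y)" using c[OF fr(1)[OF t(1) y(2,1)]] fr(2)[OF t(1) y(2,1)] by simp
    moreover have "cmod (transition LY t t' y) = 1" using \<T>(3) t y(2,3) by blast
    then have "cmod (c * snd s (fr t' y)) = 1"
      using c[OF fr(1)[OF t(2) y(3,1)]] by (simp add: transition_def fr_def)
    ultimately have "cmod c * cmod (snd s (fr t y)) = cmod c * cmod (snd s (fr t' y))" "c \<noteq> 0"
      by (metis norm_mult norm_one, auto)
    then show ?thesis by simp
  qed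
  have G_eq: "G p = weight L h s p * (cmod (snd s (fr t p)))\<^sup>2"
    if t: "t \<in> \<T>" and s: "s \<in> bundle_trivs L" and p: "p \<in> Y" "p \<in> fst t" "p \<in> fst s" for s t p
  proof -
    let ?e = "fr (\<sigma> p) p"
    have "?e \<in> over L {p}" using fr \<sigma>[OF p(1)] p(1) by blast
    then have "h ?e ?e = of_real (weight L h s p) * snd s ?e * cnj (snd s ?e)"
      using h s p unfolding hermitian_metric_def by blast
    also have "\<dots> = of_real (weight L h s p * (cmod (snd s ?e))\<^sup>2)"
      using complex_norm_square[of "snd s ?e"] by simp
    finally have "G p = weight L h s p * (cmod (snd s ?e))\<^sup>2" by (simp add: G_def)
    moreover have "cmod (snd s ?e) = cmod (snd s (fr t p))"
      using \<sigma>[OF p(1)] by (intro norm_eq t s p) auto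
    ultimately show ?thesis by simp
  qed
  show thesis
  proof (rule that[of G])
    fix y s assume y: "y \<in> Y" and s: "s \<in> bundle_trivs L" "y \<in> fst s"
    obtain t where t: "t \<in> \<T>" "y \<in> fst t" using \<sigma>[OF y] by blast
    have sY: "(fst s \<inter> Y, snd s) \<in> bundle_trivs LY"
      using s image_eqI[of _ "\<lambda>(U, \<tau>). (U \<inter> Y, \<tau>)" s "bundle_trivs L"]
      by (simp add: restrict_bundle_def split_beta)
    have "trivs_compatible (O_sub X A Y) LY (fst s \<inter> Y, snd s) t"
      using \<T>(1) t(1) sY unfolding holo_triv_def by blast
    then have "transition LY (fst s \<inter> Y, snd s) t \<in> sections (units_sheaf (O_sub X A Y)) (fst s \<inter> Y \<inter> fst t)"
      unfolding trivs_compatible_def by simp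
    then have sec: "transition LY (fst s \<inter> Y, snd s) t \<in> sections (O_sub X A Y) (fst s \<inter> Y \<inter> fst t)"
      and nz: "transition LY (fst s \<inter> Y, snd s) t y \<noteq> 0"
      using y s t by (auto simp: units_sheaf_def)
    have tr: "transition LY (fst s \<inter> Y, snd s) t p = snd s (fr t p)" for p
      by (simp add: transition_def fr_def)
    have yin: "y \<in> fst s \<inter> Y \<inter> fst t" using y s t by blast
    \<comment> \<open>On \<open>Y\<close> the coordinate of a flat frame is a section of the
      structure sheaf of \<open>Y\<close>; \<open>F\<close> is a holomorphic extension of it to an
      open subset of \<open>X\<close>.\<close>
    obtain U F where F: "openin X U" "y \<in> U" "\<forall>x\<in>U. holo_at A F x"
      "\<forall>x\<in>U \<inter> (fst s \<inter> Y \<inter> fst t). transition LY (fst s \<inter> Y, snd s) t x = F x"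
      using sec yin by (rule O_sub_sectionE)
    have "F y \<noteq> 0" using nz F(2,4) yin by auto
    define N where "N = {x \<in> U. F x \<in> - {0}}"
    have "openin X N"
      unfolding N_def using F(3) by (intro openin_holo_preimage[OF F(1)] open_Compl) auto
    then have N: "openin X N" "y \<in> N" "N \<subseteq> U" "\<And>x. x \<in> N \<Longrightarrow> F x \<noteq> 0"
      using F(2) \<open>F y \<noteq> 0\<close> by (auto simp: N_def)
    have "openin T (fst t)" using \<T>(1) t(1) local_triv_bij(2) unfolding holo_triv_def by blast
    then obtain M where M: "openin X M" "fst t = M \<inter> Y" by (auto simp: openin_subtopology)
    have "openin X (N \<inter> M \<inter> fst s)" using N M htriv_open[OF htrivI[OF s(1)]] by blast
    moreover have "y \<in> N \<inter> M \<inter> fst s" using N M t s by blast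
    moreover have "G p = weight L h s p * (cmod (F p))\<^sup>2" if p: "p \<in> N \<inter> M \<inter> fst s \<inter> Y" for p
    proof -
      have "p \<in> fst t" using p M by blast
      then have "G p = weight L h s p * (cmod (snd s (fr t p)))\<^sup>2"
        using p by (intro G_eq t s) auto
      moreover have "snd s (fr t p) = F p"
        using F(4) p N(3) \<open>p \<in> fst t\<close> tr[of p] by auto
      ultimately show ?thesis by simp
    qed
    ultimately show "\<exists>N F. openin X N \<and> y \<in> N \<and> N \<subseteq> fst s \<and> (\<forall>p\<in>N. holo_at A F p \<and> F p \<noteq> 0) \<and>
        (\<forall>p\<in>N \<inter> Y. G p = weight L h s p * (cmod (F p))\<^sup>2)"
      using N F(3) by (intro exI[of _ "N \<inter> M \<inter> fst s"] exI[of _ F]) auto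
  qed
qed

end

section \<open>The Levi form of a function of class C2\<close>

text \<open>The differentiability contained in \<open>Cr_on\<close> at level 2, in the form that
  makes all values of \<open>hess\<close> genuine derivatives.\<close>

definition C2_on :: "(complex^'n::finite) set \<Rightarrow> (complex^'n \<Rightarrow> real) \<Rightarrow> bool" where
  "C2_on S u \<longleftrightarrow> (\<forall>z\<in>S. u differentiable (at z)) \<and>
     (\<forall>v. \<forall>z\<in>S. (\<lambda>z. frechet_derivative u (at z) v) differentiable (at z))"

definition hess :: "(complex^'n::finite \<Rightarrow> real) \<Rightarrow> complex^'n \<Rightarrow> complex^'n \<Rightarrow> complex^'n \<Rightarrow> real" where
  "hess u z v w = frechet_derivative (\<lambda>z. frechet_derivative u (at z) v) (at z) w"

lemma C2_onD:
  assumes "C2_on S u" "z \<in> S"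
  shows "(u has_derivative frechet_derivative u (at z)) (at z)"
    and "((\<lambda>z. frechet_derivative u (at z) v) has_derivative hess u z v) (at z)"
proof -
  show "(u has_derivative frechet_derivative u (at z)) (at z)"
    using assms by (simp add: C2_on_def flip: frechet_derivative_works)
  have "(\<lambda>z. frechet_derivative u (at z) v) differentiable (at z)"
    using assms by (simp add: C2_on_def)
  moreover have "hess u z v = frechet_derivative (\<lambda>z. frechet_derivative u (at z) v) (at z)"
    by (simp add: hess_def fun_eq_iff)
  ultimately show "((\<lambda>z. frechet_derivative u (at z) v) has_derivative hess u z v) (at z)"
    by (simp add: frechet_derivative_works)
qed

lemma C2_on_subset: "C2_on S u \<Longrightarrow> S' \<subseteq> S \<Longrightarrow> C2_on S' u"
  by (auto simp: C2_on_def)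

text \<open>The first derivative of the logarithm is a quotient of differentiable functions on all
  of the open set \<open>S\<close>, so it can be differentiated once more.\<close>

lemma C2_on_ln:
  fixes w :: "complex^'n::finite \<Rightarrow> real"
  assumes S: "open S" and w: "Cr_on r S w" "2 \<le> r" and pos: "\<And>z. z \<in> S \<Longrightarrow> w z > 0"
  shows "C2_on S (\<lambda>z. ln (w z))"
proof -
  obtain k where r: "r = Suc (Suc k)" using w(2) by (metis add_2_eq_Suc le_Suc_ex)
  have d1: "(w has_derivative frechet_derivative w (at z)) (at z)" if "z \<in> S" for z
    using w(1) that unfolding r by (simp flip: frechet_derivative_works)
  have d2: "(\<lambda>z. frechet_derivative w (at z) v) differentiable (at z)" if "z \<in> S" for z v
    using w(1) that unfolding r by simp
  have ln: "((\<lambda>z. ln (w z)) has_derivative (\<lambda>v. frechet_derivative w (at z) v / w z)) (at z)" if "z \<in> S" for z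
    using d1[OF that] pos[OF that] by (auto intro!: derivative_eq_intros simp: divide_inverse mult.commute)
  have eq: "frechet_derivative (\<lambda>z. ln (w z)) (at z) v = frechet_derivative w (at z) v / w z" if "z \<in> S" for z v
    by (rule fun_cong[OF frechet_derivative_at[OF ln[OF that], symmetric]])
  show ?thesis
    unfolding C2_on_def
  proof (intro conjI allI ballI)
    show "(\<lambda>z. ln (w z)) differentiable (at z)" if "z \<in> S" for z
      using ln[OF that] by (rule differentiableI)
    fix v z assume z: "z \<in> S"
    have "w z \<noteq> 0" using pos[OF z] by simp
    then have "(\<lambda>z. frechet_derivative w (at z) v / w z) differentiable (at z)"
      using d2[OF z] differentiableI[OF d1[OF z]] by (intro differentiable_divide)
    then obtain D where "((\<lambda>z. frechet_derivative w (at z) v / w z) has_derivative D) (at z)"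
      by (auto simp: differentiable_def)
    then have "((\<lambda>z. frechet_derivative (\<lambda>z. ln (w z)) (at z) v) has_derivative D) (at z)"
      by (rule has_derivative_transform_within_open[OF _ S z]) (simp add: eq)
    then show "(\<lambda>z. frechet_derivative (\<lambda>z. ln (w z)) (at z) v) differentiable (at z)"
      by (rule differentiableI)
  qed
qed

lemma has_laplacian_hess:
  assumes "open S" "C2_on S u" "z0 + \<zeta> *s V \<in> S"
  shows "has_laplacian (\<lambda>\<xi>. u (z0 + \<xi> *s V))
    (hess u (z0 + \<zeta> *s V) V V + hess u (z0 + \<zeta> *s V) (\<i> *s V) (\<i> *s V)) \<zeta>"
  by (rule has_laplacian_complex_line[OF assms(1,3) C2_onD(1)[OF assms(2)] C2_onD(2)[OF assms(2,3)]])

lemma linear_axis_decompose: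
  fixes K :: "complex^'n::finite \<Rightarrow> complex"
  assumes "linear K"
  shows "K v = (\<Sum>i\<in>UNIV. Re (v $ i) *\<^sub>R K (axis i 1) + Im (v $ i) *\<^sub>R K (axis i \<i>))"
proof -
  have "axis i (v $ i) = Re (v $ i) *\<^sub>R axis i 1 + Im (v $ i) *\<^sub>R (axis i \<i> :: complex^'n)" for i
    by (simp add: vec_eq_iff axis_def complex_eq_iff)
  then have "K (axis i (v $ i)) = Re (v $ i) *\<^sub>R K (axis i 1) + Im (v $ i) *\<^sub>R K (axis i \<i>)" for i
    using assms by (simp add: linear_add linear_scale)
  moreover have "K v = (\<Sum>i\<in>UNIV. K (axis i (v $ i)))"
    using linear_sum[OF assms, of "\<lambda>i. axis i (v $ i)" UNIV] by (simp add: sum_axis_complex)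
  ultimately show ?thesis by simp
qed

text \<open>The right-hand side is twice the complex-linear part of the real-linear map
  \<open>K\<close>, the left-hand side its expression by the operators
  \<open>\<partial> / \<partial>z_i\<close>. The next lemma is the counterpart for the
  conjugate-linear part.\<close>

lemma sum_del:
  fixes K :: "complex^'n::finite \<Rightarrow> complex"
  assumes "linear K"
  shows "(\<Sum>i\<in>UNIV. v $ i * (K (axis i 1) - \<i> * K (axis i \<i>))) = K v - \<i> * K (\<i> *s v)"
  unfolding linear_axis_decompose[OF assms, of v] linear_axis_decompose[OF assms, of "\<i> *s v"]
    sum_distrib_left sum_subtractf[symmetric]
  by (rule sum.cong) (auto simp: complex_eq_iff algebra_simps)

lemma sum_del_bar:
  fixes K :: "complex^'n::finite \<Rightarrow> complex"
  assumes "linear K"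
  shows "(\<Sum>i\<in>UNIV. cnj (v $ i) * (K (axis i 1) + \<i> * K (axis i \<i>))) = K v + \<i> * K (\<i> *s v)"
  unfolding linear_axis_decompose[OF assms, of v] linear_axis_decompose[OF assms, of "\<i> *s v"]
    sum_distrib_left sum.distrib[symmetric]
  by (rule sum.cong) (auto simp: complex_eq_iff algebra_simps)

lemma frechet_of_real:
  assumes "(u has_derivative D) (at z)"
  shows "frechet_derivative (\<lambda>z. complex_of_real (u z)) (at z) v = of_real (D v)"
  by (rule fun_cong[OF frechet_derivative_at[OF has_derivative_of_real[OF assms], symmetric]])

lemma wirtinger_of_real:
  assumes "(u has_derivative D) (at z)"
  shows "wirtinger j (\<lambda>z. complex_of_real (u z)) z = (of_real (D (axis j 1)) - \<i> * of_real (D (axis j \<i>))) / 2"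
    and "wirtinger_bar j (\<lambda>z. complex_of_real (u z)) z = (of_real (D (axis j 1)) + \<i> * of_real (D (axis j \<i>))) / 2"
  by (simp_all add: wirtinger_def wirtinger_bar_def frechet_of_real[OF assms])

context
  fixes S :: "(complex^'n::finite) set" and u :: "complex^'n \<Rightarrow> real"
  assumes S: "open S" and u: "C2_on S u"
begin

lemma has_derivative_wirtinger:
  assumes z: "z \<in> S"
  shows "(wirtinger j (\<lambda>z. of_real (u z)) has_derivative
    (\<lambda>w. (of_real (hess u z (axis j 1) w) - \<i> * of_real (hess u z (axis j \<i>) w)) / 2)) (at z)"
proof -
  have "((\<lambda>z. (of_real (frechet_derivative u (at z) (axis j 1)) - \<i> * of_real (frechet_derivative u (at z) (axis j \<i>))) / 2)
      has_derivative (\<lambda>w. (of_real (hess u z (axis j 1) w) - \<i> * of_real (hess u z (axis j \<i>) w)) / 2)) (at z)"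
    using C2_onD(2)[OF u z] by (auto intro!: derivative_eq_intros)
  then show ?thesis
    by (rule has_derivative_transform_within_open[OF _ S z]) (simp add: wirtinger_of_real[OF C2_onD(1)[OF u]])
qed

lemma has_derivative_wirtinger_bar:
  assumes z: "z \<in> S"
  shows "(wirtinger_bar j (\<lambda>z. of_real (u z)) has_derivative
    (\<lambda>w. (of_real (hess u z (axis j 1) w) + \<i> * of_real (hess u z (axis j \<i>) w)) / 2)) (at z)"
proof -
  have "((\<lambda>z. (of_real (frechet_derivative u (at z) (axis j 1)) + \<i> * of_real (frechet_derivative u (at z) (axis j \<i>))) / 2)
      has_derivative (\<lambda>w. (of_real (hess u z (axis j 1) w) + \<i> * of_real (hess u z (axis j \<i>) w)) / 2)) (at z)"
    using C2_onD(2)[OF u z] by (auto intro!: derivative_eq_intros)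
  then show ?thesis
    by (rule has_derivative_transform_within_open[OF _ S z]) (simp add: wirtinger_of_real[OF C2_onD(1)[OF u]])
qed

lemma wirtinger_wirtinger_bar:
  assumes z: "z \<in> S"
  shows "wirtinger i (wirtinger_bar j (\<lambda>z. of_real (u z))) z =
    ((of_real (hess u z (axis j 1) (axis i 1)) + \<i> * of_real (hess u z (axis j \<i>) (axis i 1)))
     - \<i> * (of_real (hess u z (axis j 1) (axis i \<i>)) + \<i> * of_real (hess u z (axis j \<i>) (axis i \<i>)))) / 4"
proof -
  have "frechet_derivative (wirtinger_bar j (\<lambda>z. of_real (u z))) (at z) w =
      (of_real (hess u z (axis j 1) w) + \<i> * of_real (hess u z (axis j \<i>) w)) / 2" for w
    by (rule fun_cong[OF frechet_derivative_at[OF has_derivative_wirtinger_bar[OF z, of j], symmetric]])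
  note eq = this
  show ?thesis
    unfolding wirtinger_def eq by (simp add: field_simps)
qed

lemma linear_hess_right: "z \<in> S \<Longrightarrow> linear (hess u z v)"
  using has_derivative_linear[OF C2_onD(2)[OF u]] .

text \<open>Linearity in the direction of the inner derivative: the identity between first
  derivatives holds at all points of the open set \<open>S\<close>, and so it may be differentiated
  at \<open>z\<close>.\<close>

lemma linear_hess_left:
  assumes z: "z \<in> S"
  shows "linear (\<lambda>v. hess u z v w)"
proof (rule linearI)
  have lin: "linear (frechet_derivative u (at y))" if "y \<in> S" for y
    using has_derivative_linear[OF C2_onD(1)[OF u that]] .
  fix v v'
  have "((\<lambda>z. frechet_derivative u (at z) v + frechet_derivative u (at z) v') has_derivative
      (\<lambda>w. hess u z v w + hess u z v' w)) (at z)"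
    by (intro has_derivative_add C2_onD(2)[OF u z])
  then have "((\<lambda>z. frechet_derivative u (at z) (v + v')) has_derivative
      (\<lambda>w. hess u z v w + hess u z v' w)) (at z)"
    by (rule has_derivative_transform_within_open[OF _ S z]) (simp add: linear_add[OF lin])
  then show "hess u z (v + v') w = hess u z v w + hess u z v' w"
    using has_derivative_unique[OF C2_onD(2)[OF u z, of "v + v'"]] by (simp add: fun_eq_iff)
next
  have lin: "linear (frechet_derivative u (at y))" if "y \<in> S" for y
    using has_derivative_linear[OF C2_onD(1)[OF u that]] .
  fix c :: real and v
  have "((\<lambda>z. c *\<^sub>R frechet_derivative u (at z) v) has_derivative (\<lambda>w. c *\<^sub>R hess u z v w)) (at z)"
    by (intro has_derivative_scaleR_right C2_onD(2)[OF u z])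
  then have "((\<lambda>z. frechet_derivative u (at z) (c *\<^sub>R v)) has_derivative (\<lambda>w. c *\<^sub>R hess u z v w)) (at z)"
    by (rule has_derivative_transform_within_open[OF _ S z]) (simp add: linear_scale[OF lin])
  then show "hess u z (c *\<^sub>R v) w = c *\<^sub>R hess u z v w"
    using has_derivative_unique[OF C2_onD(2)[OF u z, of "c *\<^sub>R v"]] by (simp add: fun_eq_iff)
qed

text \<open>Contracting first the antiholomorphic and then the holomorphic index collapses the
  double sum to \<open>(K v - \<i> * K (\<i> *s v)) / 4\<close>. The mixed terms, with one
  \<open>v\<close> and one \<open>\<i> *s v\<close>, are purely imaginary and drop out of the real
  part.\<close>

lemma levi_form_eq_laplacian:
  assumes z: "z \<in> S"
  shows "Re (\<Sum>i\<in>UNIV. \<Sum>j\<in>UNIV. wirtinger i (wirtinger_bar j (\<lambda>z. of_real (u z))) z * (v $ i) * cnj (v $ j)) =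
    (hess u z v v + hess u z (\<i> *s v) (\<i> *s v)) / 4"
proof -
  define k where "k j w = complex_of_real (hess u z (axis j 1) w) + \<i> * of_real (hess u z (axis j \<i>) w)" for j w
  define K where "K w = complex_of_real (hess u z v w) + \<i> * of_real (hess u z (\<i> *s v) w)" for w
  have "linear (\<lambda>v. complex_of_real (hess u z v w))" for w
    using linear_compose[OF linear_hess_left[OF z] bounded_linear.linear[OF bounded_linear_of_real], of w]
    by (simp add: o_def)
  from sum_del_bar[OF this] have kK: "(\<Sum>j\<in>UNIV. cnj (v $ j) * k j w) = K w" for w
    by (simp add: k_def K_def)
  have "linear (\<lambda>w. complex_of_real (hess u z x w))" for x
    using linear_compose[OF linear_hess_right[OF z] bounded_linear.linear[OF bounded_linear_of_real], of x]
    by (simp add: o_def)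
  then have linK: "linear K"
    unfolding K_def
    by (intro linear_compose_add)
      (use linear_compose[OF _ bounded_linear.linear[OF bounded_linear_mult_right[of \<i>]]] in \<open>auto simp: o_def\<close>)
  have "(\<Sum>i\<in>UNIV. \<Sum>j\<in>UNIV. wirtinger i (wirtinger_bar j (\<lambda>z. of_real (u z))) z * (v $ i) * cnj (v $ j)) =
      (\<Sum>i\<in>UNIV. \<Sum>j\<in>UNIV. v $ i * ((cnj (v $ j) * k j (axis i 1)) - \<i> * (cnj (v $ j) * k j (axis i \<i>))) / 4)"
    unfolding wirtinger_wirtinger_bar[OF z] k_def
    by (intro sum.cong refl) (simp add: algebra_simps add_divide_distrib diff_divide_distrib)
  also have "\<dots> = (\<Sum>i\<in>UNIV. v $ i * (K (axis i 1) - \<i> * K (axis i \<i>))) / 4"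
  proof -
    have "(\<Sum>j\<in>UNIV. v $ i * (x j - \<i> * y j) / 4) = v $ i * ((\<Sum>j\<in>UNIV. x j) - \<i> * (\<Sum>j\<in>UNIV. y j)) / 4"
      for i and x y :: "'n \<Rightarrow> complex"
      by (simp add: sum_subtractf[symmetric] sum_distrib_left sum_divide_distrib)
    then show ?thesis by (simp only: kK sum_divide_distrib)
  qed
  also have "\<dots> = (K v - \<i> * K (\<i> *s v)) / 4"
    by (simp add: sum_del[OF linK])
  finally have "Re (\<Sum>i\<in>UNIV. \<Sum>j\<in>UNIV. wirtinger i (wirtinger_bar j (\<lambda>z. of_real (u z))) z * (v $ i) * cnj (v $ j)) =
      Re ((K v - \<i> * K (\<i> *s v)) / 4)"
    by (rule arg_cong)
  also have "\<dots> = (hess u z v v + hess u z (\<i> *s v) (\<i> *s v)) / 4"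
    by (simp add: K_def)
  finally show ?thesis .
qed

text \<open>Conjugating, instead of commuting derivatives, makes the symmetry of the Hessian unnecessary.\<close>

lemma wirtinger_derivative_complex_linear:
  assumes z: "z \<in> S" and D: "(wirtinger j (\<lambda>z. of_real (u z)) has_derivative D) (at z)"
    and zero: "wirtinger i (wirtinger_bar j (\<lambda>z. of_real (u z))) z = 0"
  shows "D (axis i \<i>) = \<i> * D (axis i 1)"
proof -
  have D_eq: "D = (\<lambda>w. (of_real (hess u z (axis j 1) w) - \<i> * of_real (hess u z (axis j \<i>) w)) / 2)"
    using has_derivative_unique[OF D has_derivative_wirtinger[OF z]] .
  \<comment> \<open>The real and imaginary parts of the hypothesis. As \<open>u\<close> is real,
    they are the Cauchy-Riemann equations in the variable \<open>i\<close> for the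
    \<open>j\<close>-th holomorphic derivative of \<open>u\<close>.\<close>
  from zero have "hess u z (axis j 1) (axis i 1) + hess u z (axis j \<i>) (axis i \<i>) = 0"
    "hess u z (axis j \<i>) (axis i 1) = hess u z (axis j 1) (axis i \<i>)"
    unfolding wirtinger_wirtinger_bar[OF z] by (simp_all add: complex_eq_iff)
  then show ?thesis
    by (simp add: D_eq complex_eq_iff)
qed

end

lemma sum_mult_axis_pair:
  fixes f :: "'n::finite \<Rightarrow> complex" and g :: "complex \<Rightarrow> complex"
  assumes "i \<noteq> j" "g 0 = 0"
  shows "(\<Sum>k\<in>UNIV. f k * g ((axis i s + axis j t :: complex^'n) $ k)) = f i * g s + f j * g t"
proof -
  have "(\<Sum>k\<in>UNIV. f k * g ((axis i s + axis j t :: complex^'n) $ k)) =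
      (\<Sum>k\<in>UNIV. (if k = i then f i * g s else 0) + (if k = j then f j * g t else 0))"
    using assms by (intro sum.cong) (auto simp: axis_def)
  then show ?thesis by (simp add: sum.distrib)
qed

text \<open>On the vectors \<open>axis i s + axis j 1\<close> the quadratic term in \<open>s\<close>
  has the coefficient \<open>C $ i $ i\<close> and vanishes. The form is then real-affine in
  \<open>s\<close>, and such a function is bounded below only if it is constant.\<close>

lemma semipositive_zero_diagonal:
  fixes C :: "complex^'n^'n::finite"
  assumes q: "\<And>v::complex^'n. (\<Sum>i\<in>UNIV. \<Sum>j\<in>UNIV. C $ i $ j * (v $ i) * cnj (v $ j)) \<in> \<real> \<and>
      Re (\<Sum>i\<in>UNIV. \<Sum>j\<in>UNIV. C $ i $ j * (v $ i) * cnj (v $ j)) \<ge> 0"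
    and zero: "C $ i $ i = 0"
  shows "C $ i $ j = 0"
proof (cases "i = j")
  case False
  define a where "a = C $ i $ j"
  define b where "b = C $ j $ i"
  define d where "d = C $ j $ j"
  have eval: "(\<Sum>k\<in>UNIV. \<Sum>l\<in>UNIV. C $ k $ l * ((axis i s + axis j 1 :: complex^'n) $ k) * cnj ((axis i s + axis j 1 :: complex^'n) $ l)) =
      s * a + cnj s * b + d" for s
  proof -
    have "(\<Sum>l\<in>UNIV. C $ k $ l * ((axis i s + axis j 1 :: complex^'n) $ k) * cnj ((axis i s + axis j 1 :: complex^'n) $ l)) =
        (C $ k $ i * cnj s + C $ k $ j) * ((axis i s + axis j 1 :: complex^'n) $ k)" for k
      using sum_mult_axis_pair[OF False, of cnj "\<lambda>l. C $ k $ l * ((axis i s + axis j 1 :: complex^'n) $ k)" s 1]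
      by (simp add: algebra_simps)
    then show ?thesis
      using sum_mult_axis_pair[OF False, of "\<lambda>x. x" "\<lambda>k. C $ k $ i * cnj s + C $ k $ j" s 1] zero
      by (simp add: a_def b_def d_def algebra_simps)
  qed
  have real: "Im (s * a + cnj s * b + d) = 0" and pos: "Re (s * a + cnj s * b + d) \<ge> 0" for s
    using q[of "axis i s + axis j 1"] unfolding eval by (auto simp: complex_is_Real_iff)
  \<comment> \<open>Hermitian symmetry of the two entries is extracted from the reality of the form
    at \<open>s = 0\<close>, \<open>1\<close> and \<open>\<i>\<close>.\<close>
  have b: "b = cnj a"
    using real[of 0] real[of 1] real[of \<i>] by (simp add: complex_eq_iff)
  have "a = 0"
  proof (rule ccontr)
    assume "a \<noteq> 0"
    \<comment> \<open>Chosen so that the form takes the value \<open>-1\<close> at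
      \<open>s = - \<tau> * cnj a\<close>, contradicting semi-positivity.\<close>
    define \<tau> where "\<tau> = (Re d + 1) / (2 * (cmod a)\<^sup>2)"
    have "Re (- of_real \<tau> * cnj a * a + cnj (- of_real \<tau> * cnj a) * b + d) = Re d - 2 * \<tau> * (cmod a)\<^sup>2"
      unfolding b by (simp add: cmod_power2) (simp add: power2_eq_square algebra_simps)
    also have "\<dots> = -1"
      using \<open>a \<noteq> 0\<close> by (simp add: \<tau>_def field_simps)
    finally show False using pos[of "- of_real \<tau> * cnj a"] by simp
  qed
  then show ?thesis by (simp add: a_def)
qed (use zero in simp)

section \<open>Local constancy of the norm of flat frames\<close>

lemma has_laplacian_isCont:
  assumes "has_laplacian u l z"
  shows "isCont u z"
  using assms unfolding has_laplacian_def
  by (elim exE conjE) (drule eventually_nhds_x_imp_x, erule has_derivative_continuous)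

lemma cdiff_at_complex_line:
  assumes "cdiff_at f (z0 + \<zeta> *s V)"
  shows "(\<lambda>\<xi>. f (z0 + \<xi> *s V)) field_differentiable (at \<zeta>)"
proof -
  obtain D where D: "(f has_derivative D) (at (z0 + \<zeta> *s V))" "\<And>c v. D (c *s v) = c * D v"
    using assms by (rule cdiff_atE) blast
  have "((\<lambda>\<xi>. z0 + \<xi> *s V) has_derivative (\<lambda>h. h *s V)) (at \<zeta>)"
    using has_derivative_add[OF has_derivative_const[of z0] bounded_linear_imp_has_derivative,
        of "\<lambda>h. h *s V" "at \<zeta>"] linear_smult_vec_left[of V]
    by (simp add: linear_conv_bounded_linear)
  from has_derivative_compose[OF this D(1)]
  have "((\<lambda>\<xi>. f (z0 + \<xi> *s V)) has_derivative (\<lambda>h. D V * h)) (at \<zeta>)"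
    by (simp add: D(2) mult.commute)
  then show ?thesis
    unfolding field_differentiable_def has_field_derivative_def by blast
qed

lemma continuous_complex_line: "continuous_on S (\<lambda>\<xi>. z0 + \<xi> *s (V :: complex^'n::finite))"
proof -
  have "bounded_linear (\<lambda>\<xi>. \<xi> *s V)"
    using linear_smult_vec_left[of V] by (simp add: linear_conv_bounded_linear)
  then show ?thesis
    by (intro continuous_intros linear_continuous_on)
qed

lemma norm_smult_vec: "norm (c *s (v :: complex^'n::finite)) = cmod c * norm v"
  by (simp add: norm_vec_def norm_mult L2_set_right_distrib)

text \<open>The unitary flat structure enters only through \<open>G\<close>, the square norm of its
  frames: near each point of \<open>Y\<close> this function is a local weight times the squared
  modulus of a holomorphic function without zeros.\<close>

locale flat_metric = csub_bundle X A Y L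
  for X :: "'a topology" and A :: "('a, 'n::finite) chart set" and Y :: "'a set"
    and L :: "('a, 'e) line_bundle" +
  fixes h :: "'e \<Rightarrow> 'e \<Rightarrow> complex" and r :: nat and G :: "'a \<Rightarrow> real"
  assumes submanifold: "complex_submanifold X A Y"
    and compact: "compactin X Y"
    and metric: "hermitian_metric L h"
    and r: "r \<ge> 2" and metric_class: "metric_of_class A L r h"
    and semipositive: "semipositive_curvature A L h"
    and flat_norm: "\<And>y t. y \<in> Y \<Longrightarrow> t \<in> bundle_trivs L \<Longrightarrow> y \<in> fst t \<Longrightarrow>
      \<exists>N F. openin X N \<and> y \<in> N \<and> N \<subseteq> fst t \<and> (\<forall>p\<in>N. holo_at A F p \<and> F p \<noteq> 0) \<and>
        (\<forall>p\<in>N \<inter> Y. G p = weight L h t p * (cmod (F p))\<^sup>2)"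
begin

definition adapted :: "'a set \<Rightarrow> ('a \<Rightarrow> complex^'n) \<Rightarrow> 'n set \<Rightarrow> bool" where
  "adapted W \<phi> I \<longleftrightarrow> (W, \<phi>) \<in> A \<and> \<phi> ` (W \<inter> Y) = {z \<in> \<phi> ` W. \<forall>i\<in>I. z $ i = 0}"

lemma adapted_exists:
  assumes "y \<in> Y"
  obtains W \<phi> I where "adapted W \<phi> I" "y \<in> W"
proof -
  have "\<exists>(W, \<phi>)\<in>A. \<exists>I. y \<in> W \<and> \<phi> ` (W \<inter> Y) = {z \<in> \<phi> ` W. \<forall>i\<in>I. z $ i = 0}"
    using submanifold assms unfolding complex_submanifold_def by blast
  then show thesis using that unfolding adapted_def by blast
qed

lemma adaptedD:
  assumes "adapted W \<phi> I"
  shows "(W, \<phi>) \<in> A"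
    and "z \<in> \<phi> ` W \<Longrightarrow> \<forall>i\<in>I. z $ i = 0 \<Longrightarrow> inv_into W \<phi> z \<in> Y"
    and "p \<in> W \<Longrightarrow> p \<in> Y \<Longrightarrow> \<forall>i\<in>I. \<phi> p $ i = 0"
proof -
  show c: "(W, \<phi>) \<in> A" using assms by (simp add: adapted_def)
  have eq: "\<phi> ` (W \<inter> Y) = {z \<in> \<phi> ` W. \<forall>i\<in>I. z $ i = 0}" using assms by (simp add: adapted_def)
  show "\<forall>i\<in>I. \<phi> p $ i = 0" if "p \<in> W" "p \<in> Y" using eq that by blast
  assume "z \<in> \<phi> ` W" "\<forall>i\<in>I. z $ i = 0"
  then obtain p where "p \<in> W \<inter> Y" "z = \<phi> p" using eq by blast
  then show "inv_into W \<phi> z \<in> Y" using chart_inverse[OF c] by simp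
qed

text \<open>In the usual notation \<open>exp (- \<phi>)\<close> for the weight of a metric this is
  the exponent \<open>- \<phi>\<close> in a chart; semi-positive curvature makes it superharmonic on
  complex lines.\<close>

definition lw :: "'a set \<times> ('e \<Rightarrow> complex) \<Rightarrow> 'a set \<Rightarrow> ('a \<Rightarrow> complex^'n) \<Rightarrow> complex^'n \<Rightarrow> real" where
  "lw t W \<phi> z = ln (weight L h t (inv_into W \<phi> z))"

lemma weight_pos: "t \<in> bundle_trivs L \<Longrightarrow> p \<in> fst t \<Longrightarrow> weight L h t p > 0"
  using metric unfolding hermitian_metric_def by blast

lemma lw_C2:
  assumes t: "t \<in> bundle_trivs L" and c: "(W, \<phi>) \<in> A"
  shows "open (\<phi> ` (fst t \<inter> W))" "C2_on (\<phi> ` (fst t \<inter> W)) (lw t W \<phi>)"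
proof -
  show op: "open (\<phi> ` (fst t \<inter> W))" by (rule open_chart_image[OF c htriv_open[OF htrivI[OF t]]])
  have "Cr_on r (\<phi> ` (fst t \<inter> W)) (\<lambda>z. weight L h t (inv_into W \<phi> z))"
    using metric_class t c unfolding metric_of_class_def by blast
  then show "C2_on (\<phi> ` (fst t \<inter> W)) (lw t W \<phi>)"
    unfolding lw_def using chart_inverse[OF c] weight_pos[OF t]
    by (intro C2_on_ln[OF op _ r]) auto
qed

lemma curvature_eq:
  assumes "(W, \<phi>) \<in> A" "x \<in> W"
  shows "chern_curvature L h t (W, \<phi>) x $ i $ j = - wirtinger i (wirtinger_bar j (\<lambda>z. of_real (lw t W \<phi> z))) (\<phi> x)"
  by (simp add: chern_curvature_def lw_def)

lemma curvature_semipositive: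
  assumes "t \<in> bundle_trivs L" "(W, \<phi>) \<in> A" "x \<in> fst t" "x \<in> W"
  shows "(\<Sum>i\<in>UNIV. \<Sum>j\<in>UNIV. chern_curvature L h t (W, \<phi>) x $ i $ j * (v $ i) * cnj (v $ j)) \<in> \<real> \<and>
    Re (\<Sum>i\<in>UNIV. \<Sum>j\<in>UNIV. chern_curvature L h t (W, \<phi>) x $ i $ j * (v $ i) * cnj (v $ j)) \<ge> 0"
proof -
  have "x \<in> fst t \<inter> fst (W, \<phi>)" using assms by simp
  then show ?thesis
    using semipositive assms(1,2) unfolding semipositive_curvature_def Let_def by blast
qed

text \<open>The link between curvature and the maximum principle: up to the factor
  \<open>-1/4\<close> the curvature in the direction \<open>v\<close> is the Laplacian of
  \<open>lw\<close> along the complex line in that direction.\<close>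

lemma Re_curvature:
  assumes "t \<in> bundle_trivs L" "(W, \<phi>) \<in> A" "x \<in> fst t" "x \<in> W"
  shows "Re (\<Sum>i\<in>UNIV. \<Sum>j\<in>UNIV. chern_curvature L h t (W, \<phi>) x $ i $ j * (v $ i) * cnj (v $ j)) =
    - (hess (lw t W \<phi>) (\<phi> x) v v + hess (lw t W \<phi>) (\<phi> x) (\<i> *s v) (\<i> *s v)) / 4"
proof -
  have x: "\<phi> x \<in> \<phi> ` (fst t \<inter> W)" using assms by blast
  have "(\<Sum>i\<in>UNIV. \<Sum>j\<in>UNIV. chern_curvature L h t (W, \<phi>) x $ i $ j * (v $ i) * cnj (v $ j)) =
      - (\<Sum>i\<in>UNIV. \<Sum>j\<in>UNIV. wirtinger i (wirtinger_bar j (\<lambda>z. of_real (lw t W \<phi> z))) (\<phi> x) * (v $ i) * cnj (v $ j))"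
    by (simp add: curvature_eq[OF assms(2,4)] sum_negf)
  then have "Re (\<Sum>i\<in>UNIV. \<Sum>j\<in>UNIV. chern_curvature L h t (W, \<phi>) x $ i $ j * (v $ i) * cnj (v $ j)) =
      - Re (\<Sum>i\<in>UNIV. \<Sum>j\<in>UNIV. wirtinger i (wirtinger_bar j (\<lambda>z. of_real (lw t W \<phi> z))) (\<phi> x) * (v $ i) * cnj (v $ j))"
    by (simp only: uminus_complex.sel)
  then show ?thesis
    unfolding levi_form_eq_laplacian[OF lw_C2[OF assms(1,2)] x] minus_divide_left .
qed

section \<open>The norm of flat frames on complex lines in the submanifold\<close>

definition flat_nbhd :: "'a set \<times> ('e \<Rightarrow> complex) \<Rightarrow> 'a set \<Rightarrow> ('a \<Rightarrow> complex) \<Rightarrow> bool" where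
  "flat_nbhd t N F \<longleftrightarrow> t \<in> bundle_trivs L \<and> openin X N \<and> N \<subseteq> fst t \<and>
     (\<forall>p\<in>N. holo_at A F p \<and> F p \<noteq> 0) \<and> (\<forall>p\<in>N \<inter> Y. G p = weight L h t p * (cmod (F p))\<^sup>2)"

lemma flat_nbhd_exists:
  assumes "y \<in> Y" "t \<in> bundle_trivs L" "y \<in> fst t"
  obtains N F where "flat_nbhd t N F" "y \<in> N"
  using flat_norm[OF assms] assms(2) unfolding flat_nbhd_def by blast

lemma G_pos:
  assumes "y \<in> Y"
  shows "G y > 0"
proof -
  obtain t where t: "t \<in> bundle_trivs L" "y \<in> fst t"
    using assms Y_subset bundle_triv_exists by blast
  obtain N F where "flat_nbhd t N F" "y \<in> N" using flat_nbhd_exists[OF assms t] .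
  then show ?thesis
    using weight_pos[OF t] assms by (auto simp: flat_nbhd_def)
qed

lemma ln_G:
  assumes a: "adapted W \<phi> I" and n: "flat_nbhd t N F"
    and z: "z \<in> \<phi> ` (N \<inter> W)" "\<forall>i\<in>I. z $ i = 0"
  shows "ln (G (inv_into W \<phi> z)) = lw t W \<phi> z + ln ((cmod (F (inv_into W \<phi> z)))\<^sup>2)"
proof -
  have p: "inv_into W \<phi> z \<in> N" "inv_into W \<phi> z \<in> Y"
    using z adaptedD[OF a] chart_inverse[of W \<phi>] by auto
  then have "weight L h t (inv_into W \<phi> z) > 0" "F (inv_into W \<phi> z) \<noteq> 0"
    "G (inv_into W \<phi> z) = weight L h t (inv_into W \<phi> z) * (cmod (F (inv_into W \<phi> z)))\<^sup>2"
    using n weight_pos[of t "inv_into W \<phi> z"] by (auto simp: flat_nbhd_def)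
  then show ?thesis by (simp add: ln_mult lw_def)
qed

text \<open>In an adapted chart the line lies in the coordinate plane of \<open>Y\<close>. There
  \<open>ln G\<close> and \<open>lw\<close> differ by the logarithm of the squared modulus of a
  holomorphic function without zeros, which is harmonic.\<close>

lemma ln_G_laplacian:
  assumes a: "adapted W \<phi> I" and n: "flat_nbhd t N F"
    and z0: "\<forall>i\<in>I. z0 $ i = 0" and V: "\<forall>i\<in>I. V $ i = 0" and \<zeta>: "z0 + \<zeta> *s V \<in> \<phi> ` (N \<inter> W)"
  shows "has_laplacian (\<lambda>\<xi>. ln (G (inv_into W \<phi> (z0 + \<xi> *s V))))
    (hess (lw t W \<phi>) (z0 + \<zeta> *s V) V V + hess (lw t W \<phi>) (z0 + \<zeta> *s V) (\<i> *s V) (\<i> *s V)) \<zeta>"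
proof -
  have c: "(W, \<phi>) \<in> A" using adaptedD[OF a] by blast
  have t: "t \<in> bundle_trivs L" "openin X N" "N \<subseteq> fst t" and F: "\<forall>p\<in>N. holo_at A F p \<and> F p \<noteq> 0"
    using n by (auto simp: flat_nbhd_def)
  have op: "open (\<phi> ` (N \<inter> W))" by (rule open_chart_image[OF c t(2)])
  have C2: "C2_on (\<phi> ` (N \<inter> W)) (lw t W \<phi>)"
    by (rule C2_on_subset[OF lw_C2(2)[OF t(1) c]]) (use t(3) in auto)
  define M where "M = (\<lambda>\<xi>. z0 + \<xi> *s V) -` (\<phi> ` (N \<inter> W))"
  have M: "open M" "\<zeta> \<in> M"
    unfolding M_def using open_vimage[OF op continuous_complex_line] \<zeta> by auto
  have "(\<lambda>\<xi>. F (inv_into W \<phi> (z0 + \<xi> *s V))) holomorphic_on M"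
    unfolding holomorphic_on_def
  proof
    fix \<xi> assume "\<xi> \<in> M"
    then obtain p where p: "p \<in> N" "p \<in> W" "z0 + \<xi> *s V = \<phi> p" unfolding M_def by blast
    have "cdiff_at (\<lambda>z. F (inv_into W \<phi> z)) (z0 + \<xi> *s V)"
      unfolding p(3) using F p(1) by (intro holo_atD[OF _ c p(2)]) auto
    then show "(\<lambda>\<xi>. F (inv_into W \<phi> (z0 + \<xi> *s V))) field_differentiable at \<xi> within M"
      by (rule field_differentiable_at_within[OF cdiff_at_complex_line])
  qed
  moreover have "F (inv_into W \<phi> (z0 + \<zeta> *s V)) \<noteq> 0"
    using \<zeta> F chart_inverse[OF c] by auto
  ultimately have "has_laplacian (\<lambda>\<xi>. ln ((cmod (F (inv_into W \<phi> (z0 + \<xi> *s V))))\<^sup>2)) 0 \<zeta>"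
    by (rule has_laplacian_ln_norm[OF _ M])
  from has_laplacian_add[OF has_laplacian_hess[OF op C2 \<zeta>] this]
  have "has_laplacian (\<lambda>\<xi>. lw t W \<phi> (z0 + \<xi> *s V) + ln ((cmod (F (inv_into W \<phi> (z0 + \<xi> *s V))))\<^sup>2))
    (hess (lw t W \<phi>) (z0 + \<zeta> *s V) V V + hess (lw t W \<phi>) (z0 + \<zeta> *s V) (\<i> *s V) (\<i> *s V)) \<zeta>"
    by simp
  then show ?thesis
  proof (rule has_laplacian_cong[OF _ M])
    fix \<xi> assume "\<xi> \<in> M"
    then show "lw t W \<phi> (z0 + \<xi> *s V) + ln ((cmod (F (inv_into W \<phi> (z0 + \<xi> *s V))))\<^sup>2) =
        ln (G (inv_into W \<phi> (z0 + \<xi> *s V)))"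
      using z0 V by (intro ln_G[OF a n, symmetric]) (auto simp: M_def)
  qed
qed

lemma ln_G_superharmonic:
  assumes a: "adapted W \<phi> I" and n: "flat_nbhd t N F"
    and z0: "\<forall>i\<in>I. z0 $ i = 0" and V: "\<forall>i\<in>I. V $ i = 0" and \<zeta>: "z0 + \<zeta> *s V \<in> \<phi> ` (N \<inter> W)"
  shows "\<exists>l\<ge>0. has_laplacian (\<lambda>\<xi>. - ln (G (inv_into W \<phi> (z0 + \<xi> *s V)))) l \<zeta>"
proof -
  obtain x where x: "x \<in> N" "x \<in> W" "z0 + \<zeta> *s V = \<phi> x" using \<zeta> by blast
  have t: "t \<in> bundle_trivs L" "x \<in> fst t" using n x by (auto simp: flat_nbhd_def)
  note c = adaptedD(1)[OF a]
  have "hess (lw t W \<phi>) (\<phi> x) V V + hess (lw t W \<phi>) (\<phi> x) (\<i> *s V) (\<i> *s V) \<le> 0"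
    using curvature_semipositive[OF t(1) c t(2) x(2), of V] Re_curvature[OF t(1) c t(2) x(2), of V]
    by simp
  with has_laplacian_cmult[OF ln_G_laplacian[OF assms], of "-1"] show ?thesis
    unfolding x(3) by (intro exI conjI) auto
qed

lemma plane_line_in_ball:
  fixes z z0 :: "complex^'n"
  assumes "z \<in> ball z0 \<rho>" "z \<noteq> z0" "\<xi> \<in> ball 0 (\<rho> / norm (z - z0))"
  shows "z0 + \<xi> *s (z - z0) \<in> ball z0 \<rho>"
proof -
  have "norm (\<xi> *s (z - z0)) < \<rho>"
    unfolding norm_smult_vec using assms by (simp add: field_simps)
  then show ?thesis by (simp add: dist_norm norm_minus_commute)
qed

text \<open>Each point of the plane of \<open>Y\<close> in the ball is joined to
  \<open>\<phi> y\<close> by a complex line in that plane. On its intersection with the ball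
  \<open>- ln G\<close> is subharmonic with its maximum at the centre, so the strong maximum
  principle in one variable is enough.\<close>

lemma constant_near_local_min:
  assumes a: "adapted W \<phi> I" and n: "flat_nbhd t N F" and y: "y \<in> Y" "y \<in> W"
    and ball: "ball (\<phi> y) \<rho> \<subseteq> \<phi> ` (N \<inter> W)"
    and min: "\<And>z. z \<in> ball (\<phi> y) \<rho> \<Longrightarrow> \<forall>i\<in>I. z $ i = 0 \<Longrightarrow> G y \<le> G (inv_into W \<phi> z)"
    and z: "z \<in> ball (\<phi> y) \<rho>" "\<forall>i\<in>I. z $ i = 0"
  shows "G (inv_into W \<phi> z) = G y"
proof (cases "z = \<phi> y")
  case True
  then show ?thesis using chart_inverse[OF adaptedD(1)[OF a] y(2)] by simp
next
  case False
  define V where "V = z - \<phi> y"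
  \<comment> \<open>The radius of the disc of parameters whose points lie in the ball. The point
    \<open>z\<close> has the parameter 1, which belongs to the disc because
    \<open>norm V < \<rho>\<close>.\<close>
  define R where "R = \<rho> / norm V"
  have V: "\<forall>i\<in>I. V $ i = 0" and y0: "\<forall>i\<in>I. \<phi> y $ i = 0"
    using adaptedD(3)[OF a y(2,1)] z(2) by (auto simp: V_def)
  have inb: "\<phi> y + \<xi> *s V \<in> ball (\<phi> y) \<rho>" if "\<xi> \<in> ball 0 R" for \<xi>
    using plane_line_in_ball[OF z(1) False] that by (simp add: V_def R_def)
  have plane: "\<forall>i\<in>I. (\<phi> y + \<xi> *s V) $ i = 0" for \<xi>
    using V y0 by simp
  define u where "u \<xi> = - ln (G (inv_into W \<phi> (\<phi> y + \<xi> *s V)))" for \<xi>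
  have lap: "\<exists>l\<ge>0. has_laplacian u l \<xi>" if "\<xi> \<in> ball 0 R" for \<xi>
    unfolding u_def using inb[OF that] ball by (intro ln_G_superharmonic[OF a n y0 V]) auto
  have inY: "inv_into W \<phi> (\<phi> y + \<xi> *s V) \<in> Y" if "\<xi> \<in> ball 0 R" for \<xi>
    using inb[OF that] ball by (intro adaptedD(2)[OF a _ plane]) auto
  have u0: "u 0 = - ln (G y)"
    using chart_inverse[OF adaptedD(1)[OF a] y(2)] by (simp add: u_def)
  have one: "(1::complex) \<in> ball 0 R"
    using z False by (simp add: R_def V_def dist_norm norm_minus_commute pos_less_divide_eq)
  have "u 1 = u 0"
  proof (rule strong_maximum_principle[OF _ lap _ one])
    show "continuous_on (ball 0 R) u"
      using lap has_laplacian_isCont by (blast intro: continuous_at_imp_continuous_on)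
    show "u \<xi> \<le> u 0" if "\<xi> \<in> ball 0 R" for \<xi>
      unfolding u0 unfolding u_def
      using min[OF inb[OF that] plane] G_pos[OF y(1)] G_pos[OF inY[OF that]] by simp
  qed
  then have "ln (G z') = ln (G y)" if "z' = inv_into W \<phi> z" for z'
    unfolding u0 using that by (simp add: u_def V_def)
  then show ?thesis
    using G_pos[OF y(1)] G_pos[OF inY[OF one]] by (simp add: V_def)
qed

text \<open>In a chart \<open>G\<close> is the restriction to \<open>Y\<close> of a continuous
  function, the exponential of \<open>lw\<close> times a squared modulus. Continuity is needed for a
  minimum on a compact set to exist.\<close>

lemma G_continuous: "continuous_map T euclideanreal G"
  unfolding continuous_map_def
proof (intro conjI allI impI)
  fix Q :: "real set" assume "openin euclidean Q"
  then have Q: "open Q" by simp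
  show "openin T {x \<in> topspace T. G x \<in> Q}"
    unfolding topspace_T
  proof (subst openin_subopen, intro ballI)
    fix y assume "y \<in> {x \<in> Y. G x \<in> Q}"
    then have y: "y \<in> Y" "G y \<in> Q" by auto
    obtain W \<phi> I where a: "adapted W \<phi> I" and yW: "y \<in> W" using adapted_exists[OF y(1)] .
    obtain t where t: "t \<in> bundle_trivs L" "y \<in> fst t"
      using y Y_subset bundle_triv_exists by blast
    obtain N F where n: "flat_nbhd t N F" and yN: "y \<in> N" using flat_nbhd_exists[OF y(1) t] .
    note c = adaptedD(1)[OF a]
    have N: "openin X N" "N \<subseteq> fst t" and F: "\<forall>p\<in>N. holo_at A F p \<and> F p \<noteq> 0"
      and GN: "\<forall>p\<in>N \<inter> Y. G p = weight L h t p * (cmod (F p))\<^sup>2"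
      using n by (auto simp: flat_nbhd_def)
    note nb = chart_nbhd[OF c yW N(1) yN]
    define g where "g z = exp (lw t W \<phi> z) * (cmod (F (inv_into W \<phi> z)))\<^sup>2" for z
    have Gg: "G p = g (\<phi> p)" if "p \<in> N" "p \<in> W" "p \<in> Y" for p
      using GN that chart_inverse[OF c that(2)] weight_pos[OF t(1)] N(2) by (auto simp: g_def lw_def)
    have "isCont (lw t W \<phi>) z" if "z \<in> \<phi> ` (N \<inter> W)" for z
      using C2_onD(1)[OF lw_C2(2)[OF t(1) c]] N(2) that by (blast intro: has_derivative_continuous)
    moreover have "isCont (\<lambda>z. F (inv_into W \<phi> z)) z" if "z \<in> \<phi> ` (N \<inter> W)" for z
      using that F c by (auto intro!: cdiff_at_continuous holo_atD)
    ultimately have "continuous_on (\<phi> ` (N \<inter> W)) g"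
      unfolding g_def by (intro continuous_at_imp_continuous_on ballI continuous_intros) auto
    then have op: "open (\<phi> ` (N \<inter> W) \<inter> g -` Q)"
      by (intro continuous_open_preimage nb(1) Q)
    define M where "M = {x \<in> W. \<phi> x \<in> \<phi> ` (N \<inter> W) \<inter> g -` Q}"
    have "openin X M" unfolding M_def by (rule openin_chart_preimage[OF c op])
    then have "openin T (M \<inter> Y)" by (rule openin_T_Int)
    moreover have "y \<in> M \<inter> Y" using y yW yN Gg by (auto simp: M_def)
    moreover have "M \<inter> Y \<subseteq> {x \<in> Y. G x \<in> Q}"
    proof
      fix x assume x: "x \<in> M \<inter> Y"
      then obtain x' where x': "x' \<in> N \<inter> W" "\<phi> x = \<phi> x'" unfolding M_def by blast
      have "x = x'" using x x' chartD(3)[OF c] by (auto simp: M_def dest: inj_onD)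
      then show "x \<in> {x \<in> Y. G x \<in> Q}" using x x' Gg[of x] by (auto simp: M_def)
    qed
    ultimately show "\<exists>M. openin T M \<and> y \<in> M \<and> M \<subseteq> {x \<in> Y. G x \<in> Q}" by blast
  qed
qed auto

text \<open>Formed with open sets of \<open>X\<close> instead of \<open>Y\<close>, so that its image
  in a chart is open in \<open>complex^'n\<close>; the condition concerns only the points of
  \<open>Y\<close>.\<close>

definition const_region :: "'a set" where
  "const_region = \<Union>{N. openin X N \<and> (\<exists>c. \<forall>p\<in>N \<inter> Y. G p = c)}"

lemma const_region_open: "openin X const_region"
  unfolding const_region_def by blast

lemma const_regionE:
  assumes "y \<in> const_region" "y \<in> Y"
  obtains N where "openin X N" "y \<in> N" "\<forall>p\<in>N \<inter> Y. G p = G y"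
proof -
  obtain N c where "openin X N" "y \<in> N" "\<forall>p\<in>N \<inter> Y. G p = c"
    using assms(1) unfolding const_region_def by blast
  then show thesis using assms(2) by (intro that[of N]) auto
qed

text \<open>The witness is the first point outside \<open>const_region\<close> on the segment from \<open>z\<close> to \<open>\<phi> y\<close>.  It follows
  that a minimum point of \<open>G\<close> on the closed set \<open>Y - const_region\<close> is a local minimum of \<open>G\<close> on \<open>Y\<close>.\<close>

lemma segment_to_boundary:
  assumes a: "adapted W \<phi> I" and n: "flat_nbhd t N F" and y: "y \<in> Y" "y \<in> W" "y \<notin> const_region"
    and ball: "ball (\<phi> y) \<rho> \<subseteq> \<phi> ` (N \<inter> W)"
    and z: "z \<in> ball (\<phi> y) \<rho>" "\<forall>i\<in>I. z $ i = 0"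
  shows "\<exists>q\<in>Y - const_region. G (inv_into W \<phi> z) = G q"
proof (cases "inv_into W \<phi> z \<in> const_region")
  case False
  then show ?thesis using adaptedD(2)[OF a _ z(2)] z(1) ball by blast
next
  case zin: True
  define V where "V = \<phi> y - z"
  have V: "\<forall>i\<in>I. V $ i = 0"
    using adaptedD(3)[OF a y(2,1)] z(2) by (simp add: V_def)
  note c = adaptedD(1)[OF a]
  define line where "line s = z + complex_of_real s *s V" for s
  have line_in: "line s \<in> ball (\<phi> y) \<rho>" if "s \<in> {0..1}" for s
  proof -
    have "line s = (1 - s) *\<^sub>R z + s *\<^sub>R \<phi> y"
      by (simp add: line_def V_def vec_eq_iff complex_eq_iff algebra_simps)
    moreover have "\<phi> y \<in> ball (\<phi> y) \<rho>" using z(1) by (simp add: dist_norm) (metis norm_ge_zero order_le_less_trans)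
    ultimately show ?thesis
      using convexD_alt[OF convex_ball z(1), of "\<phi> y" s] that by simp
  qed
  have line_plane: "\<forall>i\<in>I. line s $ i = 0" for s
    using V z(2) by (simp add: line_def)
  have line_W: "line s \<in> \<phi> ` (N \<inter> W)" if "s \<in> {0..1}" for s
    using line_in[OF that] ball by blast
  have line_Y: "inv_into W \<phi> (line s) \<in> Y" if "s \<in> {0..1}" for s
    using line_W[OF that] by (intro adaptedD(2)[OF a _ line_plane]) auto
  have cont_line: "continuous_on S line" for S
    unfolding line_def by (rule continuous_on_compose2[OF continuous_complex_line[of UNIV z V]]) (auto intro!: continuous_intros)
  have opR: "open (\<phi> ` (const_region \<inter> W))" by (rule open_chart_image[OF c const_region_open])
  have region_iff: "inv_into W \<phi> (line s) \<in> const_region \<longleftrightarrow> line s \<in> \<phi> ` (const_region \<inter> W)" if s: "s \<in> {0..1}" for s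
  proof -
    obtain p where p: "p \<in> W" "line s = \<phi> p" using line_W[OF s] by blast
    have "\<phi> p \<in> \<phi> ` (const_region \<inter> W) \<longleftrightarrow> p \<in> const_region"
      using inj_on_image_mem_iff[OF chartD(3)[OF c] p(1), of "const_region \<inter> W"] p(1) by simp
    then show ?thesis using chart_inverse[OF c p(1)] by (simp only: p(2))
  qed
  \<comment> \<open>The parameters at which the segment is outside the region. They form a compact
    set, since the region is open, and it contains 1, since \<open>y\<close> is outside; hence there
    is a first such parameter \<open>s0\<close>.\<close>
  define Z where "Z = {s \<in> {0..1}. line s \<notin> \<phi> ` (const_region \<inter> W)}"
  have "Z = {0..1} \<inter> line -` (- \<phi> ` (const_region \<inter> W))" by (auto simp: Z_def)
  then have "closed Z"
    using continuous_closed_preimage[OF cont_line closed_atLeastAtMost closed_Compl[OF opR]] by simp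
  then have "compact ({0..1} \<inter> Z)"
    by (rule compact_Int_closed[OF compact_Icc])
  moreover have "{0..1} \<inter> Z = Z" by (auto simp: Z_def)
  ultimately have "compact Z" by simp
  moreover have line1: "inv_into W \<phi> (line 1) = y" and line0: "line 0 = z"
    using chart_inverse[OF c y(2)] by (simp_all add: line_def V_def)
  have "1 \<in> Z" using region_iff[of 1] line1 y(3) by (simp add: Z_def)
  ultimately obtain s0 where s0: "s0 \<in> Z" "\<And>s. s \<in> Z \<Longrightarrow> s0 \<le> s"
    using compact_attains_inf[of Z] by blast
  have s01: "s0 \<in> {0..1}" "line s0 \<notin> \<phi> ` (const_region \<inter> W)" using s0(1) by (auto simp: Z_def)
  have "s0 \<noteq> 0" using s01(2) zin region_iff[of 0] line0 by auto
  then have pos: "0 < s0" using s01 by simp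
  define k where "k s = ln (G (inv_into W \<phi> (line s)))" for s
  \<comment> \<open>Before \<open>s0\<close> the segment runs inside the region, where
    \<open>k\<close> is locally constant and has derivative 0; continuity extends the equality to
    \<open>s0\<close> itself.\<close>
  have "k s0 = k 0"
  proof (rule DERIV_isconst_end[OF pos])
    show "continuous_on {0..s0} k"
    proof -
      have "isCont (\<lambda>\<xi>. ln (G (inv_into W \<phi> (z + \<xi> *s V)))) (of_real s)" if "s \<in> {0..s0}" for s
        using line_W[of s] that s01(1)
        by (intro has_laplacian_isCont[OF ln_G_laplacian[OF a n z(2) V]]) (auto simp: line_def)
      then have "continuous_on (of_real ` {0..s0}) (\<lambda>\<xi>. ln (G (inv_into W \<phi> (z + \<xi> *s V))))"
        by (auto intro: continuous_at_imp_continuous_on)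
      from continuous_on_compose2[OF this, of "{0..s0}" complex_of_real] show ?thesis
        unfolding k_def line_def by (auto intro!: continuous_intros)
    qed
    fix s assume s: "0 < s" "s < s0"
    then have sI: "s \<in> {0..1}" using s01 by simp
    have "s \<notin> Z" using s0(2)[of s] s by auto
    then have "inv_into W \<phi> (line s) \<in> const_region" using region_iff[OF sI] sI by (auto simp: Z_def)
    then obtain M where M: "openin X M" "inv_into W \<phi> (line s) \<in> M"
      "\<forall>p\<in>M \<inter> Y. G p = G (inv_into W \<phi> (line s))"
      using line_Y[OF sI] by (rule const_regionE)
    have opM: "open (\<phi> ` (M \<inter> W))" by (rule open_chart_image[OF c M(1)])
    have "open ({0<..<s0} \<inter> line -` (\<phi> ` (M \<inter> W)))"
      by (rule continuous_open_preimage[OF cont_line open_greaterThanLessThan opM])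
    moreover have "s \<in> {0<..<s0} \<inter> line -` (\<phi> ` (M \<inter> W))"
    proof -
      obtain p where p: "p \<in> W" "line s = \<phi> p" using line_W[OF sI] by blast
      then have "p \<in> M" using M(2) chart_inverse[OF c p(1)] by simp
      then show ?thesis using s p by auto
    qed
    moreover have "k s = k s'" if "s' \<in> {0<..<s0} \<inter> line -` (\<phi> ` (M \<inter> W))" for s'
    proof -
      have "inv_into W \<phi> (line s') \<in> M" using that chart_inverse[OF c] by auto
      moreover have "inv_into W \<phi> (line s') \<in> Y" using that s01 by (intro line_Y) auto
      ultimately show ?thesis using M(3) by (simp add: k_def)
    qed
    ultimately show "(k has_real_derivative 0) (at s)"
      using has_field_derivative_transform_within_open[OF DERIV_const[of "k s"]] by blast
  qed
  moreover have "inv_into W \<phi> (line s0) \<in> Y - const_region"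
    using line_Y[OF s01(1)] region_iff[OF s01(1)] s01(2) by blast
  moreover have "inv_into W \<phi> z \<in> Y" using line_Y[of 0] line0 by simp
  ultimately show ?thesis
    using G_pos line0 unfolding k_def by (intro bexI[of _ "inv_into W \<phi> (line s0)"]) auto
qed

text \<open>Otherwise \<open>G\<close> has a minimum on the compact set
  \<open>Y - const_region\<close>. Nearby values of \<open>G\<close> on \<open>Y\<close> are also
  attained on that set, so the minimum is local on \<open>Y\<close>; then \<open>G\<close> is
  constant near this point, which therefore belongs to the region. The argument treats all
  components of \<open>Y\<close> at once.\<close>

lemma Y_subset_const_region: "Y \<subseteq> const_region"
proof (rule ccontr)
  assume "\<not> Y \<subseteq> const_region"
  then have ne: "Y - const_region \<noteq> {}" by blast
  have "compact_space T" using compact by (simp add: compact_space_subtopology)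
  have "closedin T (Y - const_region)"
    using openin_T_Int[OF const_region_open] openin_subset
    by (simp add: closedin_def topspace_T) (simp add: double_diff Diff_Diff_Int Int_commute)
  with \<open>compact_space T\<close> have "compactin T (Y - const_region)"
    by (rule closedin_compact_space)
  then have "compactin euclideanreal (G ` (Y - const_region))"
    using image_compactin G_continuous by blast
  then have "compact (G ` (Y - const_region))" by simp
  then obtain y where y: "y \<in> Y - const_region" "\<And>q. q \<in> Y - const_region \<Longrightarrow> G y \<le> G q"
    using compact_attains_inf[of "G ` (Y - const_region)"] ne by auto
  obtain W \<phi> I where a: "adapted W \<phi> I" and yW: "y \<in> W" using adapted_exists y by blast
  note c = adaptedD(1)[OF a]
  obtain t where t: "t \<in> bundle_trivs L" "y \<in> fst t"
    using y Y_subset bundle_triv_exists by blast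
  obtain N F where n: "flat_nbhd t N F" and yN: "y \<in> N" using flat_nbhd_exists[OF _ t] y by blast
  have "openin X N" using n by (simp add: flat_nbhd_def)
  note nb = chart_nbhd[OF c yW this yN]
  obtain \<rho> where \<rho>: "\<rho> > 0" "ball (\<phi> y) \<rho> \<subseteq> \<phi> ` (N \<inter> W)"
    using openE[OF nb(1,2)] by blast
  have min: "G y \<le> G (inv_into W \<phi> z)" if "z \<in> ball (\<phi> y) \<rho>" "\<forall>i\<in>I. z $ i = 0" for z
    using segment_to_boundary[OF a n _ yW _ \<rho>(2) that] y by fastforce
  have const: "G (inv_into W \<phi> z) = G y" if "z \<in> ball (\<phi> y) \<rho>" "\<forall>i\<in>I. z $ i = 0" for z
    using constant_near_local_min[OF a n _ yW \<rho>(2) min that] y by blast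
  have "openin X {x \<in> W. \<phi> x \<in> ball (\<phi> y) \<rho>}" by (rule openin_chart_preimage[OF c open_ball])
  moreover have "G x = G y" if "x \<in> {x \<in> W. \<phi> x \<in> ball (\<phi> y) \<rho>} \<inter> Y" for x
    using const[of "\<phi> x"] that adaptedD(3)[OF a] chart_inverse[OF c] by auto
  ultimately have "{x \<in> W. \<phi> x \<in> ball (\<phi> y) \<rho>} \<subseteq> const_region"
    unfolding const_region_def by blast
  then show False using y yW \<rho>(1) by auto
qed

end

section \<open>The connection form along the submanifold\<close>

lemma sum_mult_axis:
  fixes f :: "'n::finite \<Rightarrow> complex" and g :: "complex \<Rightarrow> complex"
  assumes "g 0 = 0"
  shows "(\<Sum>k\<in>UNIV. f k * g ((axis i s :: complex^'n) $ k)) = f i * g s"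
proof -
  have "(\<Sum>k\<in>UNIV. f k * g ((axis i s :: complex^'n) $ k)) = (\<Sum>k\<in>UNIV. if k = i then f i * g s else 0)"
    using assms by (intro sum.cong) (auto simp: axis_def)
  then show ?thesis by simp
qed

text \<open>In an adapted chart this is the projection to the coordinate plane of \<open>Y\<close>.
  Composition with it extends functions from \<open>Y\<close> to a neighbourhood, constantly in the
  normal coordinates.\<close>

definition coord_proj :: "'n set \<Rightarrow> complex^'n::finite \<Rightarrow> complex^'n" where
  "coord_proj I z = (\<chi> i. if i \<in> I then 0 else z $ i)"

lemma bounded_linear_coord_proj: "bounded_linear (coord_proj I :: complex^'n::finite \<Rightarrow> complex^'n)"
proof -
  have "linear (coord_proj I :: complex^'n \<Rightarrow> complex^'n)"
    by (rule linearI) (simp_all add: coord_proj_def vec_eq_iff)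
  then show ?thesis by (simp add: linear_conv_bounded_linear)
qed

context flat_metric
begin

lemma flat_nbhd_subset: "flat_nbhd t N F \<Longrightarrow> openin X N' \<Longrightarrow> N' \<subseteq> N \<Longrightarrow> flat_nbhd t N' F"
  unfolding flat_nbhd_def by blast

text \<open>For \<open>i \<notin> I\<close> the vector \<open>axis i 1\<close> is tangent to
  \<open>Y\<close>. The Laplacian of \<open>ln G\<close> along it is zero by local constancy, which
  kills the diagonal curvature coefficient, and semi-positivity then kills its whole row. The index
  \<open>j\<close> is arbitrary, so normal directions are included.\<close>

lemma mixed_derivative_vanishes:
  assumes a: "adapted W \<phi> I" and t: "t \<in> bundle_trivs L" and p: "p \<in> Y" "p \<in> W" "p \<in> fst t" and i: "i \<notin> I"
  shows "wirtinger i (wirtinger_bar j (\<lambda>z. of_real (lw t W \<phi> z))) (\<phi> p) = 0"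
proof -
  note c = adaptedD(1)[OF a]
  obtain N F where n: "flat_nbhd t N F" "p \<in> N" using flat_nbhd_exists[OF p(1) t p(3)] .
  have "p \<in> const_region" using Y_subset_const_region p(1) by blast
  then obtain N' where N': "openin X N'" "p \<in> N'" "\<forall>q\<in>N' \<inter> Y. G q = G p"
    using p(1) by (rule const_regionE)
  define M where "M = N \<inter> N'"
  have M: "flat_nbhd t M F" "p \<in> M"
    unfolding M_def using n N' by (auto intro!: flat_nbhd_subset[OF n(1)] simp: flat_nbhd_def)
  define V where "V = (axis i 1 :: complex^'n)"
  have V: "\<forall>k\<in>I. V $ k = 0" using i by (auto simp: V_def axis_def)
  have p0: "\<forall>k\<in>I. \<phi> p $ k = 0" using adaptedD(3)[OF a p(2,1)] .
  have opM: "open (\<phi> ` (M \<inter> W))" using M(1) by (intro open_chart_image[OF c]) (simp add: flat_nbhd_def)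
  have "\<phi> p \<in> \<phi> ` (M \<inter> W)" using M(2) p(2) by blast
  then have in0: "\<phi> p + 0 *s V \<in> \<phi> ` (M \<inter> W)" by simp
  from ln_G_laplacian[OF a M(1) p0 V in0]
  have lap: "has_laplacian (\<lambda>\<xi>. ln (G (inv_into W \<phi> (\<phi> p + \<xi> *s V))))
      (hess (lw t W \<phi>) (\<phi> p) V V + hess (lw t W \<phi>) (\<phi> p) (\<i> *s V) (\<i> *s V)) 0"
    by simp
  define Z where "Z = (\<lambda>\<xi>. \<phi> p + \<xi> *s V) -` (\<phi> ` (M \<inter> W))"
  have Z: "open Z" "0 \<in> Z"
    unfolding Z_def using open_vimage[OF opM continuous_complex_line] in0 by auto
  \<comment> \<open>The second evaluation of the same Laplacian: near the parameter 0 the line stays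
    in \<open>Y\<close> and in a set where \<open>G\<close> is constant.\<close>
  have "has_laplacian (\<lambda>\<xi>. ln (G (inv_into W \<phi> (\<phi> p + \<xi> *s V)))) 0 0"
  proof (rule has_laplacian_cong[OF has_laplacian_const Z])
    fix \<xi> assume "\<xi> \<in> Z"
    then obtain q where q: "q \<in> M" "q \<in> W" "\<phi> p + \<xi> *s V = \<phi> q" unfolding Z_def by blast
    have "\<forall>k\<in>I. \<phi> q $ k = 0" unfolding q(3)[symmetric] using p0 V by simp
    then have "q \<in> Y" using adaptedD(2)[OF a, of "\<phi> q"] q(2) chart_inverse[OF c q(2)] by simp
    then show "ln (G p) = ln (G (inv_into W \<phi> (\<phi> p + \<xi> *s V)))"
      unfolding q(3) chart_inverse[OF c q(2)] using N'(3) q(1) by (simp add: M_def)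
  qed
  with lap have "hess (lw t W \<phi>) (\<phi> p) V V + hess (lw t W \<phi>) (\<phi> p) (\<i> *s V) (\<i> *s V) = 0"
    by (rule has_laplacian_unique)
  then have Re0: "Re (\<Sum>k\<in>UNIV. \<Sum>l\<in>UNIV. chern_curvature L h t (W, \<phi>) p $ k $ l * (V $ k) * cnj (V $ l)) = 0"
    using Re_curvature[OF t c p(3,2), of V] by simp
  define C where "C = chern_curvature L h t (W, \<phi>) p"
  note semi = curvature_semipositive[OF t c p(3,2), folded C_def]
  have "(\<Sum>k\<in>UNIV. \<Sum>l\<in>UNIV. C $ k $ l * (V $ k) * cnj (V $ l)) = C $ i $ i"
  proof -
    have "(\<Sum>l\<in>UNIV. C $ k $ l * (V $ k) * cnj (V $ l)) = C $ k $ i * (V $ k)" for k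
      using sum_mult_axis[of cnj "\<lambda>l. C $ k $ l * (V $ k)" i 1] by (simp add: V_def)
    then show ?thesis
      using sum_mult_axis[of "\<lambda>x. x" "\<lambda>k. C $ k $ i" i 1] by (simp add: V_def)
  qed
  then have "C $ i $ i \<in> \<real>" "Re (C $ i $ i) = 0"
    using semi[of V] Re0 unfolding C_def by metis+
  then have "C $ i $ i = 0" by (simp add: complex_is_Real_iff complex_eq_iff)
  then have "C $ i $ j = 0" by (rule semipositive_zero_diagonal[OF semi])
  then show ?thesis unfolding C_def curvature_eq[OF c p(2)] by simp
qed

text \<open>The components of the \<open>(1,0)\<close>-form \<open>\<partial> log |e|\<^sup>2\<close> for the local frame \<open>e\<close> of \<open>t\<close>.\<close>

definition conn :: "'a set \<times> ('e \<Rightarrow> complex) \<Rightarrow> ('a, 'n) chart \<Rightarrow> 'a \<Rightarrow> complex^'n" where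
  "conn t = (\<lambda>(W, \<phi>) p. \<chi> j. wirtinger j (\<lambda>z. of_real (lw t W \<phi> z)) (\<phi> p))"

lemma conn_nth: "conn t (W, \<phi>) p $ j = wirtinger j (\<lambda>z. of_real (lw t W \<phi> z)) (\<phi> p)"
  by (simp add: conn_def)

text \<open>On the plane of \<open>Y\<close> the antiholomorphic derivatives of
  \<open>\<partial>_j lw\<close> vanish in the tangent directions. Composition with the projection
  leaves only these directions, so the derivative becomes complex-linear.\<close>

lemma conn_proj_holomorphic:
  assumes a: "adapted W \<phi> I" and t: "t \<in> bundle_trivs L"
    and z: "coord_proj I z \<in> \<phi> ` (fst t \<inter> W)"
  shows "cdiff_at (\<lambda>z. wirtinger j (\<lambda>z. of_real (lw t W \<phi> z)) (coord_proj I z)) z"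
proof -
  note c = adaptedD(1)[OF a]
  define w where "w = coord_proj I z"
  have w: "w \<in> \<phi> ` (fst t \<inter> W)" using z by (simp add: w_def)
  have "\<forall>i\<in>I. w $ i = 0" by (simp add: w_def coord_proj_def)
  then obtain p where p: "p \<in> fst t" "p \<in> W" "w = \<phi> p" "p \<in> Y"
    using w adaptedD(2)[OF a, of w] chart_inverse[OF c] by auto
  obtain D where D: "(wirtinger j (\<lambda>z. of_real (lw t W \<phi> z)) has_derivative D) (at w)"
    using has_derivative_wirtinger[OF lw_C2[OF t c] w] by blast
  have Di: "D (axis i \<i>) = \<i> * D (axis i 1)" if "i \<notin> I" for i
    using wirtinger_derivative_complex_linear[OF lw_C2[OF t c] w D, of i]
      mixed_derivative_vanishes[OF a t p(4,2,1) that] p(3) by simp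
  have "D (coord_proj I v) = (\<Sum>i\<in>UNIV. coord_proj I v $ i * D (axis i 1))" for v
    unfolding linear_axis_decompose[OF has_derivative_linear[OF D], of "coord_proj I v"]
  proof (rule sum.cong)
    fix i
    show "Re (coord_proj I v $ i) *\<^sub>R D (axis i 1) + Im (coord_proj I v $ i) *\<^sub>R D (axis i \<i>) =
        coord_proj I v $ i * D (axis i 1)"
      by (cases "i \<in> I") (auto simp: coord_proj_def Di complex_eq_iff algebra_simps)
  qed simp
  moreover have "coord_proj I (c *s v) $ i = c * coord_proj I v $ i" for c v i
    by (simp add: coord_proj_def)
  ultimately have lin: "D (coord_proj I (c *s v)) = c * D (coord_proj I v)" for c v
    by (simp add: sum_distrib_left mult.assoc)
  have "((\<lambda>z. coord_proj I z) has_derivative coord_proj I) (at z)"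
    by (rule bounded_linear_imp_has_derivative[OF bounded_linear_coord_proj])
  from has_derivative_compose[OF this, of "wirtinger j (\<lambda>z. of_real (lw t W \<phi> z))" D] D
  have "((\<lambda>z. wirtinger j (\<lambda>z. of_real (lw t W \<phi> z)) (coord_proj I z)) has_derivative
      (\<lambda>v. D (coord_proj I v))) (at z)"
    by (simp add: w_def)
  then show ?thesis by (rule cdiff_atI) (rule lin)
qed

lemma conn_section:
  assumes a: "adapted W \<phi> I" and t: "t \<in> bundle_trivs L"
  shows "(\<lambda>p. conn t (W, \<phi>) p $ j) \<in> sections (O_sub X A Y) (fst t \<inter> W \<inter> Y)"
proof (rule O_sub_sectionI)
  note c = adaptedD(1)[OF a]
  show "openin T (fst t \<inter> W \<inter> Y)"
    using htriv_open[OF htrivI[OF t]] chartD(1)[OF c] by (intro openin_T_Int) blast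
  fix y assume y: "y \<in> fst t \<inter> W \<inter> Y"
  \<comment> \<open>The holomorphic extension off \<open>Y\<close>. It agrees with the connection
    coefficient on \<open>Y\<close> because the projection fixes \<open>\<phi> p\<close> for
    \<open>p\<close> in \<open>Y\<close>.\<close>
  define g where "g p = wirtinger j (\<lambda>z. of_real (lw t W \<phi> z)) (coord_proj I (\<phi> p))" for p
  define U where "U = {p \<in> W. \<phi> p \<in> coord_proj I -` (\<phi> ` (fst t \<inter> W))}"
  have "open (coord_proj I -` (\<phi> ` (fst t \<inter> W)))"
    by (rule open_vimage[OF lw_C2(1)[OF t c] linear_continuous_on[OF bounded_linear_coord_proj]])
  then have "openin X U" unfolding U_def by (rule openin_chart_preimage[OF c])
  have proj: "coord_proj I (\<phi> p) = \<phi> p" if "p \<in> W" "p \<in> Y" for p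
    using adaptedD(3)[OF a that] by (simp add: coord_proj_def vec_eq_iff)
  have "holo_at A g x" if x: "x \<in> U" for x
  proof (rule holo_at_chart[OF c])
    show xW: "x \<in> W" using x by (simp add: U_def)
    note n = chart_nbhd[OF c xW chartD(1)[OF c] xW]
    have "cdiff_at (\<lambda>z. wirtinger j (\<lambda>z. of_real (lw t W \<phi> z)) (coord_proj I z)) (\<phi> x)"
      using x by (intro conn_proj_holomorphic[OF a t]) (simp add: U_def)
    then show "cdiff_at (\<lambda>z. g (inv_into W \<phi> z)) (\<phi> x)"
      by (rule cdiff_at_cong[OF _ n(1,2)]) (simp only: g_def n(4))
  qed
  moreover have "y \<in> U" using y proj by (auto simp: U_def)
  moreover have "conn t (W, \<phi>) x $ j = g x" if "x \<in> U \<inter> (fst t \<inter> W \<inter> Y)" for x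
    using that proj[of x] by (simp add: conn_nth g_def)
  ultimately show "\<exists>U g. openin X U \<and> y \<in> U \<and> (\<forall>x\<in>U. holo_at A g x) \<and>
      (\<forall>x\<in>U \<inter> (fst t \<inter> W \<inter> Y). conn t (W, \<phi>) x $ j = g x)"
    using \<open>openin X U\<close> by (intro exI[of _ U] exI[of _ g]) auto
qed

text \<open>The logarithms of the weights of \<open>t'\<close> and \<open>t\<close> differ by
  \<open>ln ((cmod g)\<^sup>2)\<close> with \<open>g\<close> the transition function, and the
  operator \<open>\<partial>\<close> sends this to the logarithmic derivative of
  \<open>g\<close>.\<close>

lemma dlog_transition:
  assumes t: "t \<in> bundle_trivs L" "t' \<in> bundle_trivs L" and c: "(W, \<phi>) \<in> A"
    and p: "p \<in> fst t" "p \<in> fst t'" "p \<in> W"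
  shows "dlog A (transition L t t') p (W, \<phi>) = conn t' (W, \<phi>) p - conn t (W, \<phi>) p"
proof -
  define g where "g z = transition L t t' (inv_into W \<phi> z)" for z
  have sec: "\<forall>x\<in>fst t \<inter> fst t'. holo_at A (transition L t t') x \<and> transition L t t' x \<noteq> 0"
    using transition_section[OF htrivI[OF t(1)] htrivI[OF t(2)]] by (simp add: units_section_iff)
  have gp: "g (\<phi> p) = transition L t t' p" "transition L t t' p \<noteq> 0"
    using chart_inverse[OF c p(3)] sec p by (auto simp: g_def)
  define a where "a = cgrad (W, \<phi>) (transition L t t') p"
  have D: "(g has_derivative (\<lambda>v. \<Sum>i\<in>UNIV. v $ i * a $ i)) (at (\<phi> p))"
    unfolding g_def a_def using sec p by (intro holo_at_has_derivative c) auto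
  define Dg where "Dg v = (\<Sum>i\<in>UNIV. v $ i * a $ i)" for v
  have Dg: "(g has_derivative Dg) (at (\<phi> p))" using D by (simp add: Dg_def[abs_def])
  have Dax: "Dg (axis j s) = a $ j * s" for j s
    using sum_mult_axis[of "\<lambda>x. x" "\<lambda>i. a $ i" j s] by (simp add: Dg_def mult.commute)
  have nz: "(Re (g (\<phi> p)))\<^sup>2 + (Im (g (\<phi> p)))\<^sup>2 \<noteq> 0"
    using gp by (simp add: sum_power2_eq_zero_iff complex_eq_iff)
  have sq: "(Re (g (\<phi> p)))\<^sup>2 + (Im (g (\<phi> p)))\<^sup>2 > 0"
    using nz by (simp add: less_le eq_commute[of 0])
  have "((\<lambda>z. ln ((Re (g z))\<^sup>2 + (Im (g z))\<^sup>2)) has_derivative (\<lambda>v. 2 * Re (Dg v / g (\<phi> p)))) (at (\<phi> p))"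
    by (rule derivative_eq_intros has_derivative_Re[OF Dg] has_derivative_Im[OF Dg] sq refl)+
      (use nz in \<open>auto simp: fun_eq_iff Re_divide' cmod_power2 field_simps\<close>)
  then have Dln: "((\<lambda>z. ln ((cmod (g z))\<^sup>2)) has_derivative (\<lambda>v. 2 * Re (Dg v / g (\<phi> p)))) (at (\<phi> p))"
    by (simp only: cmod_power2)
  have op: "openin X (fst t \<inter> fst t')" using htriv_open htrivI t by blast
  have pt: "p \<in> fst t \<inter> fst t'" using p by blast
  note n = chart_nbhd[OF c p(3) op pt]
  have "\<phi> p \<in> \<phi> ` (fst t \<inter> W)" using p by blast
  note E = C2_onD(1)[OF lw_C2(2)[OF t(1) c] this]
  let ?E = "frechet_derivative (lw t W \<phi>) (at (\<phi> p))"
  from has_derivative_add[OF E Dln]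
  have E': "(lw t' W \<phi> has_derivative (\<lambda>v. ?E v + 2 * Re (Dg v / g (\<phi> p)))) (at (\<phi> p))"
  proof (rule has_derivative_transform_within_open[OF _ n(1,2)])
    fix z assume "z \<in> \<phi> ` (fst t \<inter> fst t' \<inter> W)"
    then have q: "inv_into W \<phi> z \<in> fst t" "inv_into W \<phi> z \<in> fst t'" using n(3)[of z] by auto
    show "lw t W \<phi> z + ln ((cmod (g z))\<^sup>2) = lw t' W \<phi> z"
      using weight_transition[OF metric t q] sec q by (simp add: lw_def g_def ln_mult)
  qed
  have "conn t' (W, \<phi>) p $ j = conn t (W, \<phi>) p $ j + a $ j / g (\<phi> p)" for j
  proof -
    define b where "b = a $ j / g (\<phi> p)"
    have "Dg (axis j s) / g (\<phi> p) = b * s" for s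
      unfolding Dax b_def by simp
    then show ?thesis
      unfolding conn_nth wirtinger_of_real(1)[OF E] wirtinger_of_real(1)[OF E'] b_def[symmetric]
      by (simp add: complex_eq_iff)
  qed
  then show ?thesis
    using c p(3) gp by (simp add: vec_eq_iff dlog_def ext_d_def a_def)
qed

text \<open>The operator \<open>\<partial>\<close> is invariant under holomorphic changes of
  coordinates: the derivative \<open>\<theta>\<close> of the change of charts sends
  \<open>axis k 1\<close> and \<open>axis k \<i>\<close> to \<open>Vk\<close> and
  \<open>\<i> *s Vk\<close>, and \<open>sum_del\<close> expands the complex-linear part at
  \<open>Vk\<close> in coordinates. Thus \<open>conn\<close> follows the rule for covectors although
  it need not be holomorphic on \<open>X\<close>.\<close>

lemma conn_transform:
  assumes t: "t \<in> bundle_trivs L" and c: "(W, \<phi>) \<in> A" "p \<in> W" and d: "(V, \<psi>) \<in> A" "p \<in> V" and p: "p \<in> fst t"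
  shows "conn t (V, \<psi>) p $ k = (\<Sum>i\<in>UNIV. conn t (W, \<phi>) p $ i * cgrad (V, \<psi>) (\<lambda>q. \<phi> q $ i) p $ k)"
proof -
  define \<theta> where "\<theta> v = (\<chi> i. \<Sum>k\<in>UNIV. v $ k * cgrad (V, \<psi>) (\<lambda>q. \<phi> q $ i) p $ k)" for v :: "complex^'n"
  have D\<theta>: "((\<lambda>z. \<phi> (inv_into V \<psi> z)) has_derivative \<theta>) (at (\<psi> p))"
    unfolding \<theta>_def[abs_def] by (intro has_derivative_vec_complex holo_at_has_derivative holo_at_coordinate[OF c] d)
  have ax: "\<theta> (axis k s) = s *s (\<chi> i. cgrad (V, \<psi>) (\<lambda>q. \<phi> q $ i) p $ k)" for s
    using sum_mult_axis[of "\<lambda>x. x" "\<lambda>k. cgrad (V, \<psi>) (\<lambda>q. \<phi> q $ i) p $ k" k s for i]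
    by (simp add: \<theta>_def vec_eq_iff mult.commute)
  define Vk where "Vk = (\<chi> i. cgrad (V, \<psi>) (\<lambda>q. \<phi> q $ i) p $ k)"
  have inv: "inv_into V \<psi> (\<psi> p) = p" using chart_inverse d by blast
  have "\<phi> p \<in> \<phi> ` (fst t \<inter> W)" using p c by blast
  note E = C2_onD(1)[OF lw_C2(2)[OF t c(1)] this]
  let ?E = "frechet_derivative (lw t W \<phi>) (at (\<phi> p))"
  have "((\<lambda>z. lw t W \<phi> (\<phi> (inv_into V \<psi> z))) has_derivative (\<lambda>v. ?E (\<theta> v))) (at (\<psi> p))"
    by (rule has_derivative_compose[OF D\<theta>]) (use E inv in simp)
  then have E': "(lw t V \<psi> has_derivative (\<lambda>v. ?E (\<theta> v))) (at (\<psi> p))"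
  proof (rule has_derivative_transform_within_open)
    show "open (\<psi> ` (W \<inter> V))" "\<psi> p \<in> \<psi> ` (W \<inter> V)"
      using chart_nbhd[OF d chartD(1)[OF c(1)] c(2)] by auto
    show "lw t W \<phi> (\<phi> (inv_into V \<psi> z)) = lw t V \<psi> z" if "z \<in> \<psi> ` (W \<inter> V)" for z
      using chart_change[OF c(1) d(1) that, of "\<lambda>x. ln (weight L h t x)"] by (simp add: lw_def)
  qed
  have "linear (\<lambda>v. complex_of_real (?E v))"
    using linear_compose[OF has_derivative_linear[OF E] bounded_linear.linear[OF bounded_linear_of_real]]
    by (simp add: o_def)
  note S = sum_del[OF this, of Vk]
  have "conn t (V, \<psi>) p $ k = (of_real (?E Vk) - \<i> * of_real (?E (\<i> *s Vk))) / 2"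
    unfolding conn_nth wirtinger_of_real(1)[OF E'] ax Vk_def by simp
  also have "\<dots> = (\<Sum>i\<in>UNIV. Vk $ i * (of_real (?E (axis i 1)) - \<i> * of_real (?E (axis i \<i>)))) / 2"
    unfolding S ..
  also have "\<dots> = (\<Sum>i\<in>UNIV. conn t (W, \<phi>) p $ i * Vk $ i)"
    unfolding conn_nth wirtinger_of_real(1)[OF E] by (simp add: sum_divide_distrib mult.commute)
  finally show ?thesis by (simp add: Vk_def)
qed

end

section \<open>Vanishing of the Ueda class\<close>

text \<open>For exchanging the sums over the coordinates of two charts.\<close>

lemma (in comm_monoid) finprod_swap:
  assumes "finite I" "finite J" "\<And>i j. i \<in> I \<Longrightarrow> j \<in> J \<Longrightarrow> f i j \<in> carrier G"
  shows "finprod G (\<lambda>i. finprod G (f i) J) I = finprod G (\<lambda>j. finprod G (\<lambda>i. f i j) I) J"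
  using assms(1,3)
proof (induction I rule: finite_induct)
  case (insert i I)
  have "finprod G (\<lambda>j. finprod G (\<lambda>i. f i j) (insert i I)) J =
      finprod G (\<lambda>j. f i j \<otimes> finprod G (\<lambda>i. f i j) I) J"
    using insert.prems insert.hyps
    by (intro finprod_cong) (auto simp: simp_implies_def Pi_def intro!: m_closed finprod_closed)
  also have "\<dots> = finprod G (f i) J \<otimes> finprod G (\<lambda>j. finprod G (\<lambda>i. f i j) I) J"
    using insert.prems by (intro finprod_multf) (auto intro!: finprod_closed)
  finally show ?case
    using insert by (simp add: Pi_def)
qed simp

context csub
begin

lemma O_sub_sum:
  assumes "openin T V" "\<And>j. j \<in> J \<Longrightarrow> g j \<in> sections (O_sub X A Y) V"
  shows "(\<lambda>x. \<Sum>j\<in>J. g j x) \<in> sections (O_sub X A Y) V"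
  using assms(2)
proof (induction J rule: infinite_finite_induct)
  case (insert j J)
  then have "(\<lambda>x. g j x + (\<Sum>j\<in>J. g j x)) \<in> sections (O_sub X A Y) V"
    by (intro O_sub_add) auto
  then show ?case using insert.hyps by simp
qed (use O_sub_const[OF assms(1), of 0] in simp_all)

lemma pe_sum_right:
  assumes z: "z \<in> Y" "z \<in> V" and V: "openin T V" and J: "finite J"
    and g: "\<And>j. j \<in> J \<Longrightarrow> g j \<in> sections (O_sub X A Y) V" and m: "m \<in> carrier (stalk X \<Omega> z)"
  shows "pe z m (germ T z (\<lambda>x. \<Sum>j\<in>J. g j x)) = finprod (P z) (\<lambda>j. pe z m (germ T z (g j))) J"
  using J g
proof (induction J rule: finite_induct)
  case empty
  interpret P: comm_group "P z" by (rule comm_group_pullback[OF z(1)])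
  show ?case using pe_zero_right[OF z(1) m] by simp
next
  case (insert j J)
  interpret P: comm_group "P z" by (rule comm_group_pullback[OF z(1)])
  have cl: "pe z m (germ T z (g i)) \<in> carrier (P z)" if "i \<in> insert j J" for i
    by (rule pe_closed[OF z(1) m germ_T_carrier[OF insert.prems[OF that] z(2)]])
  have "pe z m (germ T z (\<lambda>x. g j x + (\<Sum>j\<in>J. g j x))) =
      pe z m (germ T z (g j)) \<otimes>\<^bsub>P z\<^esub> pe z m (germ T z (\<lambda>x. \<Sum>j\<in>J. g j x))"
    using insert.prems by (intro pe_add_right[OF z _ _ m] O_sub_sum V) auto
  then show ?case
    using insert cl by (simp add: Pi_def)
qed

end

context flat_metric
begin

text \<open>The class of \<open>- \<partial> log |e|\<^sup>2\<close> in the pullback of the cotangent sheaf; its coefficients are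
  holomorphic along \<open>Y\<close> only, so it is not the germ of a holomorphic form on \<open>X\<close>.\<close>

definition bform where
  "bform t W \<phi> p = finprod (P p)
     (\<lambda>j. pe p (germ X p (ext_d A (\<lambda>x. \<phi> x $ j))) (germ T p (\<lambda>q. - conn t (W, \<phi>) q $ j))) UNIV"

lemma dz_section: "(W, \<phi>) \<in> A \<Longrightarrow> ext_d A (\<lambda>x. \<phi> x $ j) \<in> sections \<Omega> W"
  using chartD(1) holo_at_coordinate by (intro ext_d_section) auto

lemma dz_carrier: "(W, \<phi>) \<in> A \<Longrightarrow> p \<in> W \<Longrightarrow> germ X p (ext_d A (\<lambda>x. \<phi> x $ j)) \<in> carrier (stalk X \<Omega> p)"
  by (rule germ_\<Omega>_carrier[OF dz_section])

lemma bform_section: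
  assumes a: "adapted W \<phi> I" and t: "t \<in> bundle_trivs L"
  shows "bform t W \<phi> \<in> sections (module_pullback X A Y \<Omega>) (fst t \<inter> W \<inter> Y)"
proof -
  note c = adaptedD(1)[OF a]
  let ?V = "fst t \<inter> W \<inter> Y"
  have sec: "(\<lambda>q. - conn t (W, \<phi>) q $ j) \<in> sections (O_sub X A Y) ?V" for j
    by (rule O_sub_minus[OF conn_section[OF a t]])
  have op: "openin T ?V" using sec by (simp add: O_sub_section_iff)
  have dz: "(\<lambda>q. germ X q (ext_d A (\<lambda>x. \<phi> x $ j))) \<in> sections (inverse_image X Y \<Omega>) ?V" for j
    by (rule ab_sheaf.germ_section_inverse_image[OF ab_sheaf_Omega1 dz_section[OF c] op]) auto
  \<comment> \<open>Sections of the pullback are sums over an initial segment of the naturals, so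
    the index type \<open>'n\<close> has to be enumerated.\<close>
  obtain e where e: "bij_betw e {..<CARD('n)} (UNIV :: 'n set)"
    using ex_bij_betw_nat_finite[of "UNIV :: 'n set"] by (auto simp: atLeast0LessThan)
  show ?thesis
  proof (rule pullback_sectionI[OF op])
    fix y assume y: "y \<in> ?V"
    have "bform t W \<phi> z = finprod (P z) (\<lambda>j. pe z (germ X z (ext_d A (\<lambda>x. \<phi> x $ e j)))
        (germ T z (\<lambda>q. - conn t (W, \<phi>) q $ e j))) {..<CARD('n)}" if z: "z \<in> ?V" for z
    proof -
      interpret comm_group "P z" using z by (intro comm_group_pullback) auto
      have "e ` {..<CARD('n)} = UNIV" "inj_on e {..<CARD('n)}"
        using e by (auto simp: bij_betw_def)
      moreover have "pe z (germ X z (ext_d A (\<lambda>x. \<phi> x $ j))) (germ T z (\<lambda>q. - conn t (W, \<phi>) q $ j)) \<in> carrier (P z)" for j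
        by (rule pe_sections_closed(1)[OF dz sec z])
      ultimately show ?thesis
        unfolding bform_def
        using finprod_reindex[of "\<lambda>j. pe z (germ X z (ext_d A (\<lambda>x. \<phi> x $ j))) (germ T z (\<lambda>q. - conn t (W, \<phi>) q $ j))"
            e "{..<CARD('n)}"]
        by (simp add: Pi_def)
    qed
    then show "\<exists>N (k::nat) m h. y \<in> N \<and> N \<subseteq> ?V \<and> openin T N \<and>
        (\<forall>j<k. m j \<in> sections (inverse_image X Y \<Omega>) N \<and> h j \<in> sections (O_sub X A Y) N) \<and>
        (\<forall>z\<in>N. bform t W \<phi> z = finprod (P z) (\<lambda>j. pe z (m j z) (germ T z (h j))) {..<k})"
      using y op sec dz
      by (intro exI[of _ ?V] exI[of _ "CARD('n)"] exI[of _ "\<lambda>j q. germ X q (ext_d A (\<lambda>x. \<phi> x $ e j))"]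
          exI[of _ "\<lambda>j q. - conn t (W, \<phi>) q $ e j"]) auto
  qed
qed

text \<open>The differentials of the second chart are expanded in those of the first, the Jacobian
  entries are moved across the tensor sign, and the sums are exchanged. The resulting coefficients
  are those of \<open>conn\<close> in the first chart, by its transformation rule.\<close>

lemma bform_chart_independent:
  assumes a: "adapted W \<phi> I" and a': "adapted W' \<phi>' I'" and t: "t \<in> bundle_trivs L"
    and p: "p \<in> Y" "p \<in> fst t" "p \<in> W" "p \<in> W'"
  shows "bform t W' \<phi>' p = bform t W \<phi> p"
proof -
  interpret P: comm_group "P p" by (rule comm_group_pullback[OF p(1)])
  note c = adaptedD(1)[OF a] and c' = adaptedD(1)[OF a']
  define \<beta> where "\<beta> k q = - conn t (W', \<phi>') q $ k" for k q
  \<comment> \<open>The entry \<open>\<partial>\<phi>'_k / \<partial>\<phi>_j\<close> of the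
    Jacobian matrix; it is holomorphic on an open set of \<open>X\<close> and can therefore cross
    the tensor sign.\<close>
  define \<gamma> where "\<gamma> k j q = ext_d A (\<lambda>x. \<phi>' x $ k) q (W, \<phi>) $ j" for k j q
  define dz where "dz j = germ X p (ext_d A (\<lambda>x. \<phi> x $ j))" for j
  have dzc: "dz j \<in> carrier (stalk X \<Omega> p)" for j unfolding dz_def by (rule dz_carrier[OF c p(3)])
  have \<beta>sec: "\<beta> k \<in> sections (O_sub X A Y) (fst t \<inter> W' \<inter> Y)" for k
    unfolding \<beta>_def by (rule O_sub_minus[OF conn_section[OF a' t]])
  let ?V = "fst t \<inter> (W \<inter> W') \<inter> Y"
  have opV: "openin T ?V"
    using htriv_open[OF htrivI[OF t]] chartD(1)[OF c] chartD(1)[OF c'] by (intro openin_T_Int) blast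
  have pV: "p \<in> ?V" using p by blast
  have opWW: "openin X (W \<inter> W')" using chartD(1)[OF c] chartD(1)[OF c'] by blast
  have \<gamma>holo: "\<forall>x\<in>W \<inter> W'. holo_at A (\<gamma> k j) x" for k j
    using dz_section[OF c', of k] c unfolding \<gamma>_def Omega1_section_iff by auto
  have term_sec: "(\<lambda>q. \<gamma> k j q * \<beta> k q) \<in> sections (O_sub X A Y) ?V" for k j
    by (rule O_sub_mult_holo[OF O_sub_restrict[OF \<beta>sec opV] opWW \<gamma>holo]) auto
  have term_cl: "pe p (dz j) (germ T p (\<lambda>q. \<gamma> k j q * \<beta> k q)) \<in> carrier (P p)" for k j
    by (rule pe_closed[OF p(1) dzc germ_T_carrier[OF term_sec pV]])
  have pV': "p \<in> fst t \<inter> W' \<inter> Y" using p by blast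
  have "bform t W' \<phi>' p = finprod (P p) (\<lambda>k. finprod (P p) (\<lambda>j. pe p (dz j) (germ T p (\<lambda>q. \<gamma> k j q * \<beta> k q))) UNIV) UNIV"
  proof -
    have "pe p (germ X p (ext_d A (\<lambda>x. \<phi>' x $ k))) (germ T p (\<beta> k)) =
        finprod (P p) (\<lambda>j. pe p (dz j) (germ T p (\<lambda>q. \<gamma> k j q * \<beta> k q))) UNIV" for k
      unfolding dz_def \<gamma>_def by (rule pe_expand[OF p(1,4,3) c dz_section[OF c'] \<beta>sec pV'])
    moreover have "bform t W' \<phi>' p = finprod (P p) (\<lambda>k. pe p (germ X p (ext_d A (\<lambda>x. \<phi>' x $ k))) (germ T p (\<beta> k))) UNIV"
      by (simp add: bform_def \<beta>_def[abs_def])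
    ultimately show ?thesis by simp
  qed
  also have "\<dots> = finprod (P p) (\<lambda>j. finprod (P p) (\<lambda>k. pe p (dz j) (germ T p (\<lambda>q. \<gamma> k j q * \<beta> k q))) UNIV) UNIV"
    by (rule P.finprod_swap) (auto intro: term_cl)
  also have "\<dots> = finprod (P p) (\<lambda>j. pe p (dz j) (germ T p (\<lambda>q. \<Sum>k\<in>UNIV. \<gamma> k j q * \<beta> k q))) UNIV"
    by (simp only: pe_sum_right[OF p(1) pV opV finite term_sec dzc])
  also have "\<dots> = bform t W \<phi> p"
  proof -
    have "germ T p (\<lambda>q. \<Sum>k\<in>UNIV. \<gamma> k j q * \<beta> k q) = germ T p (\<lambda>q. - conn t (W, \<phi>) q $ j)" for j
    proof (rule germ_cong[OF opV pV])
      fix q assume q: "q \<in> ?V"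
      then show "(\<Sum>k\<in>UNIV. \<gamma> k j q * \<beta> k q) = - conn t (W, \<phi>) q $ j"
        using conn_transform[OF t c' _ c, of q j] c
        by (simp add: \<gamma>_def \<beta>_def ext_d_def sum_negf mult.commute)
    qed
    then show ?thesis by (simp add: bform_def dz_def)
  qed
  finally show ?thesis .
qed

text \<open>In one chart this is the identity \<open>- conn t = (conn t' - conn t) - conn t'\<close>
  of coefficients, whose bracket is the logarithmic derivative of the transition function.
  Independence of the chart admits a different adapted chart for \<open>t'\<close>.\<close>

lemma bform_coboundary:
  assumes a: "adapted W \<phi> I" and a': "adapted W' \<phi>' I'"
    and t: "t \<in> bundle_trivs L" "t' \<in> bundle_trivs L"
    and p: "p \<in> Y" "p \<in> fst t" "p \<in> fst t'" "p \<in> W" "p \<in> W'"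
  shows "bform t W \<phi> p = pe p (germ X p (dlog A (transition L t t'))) (germ T p (\<lambda>x. 1)) \<otimes>\<^bsub>P p\<^esub> bform t' W' \<phi>' p"
proof -
  interpret P: comm_group "P p" by (rule comm_group_pullback[OF p(1)])
  note c = adaptedD(1)[OF a]
  let ?V = "fst t \<inter> fst t' \<inter> W \<inter> Y"
  have opV: "openin T ?V"
    using htriv_open[OF htrivI[OF t(1)]] htriv_open[OF htrivI[OF t(2)]] chartD(1)[OF c]
    by (intro openin_T_Int) blast
  have pV: "p \<in> ?V" using p by blast
  have conn_sec: "(\<lambda>q. conn s (W, \<phi>) q $ j) \<in> sections (O_sub X A Y) ?V" if "s = t \<or> s = t'" for s j
    by (rule O_sub_restrict[OF conn_section[OF a] opV]) (use that t in auto)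
  have sec: "(\<lambda>q. - conn t (W, \<phi>) q $ j) \<in> sections (O_sub X A Y) ?V"
    "(\<lambda>q. - conn t' (W, \<phi>) q $ j) \<in> sections (O_sub X A Y) ?V"
    "(\<lambda>q. conn t' (W, \<phi>) q $ j) \<in> sections (O_sub X A Y) ?V" for j
    using O_sub_minus[OF conn_sec[of t j]] O_sub_minus[OF conn_sec[of t' j]] conn_sec[of t' j] by simp_all
  have diff: "(\<lambda>q. conn t' (W, \<phi>) q $ j + - conn t (W, \<phi>) q $ j) \<in> sections (O_sub X A Y) ?V" for j
    by (rule O_sub_add[OF sec(3,1)])
  define dz where "dz j = germ X p (ext_d A (\<lambda>x. \<phi> x $ j))" for j
  have dzc: "dz j \<in> carrier (stalk X \<Omega> p)" for j unfolding dz_def by (rule dz_carrier[OF c p(4)])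
  have \<omega>: "dlog A (transition L t t') \<in> sections \<Omega> (fst t \<inter> fst t')"
    using dlog_section[OF transition_section[OF htrivI[OF t(1)] htrivI[OF t(2)]]] dO_subset_Omega1 by blast
  have pt: "p \<in> fst t \<inter> fst t'" using p by blast
  have one: "(\<lambda>x. 1) \<in> sections (O_sub X A Y) Y"
    by (rule O_sub_const) (use openin_topspace[of T] in simp)
  have "pe p (germ X p (dlog A (transition L t t'))) (germ T p (\<lambda>x. 1)) =
      finprod (P p) (\<lambda>j. pe p (dz j) (germ T p (\<lambda>q. dlog A (transition L t t') q (W, \<phi>) $ j * 1))) UNIV"
    unfolding dz_def by (rule pe_expand[OF p(1) pt p(4) c \<omega> one p(1)])
  also have "\<dots> = finprod (P p) (\<lambda>j. pe p (dz j) (germ T p (\<lambda>q. conn t' (W, \<phi>) q $ j + - conn t (W, \<phi>) q $ j))) UNIV"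
  proof -
    have "germ T p (\<lambda>q. dlog A (transition L t t') q (W, \<phi>) $ j * 1) =
        germ T p (\<lambda>q. conn t' (W, \<phi>) q $ j + - conn t (W, \<phi>) q $ j)" for j
      by (rule germ_cong[OF opV pV]) (use dlog_transition[OF t c] in auto)
    then show ?thesis by simp
  qed
  finally have "pe p (germ X p (dlog A (transition L t t'))) (germ T p (\<lambda>x. 1)) \<otimes>\<^bsub>P p\<^esub> bform t' W \<phi> p =
      finprod (P p) (\<lambda>j. pe p (dz j) (germ T p (\<lambda>q. conn t' (W, \<phi>) q $ j + - conn t (W, \<phi>) q $ j)) \<otimes>\<^bsub>P p\<^esub>
        pe p (dz j) (germ T p (\<lambda>q. - conn t' (W, \<phi>) q $ j))) UNIV"
    unfolding bform_def dz_def[symmetric]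
    using pe_closed[OF p(1) dzc germ_T_carrier[OF diff pV]] pe_closed[OF p(1) dzc germ_T_carrier[OF sec(2) pV]]
    by (simp add: P.finprod_multf Pi_def)
  also have "\<dots> = finprod (P p) (\<lambda>j. pe p (dz j) (germ T p (\<lambda>q. - conn t (W, \<phi>) q $ j))) UNIV"
  proof -
    have "pe p (dz j) (germ T p (\<lambda>q. conn t' (W, \<phi>) q $ j + - conn t (W, \<phi>) q $ j)) \<otimes>\<^bsub>P p\<^esub>
        pe p (dz j) (germ T p (\<lambda>q. - conn t' (W, \<phi>) q $ j)) = pe p (dz j) (germ T p (\<lambda>q. - conn t (W, \<phi>) q $ j))" for j
      using pe_add_right[OF p(1) pV diff[of j] sec(2)[of j] dzc[of j]] by simp
    then show ?thesis by (simp only:)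
  qed
  also have "\<dots> = bform t W \<phi> p" by (simp add: bform_def dz_def)
  finally show ?thesis
    using bform_chart_independent[OF a a' t(2) p(1,3,4,5)] by simp
qed

text \<open>At each point \<open>x\<close> of \<open>Y\<close> a trivialization and an adapted chart
  are chosen. The corresponding sections \<open>bform\<close> form a 0-cochain on the common
  domains, which exhibits the Ueda cocycle as cohomologous to the trivial one.\<close>

lemma ueda_class_trivial: "ueda_class X A Y L = \<one>\<^bsub>H1 T (module_pullback X A Y \<Omega>)\<^esub>"
proof -
  have "\<forall>x\<in>topspace X. \<exists>t. t \<in> bundle_trivs L \<and> x \<in> fst t"
    using bundle_triv_exists by metis
  then obtain t where t: "\<And>x. x \<in> topspace X \<Longrightarrow> t x \<in> bundle_trivs L \<and> x \<in> fst (t x)" by metis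
  then have fam: "triv_family t" by (simp add: triv_family_def htrivI)
  have "\<forall>x\<in>Y. \<exists>W \<phi> I. adapted W \<phi> I \<and> x \<in> W" using adapted_exists by metis
  then obtain W \<phi> I where a: "\<And>x. x \<in> Y \<Longrightarrow> adapted (W x) (\<phi> x) (I x) \<and> x \<in> W x" by metis
  have tY: "t x \<in> bundle_trivs L" "x \<in> fst (t x)" if "x \<in> Y" for x
    using t that Y_subset by auto
  let ?S = "module_pullback X A Y \<Omega>"
  let ?h = "\<lambda>p a. pe p (\<Union>f\<in>a. germ X p (dlog A f)) (germ T p (\<lambda>x. 1))"
  let ?u = "push_cochain ?h (ab_sheaf.restrict_cochain X Y (triv_cochain t))"
  have fst_u: "fst ?u = (\<lambda>x. fst (t x) \<inter> Y)"
    by (simp add: push_cochain_def ab_sheaf.restrict_cochain_def[OF ab_sheaf_units] triv_cochain_def)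
  have u: "(fst ?u, snd ?u) \<in> cocycles T ?S" using ueda_class_eq(2)[OF fam] by simp
  have one: "(\<lambda>x. topspace T, \<lambda>x y p. \<one>\<^bsub>vals ?S p\<^esub>) \<in> cocycles T ?S"
    using ab_sheaf.sec_one[OF ab_sheaf_pullback, of Y] openin_topspace[of T] comm_group_pullback
    by (auto simp: cocycles_def comm_group_def group_def monoid.l_one)
  have "((fst ?u, snd ?u), (\<lambda>x. topspace T, \<lambda>x y p. \<one>\<^bsub>vals ?S p\<^esub>)) \<in> cohomologous T ?S"
  proof (rule ab_sheaf.cohomologousI[OF ab_sheaf_pullback u one,
        where V = "\<lambda>x. fst (t x) \<inter> W x \<inter> Y" and b = "\<lambda>x. bform (t x) (W x) (\<phi> x)"], unfold topspace_T)
    fix x assume x: "x \<in> Y"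
    have sec: "bform (t x) (W x) (\<phi> x) \<in> sections ?S (fst (t x) \<inter> W x \<inter> Y)"
      using a[OF x] tY[OF x] bform_section by blast
    then show "openin T (fst (t x) \<inter> W x \<inter> Y) \<and> x \<in> fst (t x) \<inter> W x \<inter> Y \<and>
        fst (t x) \<inter> W x \<inter> Y \<subseteq> fst ?u x \<inter> Y \<and> bform (t x) (W x) (\<phi> x) \<in> sections ?S (fst (t x) \<inter> W x \<inter> Y)"
      unfolding fst_u using ab_sheaf.open_sec[OF ab_sheaf_pullback sec] a[OF x] tY[OF x] x by blast
    fix y p assume y: "y \<in> Y" and p: "p \<in> fst (t x) \<inter> W x \<inter> Y \<inter> (fst (t y) \<inter> W y \<inter> Y)"
    have pY: "p \<in> Y" using p by blast
    interpret P: comm_group "P p" by (rule comm_group_pullback[OF pY])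
    have "bform (t x) (W x) (\<phi> x) p \<in> carrier (P p)"
      using ab_sheaf.sec_closed[OF ab_sheaf_pullback sec, of p] p by simp
    moreover have "bform (t x) (W x) (\<phi> x) p = snd ?u x y p \<otimes>\<^bsub>P p\<^esub> bform (t y) (W y) (\<phi> y) p"
      unfolding ueda_cochain_apply[OF pY]
      using p a[OF x] a[OF y] tY[OF x] tY[OF y] by (intro bform_coboundary) auto
    ultimately show "bform (t x) (W x) (\<phi> x) p \<otimes>\<^bsub>vals ?S p\<^esub> \<one>\<^bsub>vals ?S p\<^esub> =
        snd ?u x y p \<otimes>\<^bsub>vals ?S p\<^esub> bform (t y) (W y) (\<phi> y) p"
      by simp
  qed
  from ab_sheaf.coh_class_eq[OF ab_sheaf_pullback this] show ?thesis
    unfolding ueda_class_eq(1)[OF fam] by (simp add: H1_def)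
qed

end

theorem mainTheorem3:
  fixes X :: "'a topology" and A :: "('a, 'n::finite) chart set"
    and Y :: "'a set" and L :: "('a, 'e) line_bundle" and r :: nat
  assumes "complex_manifold X A"
    and "complex_submanifold X A Y"
    and "compactin X Y"
    and "holomorphic_line_bundle X (O_sheaf X A) L"
    and "unitary_flat (subtopology X Y) (O_sub X A Y) (restrict_bundle L Y)"
    and "r \<ge> 2"
    and "ueda_class X A Y L \<noteq> \<one>\<^bsub>H1 (subtopology X Y) (module_pullback X A Y (Omega1 X A))\<^esub>"
  shows "\<not> (\<exists>h. hermitian_metric L h \<and> metric_of_class A L r h \<and> semipositive_curvature A L h)"
proof
  assume "\<exists>h. hermitian_metric L h \<and> metric_of_class A L r h \<and> semipositive_curvature A L h"
  then obtain h where h: "hermitian_metric L h" "metric_of_class A L r h" "semipositive_curvature A L h"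
    by blast
  interpret csub_bundle X A Y L
    using assms(1,2,4) by unfold_locales (auto simp: complex_submanifold_def)
  obtain G :: "'a \<Rightarrow> real" where G: "\<And>y t. y \<in> Y \<Longrightarrow> t \<in> bundle_trivs L \<Longrightarrow> y \<in> fst t \<Longrightarrow>
      \<exists>N F. openin X N \<and> y \<in> N \<and> N \<subseteq> fst t \<and> (\<forall>p\<in>N. holo_at A F p \<and> F p \<noteq> 0) \<and>
        (\<forall>p\<in>N \<inter> Y. G p = weight L h t p * (cmod (F p))\<^sup>2)"
    using flat_frame_norm[OF assms(5) h(1)] by blast
  interpret flat_metric X A Y L h r G
    by unfold_locales (fact assms h G)+
  show False using ueda_class_trivial assms(7) by blast
qed

end
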